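(* Let $m,n\ge1$ and let $\mathbf r=(r_1,\dots,r_n)$ be positive real numbers. If $\mathbf r$ does not lie on a wall, then $M_{\mathbf r}$ is a smooth manifold of (real) dimension $2m(n-m-2)$.
   Context: For a unit vector $w\in\mathbb C^{m+1}$, $w\otimes w^*$ is the projection $v\mapsto(v,w)w$. For $r>0$, $\mathcal O_r=\{r\,w\otimes w^*:\|w\|=1\}$, a set of $(m+1)\times(m+1)$ Hermitian matrices. $\Lambda=\frac1{m+1}\sum_i r_i$, $\widetilde M_{\mathbf r}=\{(e_1,\dots,e_n)\in\prod_i\mathcal O_{r_i}:\sum_i e_i=\Lambda\mathbb I\}$, and $M_{\mathbf r}=\widetilde M_{\mathbf r}/U(m+1)$ (simultaneous conjugation), with smooth structure for which $\widetilde M_{\mathbf r}\subset\prod_i\mathcal O_{r_i}$ is a submanifold and $\widetilde M_{\mathbf r}\to M_{\mathbf r}$ a submersion. The empty set counts as a manifold of any dimension. Walls: let $C(n,m+1)$ be the set of $\mathbf r\in(\mathbb R_{>0})^n$ with $M_{\mathbf r}\neq\emptyset$ (equivalently $m r_i\le\sum_{j\ne i}r_j$ for all $i$). For $1\le k\le m$ and a partition $\{1,\dots,n\}=I\sqcup J$ into nonempty subsets, the wall $W_{I,J,k}$ is $\{\mathbf r\in C(n,m+1): k\sum_{i\in I}r_i=(m-k+1)\sum_{j\in J}r_j\}$. *)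

theory Defs
  imports "HOL-Analysis.Analysis"
begin

text \<open>\<open>C_on k f S\<close> is meant for open \<open>S\<close>, where \<open>frechet_derivative f (at x) v\<close> is the
  directional derivative.\<close>

primrec C_on ::
  "nat \<Rightarrow> ('a::euclidean_space \<Rightarrow> 'b::euclidean_space) \<Rightarrow> 'a set \<Rightarrow> bool" where
  "C_on 0 f S \<longleftrightarrow> continuous_on S f"
| "C_on (Suc k) f S \<longleftrightarrow> (\<forall>x\<in>S. f differentiable (at x)) \<and>
     (\<forall>v. C_on k (\<lambda>x. frechet_derivative f (at x) v) S)"

text \<open>On an arbitrary set, a map is smooth if it locally extends to a smooth map on an open set.
  On a set that is relatively open in a linear subspace \<open>V\<close> this is ordinary smoothness on an
  open subset of \<open>V\<close>.\<close>

definition smooth_on ::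
  "'a set \<Rightarrow> ('a::euclidean_space \<Rightarrow> 'b::euclidean_space) \<Rightarrow> bool" where
  "smooth_on S f \<longleftrightarrow> (\<forall>x\<in>S. \<exists>N g. open N \<and> x \<in> N \<and>
     (\<forall>k. C_on k g N) \<and> (\<forall>y\<in>S \<inter> N. g y = f y))"

text \<open>A chart is a triple \<open>(U, \<phi>, V)\<close>: its domain, its coordinate map and its model space. The
  role of the model space \<open>\<real>\<^sup>d\<close> is played by a \<open>d\<close>-dimensional linear subspace \<open>V\<close> of a Euclidean
  space \<open>'e\<close>; in this way \<open>d\<close> is a term rather than a type, and may be \<open>0\<close>.\<close>

type_synonym ('a, 'e) chart = "'a set \<times> ('a \<Rightarrow> 'e) \<times> 'e set"

text \<open>An atlas consists of pairwise smoothly compatible charts, of a Hausdorff second countable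
  space. The dimension is an integer: a chart forces it to be nonnegative, and the empty space
  is a manifold of every dimension (with the empty atlas).\<close>

definition smooth_atlas ::
  "int \<Rightarrow> 'a topology \<Rightarrow> ('a, 'e::euclidean_space) chart set \<Rightarrow> bool" where
  "smooth_atlas d X A \<longleftrightarrow>
     Hausdorff_space X \<and> second_countable X \<and>
     topspace X = (\<Union>(U, \<phi>, V)\<in>A. U) \<and>
     (\<forall>(U, \<phi>, V)\<in>A. openin X U \<and> subspace V \<and> int (dim V) = d \<and>
        openin (top_of_set V) (\<phi> ` U) \<and>
        homeomorphic_map (subtopology X U) (top_of_set (\<phi> ` U)) \<phi>) \<and>
     (\<forall>(U, \<phi>, V)\<in>A. \<forall>(U', \<phi>', V')\<in>A.
        smooth_on (\<phi> ` (U \<inter> U')) (\<lambda>x. \<phi>' (inv_into U \<phi> x)))"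

text \<open>For a subset of a Euclidean space: the local diffeomorphisms to \<open>d\<close>-dimensional linear
  spaces. Transition maps between these are automatically smooth.\<close>

definition euclidean_charts :: "nat \<Rightarrow> 'a set \<Rightarrow> ('a::euclidean_space, 'a) chart set" where
  "euclidean_charts d Y = {(U, \<phi>, V). openin (top_of_set Y) U \<and> subspace V \<and> dim V = d \<and>
     openin (top_of_set V) (\<phi> ` U) \<and> inj_on \<phi> U \<and>
     smooth_on U \<phi> \<and> smooth_on (\<phi> ` U) (inv_into U \<phi>)}"

definition euclidean_submanifold :: "nat \<Rightarrow> 'a::euclidean_space set \<Rightarrow> bool" where
  "euclidean_submanifold d Y \<longleftrightarrow> (\<forall>p\<in>Y. \<exists>(U, \<phi>, V)\<in>euclidean_charts d Y. p \<in> U)"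

text \<open>\<open>X\<close> is a \<open>k\<close>-dimensional (embedded) submanifold of the manifold \<open>Y\<close>: around each of its
  points there is a slice chart of \<open>Y\<close>.\<close>

definition submanifold_of ::
  "nat \<Rightarrow> 'a::euclidean_space set \<Rightarrow> 'a set \<Rightarrow> bool" where
  "submanifold_of k X Y \<longleftrightarrow> X \<subseteq> Y \<and> (\<exists>d. euclidean_submanifold d Y \<and>
     (\<forall>p\<in>X. \<exists>(U, \<phi>, V)\<in>euclidean_charts d Y. \<exists>W.
        p \<in> U \<and> subspace W \<and> W \<subseteq> V \<and> dim W = k \<and> \<phi> ` (X \<inter> U) = \<phi> ` U \<inter> W))"

text \<open>The derivative \<open>F'\<close> is only
  determined on the model space \<open>V\<close>, in which \<open>D\<close> is open.\<close>

definition submersion ::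
  "'a topology \<Rightarrow> ('a, 'e::euclidean_space) chart set \<Rightarrow>
   'b topology \<Rightarrow> ('b, 'f::euclidean_space) chart set \<Rightarrow> ('a \<Rightarrow> 'b) \<Rightarrow> bool" where
  "submersion X A Y B f \<longleftrightarrow> continuous_map X Y f \<and>
     (\<forall>(U, \<phi>, V)\<in>A. \<forall>(U', \<psi>, V')\<in>B.
        let D = \<phi> ` (U \<inter> f -` U'); F = (\<lambda>x. \<psi> (f (inv_into U \<phi> x))) in
        smooth_on D F \<and>
        (\<forall>x\<in>D. \<exists>F'. (F has_derivative F') (at x within D) \<and> F' ` V = V'))"

definition quotient_topology :: "'a topology \<Rightarrow> ('a \<Rightarrow> 'b) \<Rightarrow> 'b topology" where
  "quotient_topology X f = topology (\<lambda>U. U \<subseteq> f ` topspace X \<and> openin X {x \<in> topspace X. f x \<in> U})"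

lemma openin_quotient_topology:
  "openin (quotient_topology X f) U \<longleftrightarrow>
     U \<subseteq> f ` topspace X \<and> openin X {x \<in> topspace X. f x \<in> U}"
proof -
  let ?P = "\<lambda>U. U \<subseteq> f ` topspace X \<and> openin X {x \<in> topspace X. f x \<in> U}"
  have "?P (S \<inter> T)" if "?P S" "?P T" for S T
  proof -
    have "{x \<in> topspace X. f x \<in> S \<inter> T} = {x \<in> topspace X. f x \<in> S} \<inter> {x \<in> topspace X. f x \<in> T}"
      by auto
    with that show ?thesis by auto
  qed
  moreover have "?P (\<Union>K)" if "\<forall>S\<in>K. ?P S" for K
  proof -
    have "{x \<in> topspace X. f x \<in> \<Union>K} = (\<Union>S\<in>K. {x \<in> topspace X. f x \<in> S})"
      by auto
    with that show ?thesis by auto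
  qed
  ultimately have "istopology ?P"
    unfolding istopology_def by blast
  then show ?thesis
    by (simp add: quotient_topology_def topology_inverse')
qed

lemma topspace_quotient_topology [simp]: "topspace (quotient_topology X f) = f ` topspace X"
proof -
  have "{x \<in> topspace X. f x \<in> f ` topspace X} = topspace X" by auto
  then have "openin (quotient_topology X f) (f ` topspace X)"
    by (simp add: openin_quotient_topology)
  then show ?thesis
    by (metis openin_quotient_topology openin_subset openin_topspace subset_antisym)
qed

lemma quotient_map_quotient_topology: "quotient_map X (quotient_topology X f) f"
  by (auto simp: quotient_map_def openin_quotient_topology)

text \<open>The type \<open>'d\<close> has \<open>m + 1\<close> elements, and \<open>'n\<close> has \<open>n\<close>.\<close>

definition rank_one :: "complex^'d \<Rightarrow> complex^'d^'d" where
  "rank_one w = (\<chi> i j. w $ i * cnj (w $ j))"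

lemma rank_one_mult_vec: "rank_one w *v v = (\<Sum>j\<in>UNIV. v $ j * cnj (w $ j)) *s w"
  by (simp add: rank_one_def matrix_vector_mult_def vec_eq_iff sum_distrib_left mult_ac)

definition weighted_projections :: "real \<Rightarrow> (complex^'d^'d) set" where
  "weighted_projections \<rho> = {\<rho> *\<^sub>R rank_one w | w. norm w = 1}"

definition projections_product :: "real^'n \<Rightarrow> (complex^'d^'d^'n) set" where
  "projections_product r = {e. \<forall>i. e $ i \<in> weighted_projections (r $ i)}"

definition Mtilde :: "real^'n \<Rightarrow> (complex^'d^'d^'n) set" where
  "Mtilde r = {e \<in> projections_product r.
     (\<Sum>i\<in>UNIV. e $ i) = ((\<Sum>i\<in>UNIV. r $ i) / real CARD('d)) *\<^sub>R mat 1}"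

definition conj_transpose :: "complex^'d^'d \<Rightarrow> complex^'d^'d" where
  "conj_transpose u = (\<chi> i j. cnj (u $ j $ i))"

definition unitary :: "complex^'d^'d \<Rightarrow> bool" where
  "unitary u \<longleftrightarrow> conj_transpose u ** u = mat 1 \<and> u ** conj_transpose u = mat 1"

definition unitary_orbit :: "complex^'d^'d^'n \<Rightarrow> (complex^'d^'d^'n) set" where
  "unitary_orbit e = {(\<chi> i. u ** e $ i ** conj_transpose u) | u. unitary u}"

definition moduli_space :: "real^'n \<Rightarrow> (complex^'d^'d^'n) set set" where
  "moduli_space r = unitary_orbit ` Mtilde r"

definition moduli_topology :: "real^'n \<Rightarrow> (complex^'d^'d^'n) set topology" where
  "moduli_topology r = quotient_topology (top_of_set (Mtilde r)) unitary_orbit"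

lemma topspace_moduli_topology: "topspace (moduli_topology r) = moduli_space r"
  by (simp add: moduli_topology_def moduli_space_def)

definition polygon_cone :: "'d::finite itself \<Rightarrow> (real^'n) set" where
  "polygon_cone _ = {r. (\<forall>i. 0 < r $ i) \<and> (moduli_space r :: (complex^'d^'d^'n) set set) \<noteq> {}}"

text \<open>The factor \<open>m - k + 1\<close> is \<open>CARD('d) - k\<close>.\<close>

definition wall :: "'d::finite itself \<Rightarrow> 'n set \<Rightarrow> 'n set \<Rightarrow> nat \<Rightarrow> (real^'n) set" where
  "wall T I J k = {r \<in> polygon_cone T.
     real k * (\<Sum>i\<in>I. r $ i) = (real CARD('d) - real k) * (\<Sum>j\<in>J. r $ j)}"

definition on_wall :: "'d::finite itself \<Rightarrow> real^'n \<Rightarrow> bool" where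
  "on_wall T r \<longleftrightarrow> (\<exists>I J k. I \<union> J = UNIV \<and> I \<inter> J = {} \<and> I \<noteq> {} \<and> J \<noteq> {} \<and>
     1 \<le> k \<and> k < CARD('d) \<and> r \<in> wall T I J k)"

end

theory Submission
  imports Defs
begin

text \<open>Let \<open>p\<^sub>i = r\<^sub>i w\<^sub>i \<otimes> w\<^sub>i\<^sup>*\<close> be a point of the level set \<open>X\<close> of \<open>\<mu>(e) = \<Sum> e\<^sub>i\<close> in the product
  \<open>Y\<close> of the orbits. Off the walls the lines of the \<open>w\<^sub>i\<close> admit no orthogonal partition, hence the
  \<open>p\<^sub>i\<close> have no common invariant subspace and only scalars commute with all of them. By duality \<open>\<mu>\<close>
  maps the tangent space of \<open>Y\<close> onto the traceless Hermitian matrices, so \<open>X\<close> is a submanifold,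
  and the orbit of \<open>p\<close> has dimension \<open>(m+1)\<^sup>2 - 1\<close>.

  All charts come from smooth retractions. Irreducibility gives noncommutative polynomials \<open>f\<^sub>j\<close> such
  that the vectors \<open>f\<^sub>j(x) w\<^sub>1(x)\<close> form a frame for \<open>x\<close> in an invariant neighbourhood of the orbit. The
  matrices of \<open>x\<close> in the orthonormalised frame form a tuple \<open>\<sigma>(x)\<close> in the orbit of \<open>x\<close>, and \<open>\<sigma>\<close> is
  constant on orbits. So \<open>\<sigma>\<close> is a retraction onto a slice, which is a chart domain of the quotient;
  its dimension is that of \<open>X\<close> minus that of the orbit, because the derivative of \<open>\<sigma>\<close> kills exactly
  the tangent space of the orbit.\<close>

section \<open>Calculus of smooth maps\<close>

text \<open>Why a smooth retraction yields a chart: \<open>\<rho> (\<rho> x) = \<rho> x\<close>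
  makes the derivative \<open>L\<close> at a fixed point a linear projection. Its range is the
  tangent space of the image, and subtracting it controls the transversal directions, so the
  straightening map has identity derivative and the inverse function theorem applies. Why the walls
  are indexed by \<open>k\<close>: an orthogonal partition would turn the partial sum over one
  block, divided by \<Lambda>, into a projection, and \<open>k\<close> is its rank. The obstacle to
  a slice is that a matrix of rank one determines its unit vector only up to a phase.
  \<open>\<sigma>\<close> is therefore built from expressions in which the phase cancels. To find
  the kernel of its derivative, a smooth but non-unitary intertwiner \<open>h\<close> replaces the
  conjugating unitary, and the skew-Hermitian part of its derivative is extracted afterwards. The
  same invariants separate orbits, which gives the Hausdorff property. The count: the product has
  dimension 2mn; the level equation and the orbit each cost (m+1)^2 - 1, and 2mn - 2((m+1)^2 - 1) =
  2m(n-m-2).\<close>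

lemma C_on_cong:
  assumes "open S" "C_on k f S" "\<And>x. x \<in> S \<Longrightarrow> f x = g x"
  shows "C_on k g S"
  using assms(2,3)
proof (induction k arbitrary: f g)
  case 0
  then show ?case by (auto cong: continuous_on_cong)
next
  case (Suc k)
  have "frechet_derivative f (at x) = frechet_derivative g (at x)" if "x \<in> S" for x
    using frechet_derivative_transform_within_open[of f x S g] Suc.prems that assms(1) by auto
  moreover have "g differentiable (at x)" if "x \<in> S" for x
    using Suc.prems that assms(1)
    by (metis C_on.simps(2) differentiable_def has_derivative_transform_within_open)
  ultimately show ?case
    using Suc.prems(1) Suc.IH by (metis (no_types, lifting) C_on.simps(2))
qed

lemma C_on_Suc_imp: "C_on (Suc k) f S \<Longrightarrow> C_on k f S"
proof (induction k arbitrary: f)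
  case 0
  then show ?case
    by (auto intro: continuous_at_imp_continuous_on differentiable_imp_continuous_within)
next
  case (Suc k)
  then show ?case by (metis C_on.simps(2))
qed

lemma C_on_SucI:
  assumes "open S" "\<And>x. x \<in> S \<Longrightarrow> (f has_derivative f' x) (at x)"
    and "\<And>v. C_on k (\<lambda>x. f' x v) S"
  shows "C_on (Suc k) f S"
proof -
  have "frechet_derivative f (at x) = f' x" if "x \<in> S" for x
    using assms(2)[OF that] frechet_derivative_at by metis
  then show ?thesis
    using assms C_on_cong[OF assms(1) assms(3)]
    by (auto simp: differentiable_def)
qed

lemma C_on_SucD:
  assumes "C_on (Suc k) f S" "x \<in> S"
  shows "(f has_derivative frechet_derivative f (at x)) (at x)"
  using assms frechet_derivative_works by auto

lemma C_on_subset: "C_on k f S \<Longrightarrow> T \<subseteq> S \<Longrightarrow> C_on k f T"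
  by (induction k arbitrary: f) (auto intro: continuous_on_subset)

lemma C_on_continuous: "C_on k f S \<Longrightarrow> continuous_on S f"
  by (induction k) (auto dest: C_on_Suc_imp simp del: C_on.simps(2))

lemma C_on_const: "open S \<Longrightarrow> C_on k (\<lambda>x. c) S"
proof (induction k arbitrary: c)
  case (Suc k)
  show ?case by (rule C_on_SucI[where f' = "\<lambda>x h. 0"]) (use Suc in auto)
qed auto

lemma C_on_bounded_linear:
  assumes "open S" "bounded_linear f"
  shows "C_on k f S"
proof (cases k)
  case 0
  then show ?thesis using assms by (simp add: linear_continuous_on)
next
  case (Suc j)
  then show ?thesis
    using C_on_SucI[OF assms(1), of f "\<lambda>x. f" j] bounded_linear_imp_has_derivative[OF assms(2)]
      C_on_const[OF assms(1)] by auto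
qed

lemma C_on_id: "open S \<Longrightarrow> C_on k (\<lambda>x. x) S"
  by (intro C_on_bounded_linear bounded_linear_ident)

lemma C_on_add:
  assumes "open S" "C_on k f S" "C_on k g S"
  shows "C_on k (\<lambda>x. f x + g x) S"
  using assms(2,3)
proof (induction k arbitrary: f g)
  case 0
  then show ?case by (auto intro: continuous_on_add)
next
  case (Suc k)
  show ?case
  proof (rule C_on_SucI[OF assms(1)])
    show "((\<lambda>x. f x + g x) has_derivative
        (\<lambda>h. frechet_derivative f (at x) h + frechet_derivative g (at x) h)) (at x)" if "x \<in> S" for x
      using Suc.prems that by (intro has_derivative_add C_on_SucD)
    show "C_on k (\<lambda>x. frechet_derivative f (at x) v + frechet_derivative g (at x) v) S" for v
      using Suc by auto
  qed
qed

lemma C_on_sum: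
  assumes "open S" "\<And>i. i \<in> I \<Longrightarrow> C_on k (f i) S"
  shows "C_on k (\<lambda>x. \<Sum>i\<in>I. f i x) S"
  using assms(2)
  by (induction I rule: infinite_finite_induct) (auto intro: C_on_add C_on_const assms(1))

lemma C_on_bilinear:
  fixes prod :: "'b::euclidean_space \<Rightarrow> 'c::euclidean_space \<Rightarrow> 'd::euclidean_space"
  assumes "bounded_bilinear prod" "open S" "C_on k f S" "C_on k g S"
  shows "C_on k (\<lambda>x. prod (f x) (g x)) S"
  using assms(3,4)
proof (induction k arbitrary: f g)
  case 0
  then show ?case using bounded_bilinear.continuous_on[OF assms(1)] by auto
next
  case (Suc k)
  show ?case
  proof (rule C_on_SucI[OF assms(2)])
    show "((\<lambda>x. prod (f x) (g x)) has_derivative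
        (\<lambda>h. prod (f x) (frechet_derivative g (at x) h) + prod (frechet_derivative f (at x) h) (g x))) (at x)"
      if "x \<in> S" for x
      using Suc.prems that by (intro bounded_bilinear.FDERIV[OF assms(1)] C_on_SucD)
    show "C_on k (\<lambda>x. prod (f x) (frechet_derivative g (at x) v) +
        prod (frechet_derivative f (at x) v) (g x)) S" for v
      using Suc.prems C_on_Suc_imp[OF Suc.prems(1)] C_on_Suc_imp[OF Suc.prems(2)]
      by (intro C_on_add Suc.IH assms) auto
  qed
qed

lemmas C_on_scaleR = C_on_bilinear[OF bounded_bilinear_scaleR]
lemmas C_on_inner = C_on_bilinear[OF bounded_bilinear_inner]

lemma linear_eq_sum_Basis:
  fixes f :: "'a::euclidean_space \<Rightarrow> 'b::real_vector"
  assumes "linear f"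
  shows "f v = (\<Sum>b\<in>Basis. (v \<bullet> b) *\<^sub>R f b)"
proof -
  have "f v = f (\<Sum>b\<in>Basis. (v \<bullet> b) *\<^sub>R b)" by (simp add: euclidean_representation)
  then show ?thesis by (simp add: linear_sum[OF assms] linear_scale[OF assms])
qed

lemma C_on_compose:
  fixes f :: "'a::euclidean_space \<Rightarrow> 'b::euclidean_space" and g :: "'b \<Rightarrow> 'c::euclidean_space"
  assumes "open S" "C_on k f S" "C_on k g T" "f ` S \<subseteq> T"
  shows "C_on k (\<lambda>x. g (f x)) S"
  using assms(2,3)
proof (induction k arbitrary: g)
  case 0
  then show ?case using assms(4) by (auto intro: continuous_on_compose2)
next
  case (Suc k)
  let ?f' = "\<lambda>x. frechet_derivative f (at x)" and ?g' = "\<lambda>x. frechet_derivative g (at x)"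
  have g': "linear (?g' (f x))" if "x \<in> S" for x
    using C_on_SucD[OF Suc.prems(2), of "f x"] that assms(4)
    by (auto intro: has_derivative_linear)
  show ?case
  proof (rule C_on_SucI[OF assms(1)])
    show "((\<lambda>x. g (f x)) has_derivative (\<lambda>h. ?g' (f x) (?f' x h))) (at x)" if "x \<in> S" for x
      using that assms(4)
      by (intro has_derivative_compose[OF C_on_SucD[OF Suc.prems(1)] C_on_SucD[OF Suc.prems(2)]]) auto
    \<comment> \<open>\<open>C_on\<close> controls derivatives in fixed directions only, while the
      direction \<open>?f' x v\<close> moves with \<open>x\<close>; expanding it in the basis leaves
      the fixed directions \<open>b\<close>.\<close>
    have "C_on k (\<lambda>x. \<Sum>b\<in>Basis. (?f' x v \<bullet> b) *\<^sub>R ?g' (f x) b) S" for v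
      using Suc.prems C_on_Suc_imp[OF Suc.prems(1)]
      by (intro C_on_sum C_on_scaleR C_on_inner C_on_const Suc.IH assms(1)) auto
    then show "C_on k (\<lambda>x. ?g' (f x) (?f' x v)) S" for v
      by (rule C_on_cong[OF assms(1)]) (rule linear_eq_sum_Basis[OF g', symmetric])
  qed
qed

lemma C_on_linear_compose:
  fixes f :: "'a::euclidean_space \<Rightarrow> 'b::euclidean_space" and g :: "'b \<Rightarrow> 'c::euclidean_space"
  assumes "open S" "linear g" "C_on k f S"
  shows "C_on k (\<lambda>x. g (f x)) S"
  using C_on_compose[OF assms(1,3), of g UNIV] C_on_bounded_linear[of UNIV g k] assms(2)
  by (simp add: linear_conv_bounded_linear)

lemma C_on_minus: "open S \<Longrightarrow> C_on k f S \<Longrightarrow> C_on k (\<lambda>x. - f x) S"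
  by (rule C_on_linear_compose) (auto intro: linearI)

lemma C_on_diff: "open S \<Longrightarrow> C_on k f S \<Longrightarrow> C_on k g S \<Longrightarrow> C_on k (\<lambda>x. f x - g x) S"
  using C_on_add[of S k f "\<lambda>x. - g x"] C_on_minus by auto

lemma C_on_Pair:
  assumes "open S" "C_on k f S" "C_on k g S"
  shows "C_on k (\<lambda>x. (f x, g x)) S"
proof -
  have "C_on k (\<lambda>x. (f x, 0) + (0, g x)) S"
    by (intro C_on_add C_on_linear_compose[where g = "\<lambda>y. (y, 0)"]
        C_on_linear_compose[where g = "\<lambda>y. (0, y)"] assms) (auto intro: linearI)
  then show ?thesis by simp
qed

lemma C_on_inverse: "C_on k (inverse :: real \<Rightarrow> real) (- {0})"
proof (induction k)
  case 0
  then show ?case by (auto intro!: continuous_intros)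
next
  case (Suc k)
  have op: "open (- {0::real})" by auto
  show ?case
  proof (rule C_on_SucI[OF op])
    show "(inverse has_derivative (\<lambda>h. - (inverse x *\<^sub>R h *\<^sub>R inverse x))) (at x)" if "x \<in> -{0}" for x :: real
      using has_derivative_inverse'[of x] that by (auto simp: mult.assoc)
    show "C_on k (\<lambda>x::real. - (inverse x *\<^sub>R v *\<^sub>R inverse x)) (- {0})" for v
      by (intro C_on_minus C_on_scaleR Suc C_on_const op)
  qed
qed

text \<open>Joint differentiability of \<open>(x, v) \<mapsto> f' x v\<close>, the second component
  of the tangent map used below. The basis expansion reduces it to fixed directions.\<close>

lemma has_derivative_frechet_Basis:
  assumes "C_on (Suc (Suc k)) f U" "x \<in> U"
  shows "((\<lambda>z. \<Sum>b\<in>Basis. (snd z \<bullet> b) *\<^sub>R frechet_derivative f (at (fst z)) b) has_derivative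
    (\<lambda>z. \<Sum>b\<in>Basis. (v \<bullet> b) *\<^sub>R frechet_derivative (\<lambda>x. frechet_derivative f (at x) b) (at x) (fst z)
       + (snd z \<bullet> b) *\<^sub>R frechet_derivative f (at x) b)) (at (x, v))"
proof (rule has_derivative_sum)
  fix b :: 'a
  have "C_on (Suc k) (\<lambda>x. frechet_derivative f (at x) b) U" using assms by auto
  then have D: "((\<lambda>x. frechet_derivative f (at x) b) has_derivative
      frechet_derivative (\<lambda>x. frechet_derivative f (at x) b) (at x)) (at x)"
    using assms by (intro C_on_SucD)
  have "((\<lambda>z. frechet_derivative f (at (fst z)) b) has_derivative
      (\<lambda>z. frechet_derivative (\<lambda>x. frechet_derivative f (at x) b) (at x) (fst z))) (at (x, v))"
    by (rule has_derivative_compose[of fst fst "(x, v)" UNIV "\<lambda>x. frechet_derivative f (at x) b"])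
      (use D in \<open>auto intro: bounded_linear_imp_has_derivative bounded_linear_fst\<close>)
  then show "((\<lambda>z. (snd z \<bullet> b) *\<^sub>R frechet_derivative f (at (fst z)) b) has_derivative
    (\<lambda>z. (v \<bullet> b) *\<^sub>R frechet_derivative (\<lambda>x. frechet_derivative f (at x) b) (at x) (fst z)
       + (snd z \<bullet> b) *\<^sub>R frechet_derivative f (at x) b)) (at (x, v))"
    by (auto intro!: derivative_eq_intros)
qed

text \<open>Differentiability of the inverse derivative is obtained by applying the differentiability of
  inverse functions to the tangent map \<open>(x, v) \<mapsto> (f x, f' x v)\<close>.\<close>

theorem smooth_inverse_function:
  fixes f :: "'a::euclidean_space \<Rightarrow> 'a"
  assumes "open U" "p \<in> U" "\<And>k. C_on k f U" "(f has_derivative (\<lambda>h. h)) (at p)"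
  obtains N M g where "open N" "p \<in> N" "N \<subseteq> U" "open M" "homeomorphism N M f g"
    "\<And>k. C_on k g M"
proof -
  define A where "A = (\<lambda>x. frechet_derivative f (at x))"
  have D: "(f has_derivative A x) (at x)" if "x \<in> U" for x
    unfolding A_def using C_on_SucD[OF assms(3)] that by blast
  have CA: "C_on k (\<lambda>x. A x v) U" for k v
    using assms(3)[of "Suc k"] by (simp add: A_def)
  have bl: "bounded_linear (A x)" if "x \<in> U" for x
    using D[OF that] by (rule has_derivative_bounded_linear)
  define f' where "f' = (\<lambda>x. Blinfun (A x))"
  have f': "blinfun_apply (f' x) = A x" if "x \<in> U" for x
    using bl[OF that] by (simp add: f'_def bounded_linear_Blinfun_apply)
  have "continuous_on U f'"
    by (rule continuous_on_blinfun_componentwise)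
      (use CA[of 0] f' in \<open>auto cong: continuous_on_cong\<close>)
  moreover have "id_blinfun o\<^sub>L f' p = id_blinfun"
    using f'[OF assms(2)] has_derivative_unique[OF D[OF assms(2)] assms(4)]
    by (intro blinfun_eqI) auto
  ultimately obtain N M g g' where NM: "open N" "N \<subseteq> U" "p \<in> N" "open M" "homeomorphism N M f g"
    and g': "\<And>y. y \<in> M \<Longrightarrow> (g has_derivative (g' y)) (at y)"
      "\<And>y. y \<in> M \<Longrightarrow> g' y = inv (blinfun_apply (f' (g y)))"
      "\<And>y. y \<in> M \<Longrightarrow> bij (blinfun_apply (f' (g y)))"
    using inverse_function_theorem[of U f f' p id_blinfun] assms(1,2) D f' by metis
  have gN: "g y \<in> N" "f (g y) = y" if "y \<in> M" for y
    using NM(5) that by (auto simp: homeomorphism_def)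
  have gf: "g (f x) = x" "f x \<in> M" if "x \<in> N" for x
    using NM(5) that by (auto simp: homeomorphism_def)
  have fg': "f' (g y) = Blinfun (A (g y))" "blinfun_apply (f' (g y)) = A (g y)" if "y \<in> M" for y
    using gN[OF that] NM(2) f' by (auto simp: f'_def)
  have AB: "A (g y) (g' y v) = v" "g' y (A (g y) v) = v" if "y \<in> M" for y v
    using g'(2,3)[OF that] fg'[OF that] by (auto simp: bij_is_surj bij_is_inj surj_f_inv_f)
  have lin: "linear (g' y)" if "y \<in> M" for y
    using g'(1)[OF that] by (rule has_derivative_linear)
  define H where "H = (\<lambda>b x. frechet_derivative (\<lambda>x. A x b) (at x))"
  have CH: "C_on k (\<lambda>x. H b x v) U" for k b v
    using CA[of "Suc k" b] by (simp add: H_def)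
  have linH: "linear (H b x)" if "x \<in> U" for b x
    unfolding H_def using C_on_SucD[OF CA that] by (rule has_derivative_linear)
  have linA: "linear (A x)" if "x \<in> U" for x
    using D[OF that] by (rule has_derivative_linear)
  have sumA: "(\<Sum>b\<in>Basis. (v \<bullet> b) *\<^sub>R A x b) = A x v" if "x \<in> U" for x v
    using linear_eq_sum_Basis[OF linA[OF that], of v] by (rule sym)
  \<comment> \<open>As \<open>g' y\<close> inverts \<open>A (g y)\<close>, this is the rule
    \<open>- A^-1 A' A^-1\<close> for the derivative of an inverse, with \<open>H b\<close> the
    derivative of \<open>\<lambda>x. A x b\<close>.\<close>
  have dB: "((\<lambda>y. g' y w) has_derivative
      (\<lambda>u. - g' y (\<Sum>b\<in>Basis. (g' y w \<bullet> b) *\<^sub>R H b (g y) (g' y u)))) (at y)" if y: "y \<in> M" for y w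
  proof -
    have gU: "g y \<in> U" using gN y NM(2) by auto
    let ?F = "\<lambda>z. (f (fst z), A (fst z) (snd z))"
    let ?G = "\<lambda>z. (g (fst z), g' (fst z) (snd z))"
    let ?v = "g' y w"
    let ?h = "\<lambda>h. \<Sum>b\<in>Basis. (?v \<bullet> b) *\<^sub>R H b (g y) h"
    let ?F' = "\<lambda>z. (A (g y) (fst z), \<Sum>b\<in>Basis. (?v \<bullet> b) *\<^sub>R H b (g y) (fst z) + (snd z \<bullet> b) *\<^sub>R A (g y) b)"
    let ?G' = "\<lambda>z. (g' y (fst z), g' y (snd z - ?h (g' y (fst z))))"
    have "((\<lambda>z. \<Sum>b\<in>Basis. (snd z \<bullet> b) *\<^sub>R A (fst z) b) has_derivative
        (\<lambda>z. \<Sum>b\<in>Basis. (?v \<bullet> b) *\<^sub>R H b (g y) (fst z) + (snd z \<bullet> b) *\<^sub>R A (g y) b)) (at (g y, ?v))"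
      using has_derivative_frechet_Basis[OF assms(3)[of "Suc (Suc 0)"] gU, of ?v]
      by (simp add: A_def H_def)
    then have "((\<lambda>z. A (fst z) (snd z)) has_derivative
        (\<lambda>z. \<Sum>b\<in>Basis. (?v \<bullet> b) *\<^sub>R H b (g y) (fst z) + (snd z \<bullet> b) *\<^sub>R A (g y) b)) (at (g y, ?v))"
      by (rule has_derivative_transform_within_open[of _ _ _ _ "U \<times> UNIV"])
        (use gU assms(1) sumA in \<open>auto simp: open_Times\<close>)
    moreover have "((\<lambda>z. f (fst z)) has_derivative (\<lambda>z. A (g y) (fst z))) (at (g y, ?v))"
      by (rule has_derivative_compose[of fst fst "(g y, ?v)" UNIV f])
        (use D[OF gU] in \<open>auto intro: bounded_linear_imp_has_derivative bounded_linear_fst\<close>)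
    ultimately have F': "(?F has_derivative ?F') (at (?G (y, w)))"
      by (auto intro: has_derivative_Pair)
    have "continuous_on (N \<times> UNIV) (\<lambda>z. \<Sum>b\<in>Basis. (snd z \<bullet> b) *\<^sub>R A (fst z) b)"
    proof (intro continuous_intros)
      fix b :: 'a
      show "continuous_on (N \<times> (UNIV::'a set)) (\<lambda>x. A (fst x) b)"
        using CA[of 0 b] NM(2)
        by (intro continuous_on_compose2[of U "\<lambda>x. A x b" _ fst]) (auto intro!: continuous_intros)
    qed
    then have "continuous_on (N \<times> UNIV) (\<lambda>z. A (fst z) (snd z))"
      by (rule continuous_on_eq) (use sumA NM(2) in auto)
    moreover have "continuous_on (N \<times> (UNIV::'a set)) (\<lambda>z. f (fst z))"
      using C_on_continuous[OF assms(3)[of 0]] NM(2)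
      by (intro continuous_on_compose2[of U f _ fst]) (auto intro!: continuous_intros)
    ultimately have contF: "continuous_on (N \<times> UNIV) ?F"
      by (auto intro: continuous_on_Pair)
    have FG: "?F' \<circ> ?G' = id"
    proof
      fix z :: "'a \<times> 'a"
      have "(\<Sum>b\<in>Basis. (?v \<bullet> b) *\<^sub>R H b (g y) (g' y (fst z)) +
          (g' y (snd z - ?h (g' y (fst z))) \<bullet> b) *\<^sub>R A (g y) b)
        = ?h (g' y (fst z)) + A (g y) (g' y (snd z - ?h (g' y (fst z))))"
        using sumA[OF gU] by (simp add: sum.distrib)
      then show "(?F' \<circ> ?G') z = id z"
        using AB[OF y] by (simp add: prod_eq_iff)
    qed
    \<comment> \<open>\<open>?G\<close> inverts the tangent map \<open>?F\<close>. The derivative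
      \<open>?F'\<close> is block triangular, so its right inverse \<open>?G'\<close> is explicit;
      the second component of \<open>?G'\<close> contains the wanted formula.\<close>
    have "(?G has_derivative ?G') (at (y, w))"
    proof (rule has_derivative_inverse_strong_x[of "N \<times> UNIV" ?G "(y, w)" ?F ?F' ?G'])
      show "open (N \<times> (UNIV::'a set))" using NM by (simp add: open_Times)
      show "?G (y, w) \<in> N \<times> UNIV" using gN y by auto
      show "?G (?F x) = x" if "x \<in> N \<times> UNIV" for x
      proof -
        have "fst x \<in> N" using that by auto
        then show ?thesis using gf[of "fst x"] AB(2)[of "f (fst x)"] by (simp add: prod_eq_iff)
      qed
      show "?F (?G (y, w)) = (y, w)" using gN y AB by auto
    qed (use contF F' FG in auto)
    then have "((\<lambda>z. snd (?G z)) has_derivative (\<lambda>z. snd (?G' z))) (at (y, w))"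
      by (rule has_derivative_snd)
    moreover have "((\<lambda>y. (y, w)) has_derivative (\<lambda>u. (u, 0))) (at y)"
      by (auto intro!: derivative_eq_intros)
    ultimately have "((\<lambda>y. snd (?G (y, w))) has_derivative (\<lambda>u. snd (?G' (u, 0)))) (at y)"
      by (rule has_derivative_compose[rotated])
    then show ?thesis by (simp add: linear_neg[OF lin[OF y]])
  qed
  \<comment> \<open>Both claims go together: the derivative of \<open>g\<close> is
    \<open>g'\<close>, and by \<open>dB\<close> the derivative of \<open>g'\<close> is again an
    expression in \<open>g\<close>, \<open>g'\<close> and the smooth \<open>H\<close>.\<close>
  have main: "C_on k g M \<and> (\<forall>w. C_on k (\<lambda>y. g' y w) M)" for k
  proof (induction k)
    case 0
    have "continuous_on M g" using NM(5) by (auto simp: homeomorphism_def)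
    moreover have "continuous_on M (\<lambda>y. g' y w)" for w
      using dB by (intro has_derivative_continuous_on) (auto intro: has_derivative_at_withinI)
    ultimately show ?case by auto
  next
    case (Suc k)
    have 1: "C_on (Suc k) g M"
      by (rule C_on_SucI[OF NM(4) g'(1)]) (use Suc in auto)
    have "C_on (Suc k) (\<lambda>y. g' y w) M" for w
    proof (rule C_on_SucI[OF NM(4) dB])
      fix u
      let ?s = "\<lambda>y. \<Sum>b\<in>Basis. (g' y w \<bullet> b) *\<^sub>R (\<Sum>c\<in>Basis. (g' y u \<bullet> c) *\<^sub>R H b (g y) c)"
      have "C_on k (\<lambda>y. H b (g y) c) M" for b c
        using Suc gN NM(2) by (intro C_on_compose[OF NM(4) _ CH]) auto
      then have "C_on k (\<lambda>y. - (\<Sum>e\<in>Basis. (?s y \<bullet> e) *\<^sub>R g' y e)) M"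
        using Suc by (intro C_on_minus C_on_sum C_on_scaleR C_on_inner C_on_const NM(4)) auto
      moreover have "- (\<Sum>e\<in>Basis. (?s y \<bullet> e) *\<^sub>R g' y e) =
          - g' y (\<Sum>b\<in>Basis. (g' y w \<bullet> b) *\<^sub>R H b (g y) (g' y u))" if "y \<in> M" for y
      proof -
        have "g y \<in> U" using gN that NM(2) by auto
        then have "(\<Sum>c\<in>Basis. (g' y u \<bullet> c) *\<^sub>R H b (g y) c) = H b (g y) (g' y u)" for b
          by (rule linear_eq_sum_Basis[OF linH, symmetric])
        then show ?thesis
          using linear_eq_sum_Basis[OF lin[OF that], of "?s y", symmetric] by simp
      qed
      ultimately show "C_on k (\<lambda>y. - g' y (\<Sum>b\<in>Basis. (g' y w \<bullet> b) *\<^sub>R H b (g y) (g' y u))) M"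
        by (rule C_on_cong[OF NM(4)])
    qed
    with 1 show ?case by auto
  qed
  show ?thesis
    by (rule that[OF NM(1,3,2,4,5)]) (use main in auto)
qed

section \<open>Charts from smooth retractions\<close>

lemma smooth_onI: "open N \<Longrightarrow> S \<subseteq> N \<Longrightarrow> (\<And>k. C_on k f N) \<Longrightarrow> smooth_on S f"
  unfolding smooth_on_def by blast

lemma smooth_on_cong: "smooth_on S f \<Longrightarrow> (\<And>x. x \<in> S \<Longrightarrow> f x = g x) \<Longrightarrow> smooth_on S g"
  unfolding smooth_on_def by (metis IntD1)

lemma smooth_onE:
  assumes "smooth_on S f" "x \<in> S"
  obtains N g where "open N" "x \<in> N" "\<And>k. C_on k g N" "\<And>y. y \<in> S \<Longrightarrow> y \<in> N \<Longrightarrow> g y = f y"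
proof -
  obtain N g where "open N \<and> x \<in> N \<and> (\<forall>k. C_on k g N) \<and> (\<forall>y\<in>S \<inter> N. g y = f y)"
    using assms unfolding smooth_on_def by (elim ballE exE) auto
  then show ?thesis by (intro that[of N g]) auto
qed

lemma smooth_on_subset:
  assumes "smooth_on S f" "T \<subseteq> S"
  shows "smooth_on T f"
  unfolding smooth_on_def
proof
  fix x assume "x \<in> T"
  then have x: "x \<in> S" using assms(2) by auto
  obtain N g where "open N" "x \<in> N" "\<And>k. C_on k g N" "\<And>y. y \<in> S \<Longrightarrow> y \<in> N \<Longrightarrow> g y = f y"
    using smooth_onE[OF assms(1) x] by metis
  then show "\<exists>N g. open N \<and> x \<in> N \<and> (\<forall>k. C_on k g N) \<and> (\<forall>y\<in>T \<inter> N. g y = f y)"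
    using assms(2) by (intro exI[of _ N] exI[of _ g]) auto
qed

lemma smooth_on_continuous_on:
  assumes "smooth_on S f"
  shows "continuous_on S f"
  unfolding continuous_on_eq_continuous_within
proof
  fix x assume x: "x \<in> S"
  obtain N g where N: "open N" "x \<in> N" "\<And>k. C_on k g N" "\<And>y. y \<in> S \<Longrightarrow> y \<in> N \<Longrightarrow> g y = f y"
    using smooth_onE[OF assms x] by metis
  then have "continuous_on N g" by (auto intro: C_on_continuous)
  with N have "continuous (at x within S) g"
    by (simp add: continuous_on_eq_continuous_at continuous_at_imp_continuous_at_within)
  moreover have "eventually (\<lambda>y. g y = f y) (at x within S)"
    using N unfolding eventually_at_topological by blast
  ultimately show "continuous (at x within S) f"
    using tendsto_cong[of g f "at x within S" "f x"] N(2) N(4)[OF x] by (auto simp: continuous_within)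
qed

lemma smooth_on_compose:
  assumes f: "smooth_on S f" and g: "smooth_on T g" and sub: "f ` S \<subseteq> T"
  shows "smooth_on S (\<lambda>x. g (f x))"
  unfolding smooth_on_def
proof
  fix x assume x: "x \<in> S"
  obtain N F where N: "open N" "x \<in> N" "\<And>k. C_on k F N" "\<And>y. y \<in> S \<Longrightarrow> y \<in> N \<Longrightarrow> F y = f y"
    using smooth_onE[OF f x] by metis
  have "f x \<in> T" using sub x by auto
  then obtain M G where M: "open M" "f x \<in> M" "\<And>k. C_on k G M" "\<And>y. y \<in> T \<Longrightarrow> y \<in> M \<Longrightarrow> G y = g y"
    using smooth_onE[OF g] by metis
  let ?N = "N \<inter> F -` M"
  have o: "open ?N"
    using continuous_open_preimage[OF C_on_continuous[OF N(3)[of 0]] N(1) M(1)] .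
  have "C_on k (\<lambda>x. G (F x)) ?N" for k
    by (rule C_on_compose[OF o C_on_subset[OF N(3)] M(3)]) auto
  moreover have "G (F y) = g (f y)" if "y \<in> S \<inter> ?N" for y
    using that N(4) M(4) sub by auto
  moreover have "x \<in> ?N" using N M x by auto
  ultimately show "\<exists>N G. open N \<and> x \<in> N \<and> (\<forall>k. C_on k G N) \<and> (\<forall>y\<in>S \<inter> N. G y = g (f y))"
    using o by (intro exI[of _ ?N] exI[of _ "\<lambda>x. G (F x)"]) auto
qed

section \<open>Ambient diffeomorphisms, charts and smooth retractions\<close>

definition diffeo ::
  "'a set \<Rightarrow> 'b set \<Rightarrow> ('a::euclidean_space \<Rightarrow> 'b::euclidean_space) \<Rightarrow> ('b \<Rightarrow> 'a) \<Rightarrow> bool" where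
  "diffeo N M f g \<longleftrightarrow> open N \<and> open M \<and> homeomorphism N M f g \<and>
     (\<forall>k. C_on k f N) \<and> (\<forall>k. C_on k g M)"

lemma diffeoD:
  assumes "diffeo N M f g"
  shows "open N" "open M" "\<And>k. C_on k f N" "\<And>k. C_on k g M"
    "\<And>x. x \<in> N \<Longrightarrow> f x \<in> M" "\<And>x. x \<in> N \<Longrightarrow> g (f x) = x"
    "\<And>y. y \<in> M \<Longrightarrow> g y \<in> N" "\<And>y. y \<in> M \<Longrightarrow> f (g y) = y"
  using assms by (auto simp: diffeo_def homeomorphism_def)

lemma diffeo_subset:
  assumes "diffeo N M f g" "open N'" "N' \<subseteq> N"
  shows "diffeo N' (f ` N') f g"
proof -
  have h: "homeomorphism N M f g" using assms by (simp add: diffeo_def)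
  have "openin (top_of_set M) (f ` N')"
    by (rule homeomorphism_imp_open_map[OF h]) (use assms in \<open>auto simp: diffeo_def openin_open_eq\<close>)
  then have "open (f ` N')" using assms(1) by (simp add: diffeo_def openin_open_eq)
  moreover have "homeomorphism N' (f ` N') f g"
    using homeomorphism_of_subsets[OF h assms(3) _ refl] diffeoD(5)[OF assms(1)] assms(3) by auto
  moreover have "f ` N' \<subseteq> M" using assms diffeoD(5) by blast
  ultimately show ?thesis
    using assms(2) C_on_subset[OF diffeoD(3)[OF assms(1)] assms(3)]
      C_on_subset[OF diffeoD(4)[OF assms(1)]] by (simp add: diffeo_def)
qed

lemma diffeo_inv_into:
  assumes "diffeo N M f g" "f ` (Y \<inter> N) = M \<inter> V" "y \<in> M \<inter> V"
  shows "g y \<in> Y \<inter> N" "inv_into (Y \<inter> N) f y = g y"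
proof -
  obtain x where x: "x \<in> Y \<inter> N" "y = f x" using assms by auto
  show "g y \<in> Y \<inter> N" using x diffeoD(6)[OF assms(1)] by auto
  have "inj_on f (Y \<inter> N)"
    using diffeoD(6)[OF assms(1)] by (metis IntD2 inj_onI)
  then show "inv_into (Y \<inter> N) f y = g y"
    using x diffeoD(6)[OF assms(1)] by auto
qed

lemma diffeo_euclidean_charts:
  assumes d: "diffeo N M f g" and V: "subspace V" "dim V = k" and im: "f ` (Y \<inter> N) = M \<inter> V"
  shows "(Y \<inter> N, f, V) \<in> euclidean_charts k Y"
proof -
  note D = diffeoD[OF d]
  have "inj_on f (Y \<inter> N)" using D(6) by (metis IntD2 inj_onI)
  moreover have "openin (top_of_set V) (f ` (Y \<inter> N))"
    unfolding im using D(2) by (metis Int_commute openin_open_Int)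
  moreover have "openin (top_of_set Y) (Y \<inter> N)" using D(1) by (rule openin_open_Int)
  moreover have "smooth_on (Y \<inter> N) f" using D by (intro smooth_onI[of N]) auto
  moreover have "smooth_on (f ` (Y \<inter> N)) (inv_into (Y \<inter> N) f)"
  proof (rule smooth_on_cong)
    show "smooth_on (f ` (Y \<inter> N)) g" using D im by (intro smooth_onI[of M]) auto
  qed (use diffeo_inv_into[OF d im] im in auto)
  ultimately show ?thesis using V by (simp add: euclidean_charts_def)
qed

definition local_retraction :: "'a set \<Rightarrow> ('a::euclidean_space \<Rightarrow> 'a) \<Rightarrow> 'a set \<Rightarrow> bool" where
  "local_retraction U \<rho> Y \<longleftrightarrow> open U \<and> (\<forall>k. C_on k \<rho> U) \<and> \<rho> ` U \<subseteq> Y \<and> (\<forall>x\<in>Y \<inter> U. \<rho> x = x)"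

lemma C_on_has_derivative:
  assumes "\<And>k. C_on k f U" "x \<in> U"
  obtains f' where "(f has_derivative f') (at x)"
  using C_on_SucD[OF assms(1)[of "Suc 0"] assms(2)] by blast

text \<open>Around \<open>p\<close> the map \<open>x \<mapsto> L (\<rho> x - p) + (x - \<rho> x) - L (x - \<rho> x)\<close> straightens the image of
  the retraction \<open>\<rho>\<close> with derivative \<open>L\<close>; correcting it by the right inverse \<open>R\<close> of \<open>\<mu>\<close>
  straightens the level set of \<open>\<mu>\<close> at the same time.\<close>

lemma local_retraction_straighten:
  fixes \<rho> :: "'a::euclidean_space \<Rightarrow> 'a" and \<mu> :: "'a \<Rightarrow> 'b::euclidean_space"
  assumes ret: "local_retraction U \<rho> Y" and p: "p \<in> U" "p \<in> Y"
    and L: "(\<rho> has_derivative L) (at p)"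
    and lin: "linear \<mu>" "linear R"
    and \<mu>Y: "\<And>x. x \<in> Y \<Longrightarrow> \<mu> (x - p) \<in> H"
    and \<mu>L: "\<And>h. \<mu> (L h) \<in> H"
    and R: "\<And>h. h \<in> H \<Longrightarrow> R h \<in> range L" "\<And>h. h \<in> H \<Longrightarrow> \<mu> (R h) = h"
  obtains N M \<Phi> \<Psi> where "diffeo N M \<Phi> \<Psi>" "p \<in> N" "N \<subseteq> U" "\<Phi> p = 0"
    "(\<Phi> has_derivative (\<lambda>h. h)) (at p)" "(\<Psi> has_derivative (\<lambda>h. h)) (at 0)"
    "\<Phi> ` (Y \<inter> N) = M \<inter> range L"
    "\<Phi> ` ({x \<in> Y. \<mu> x = \<mu> p} \<inter> N) = M \<inter> {v \<in> range L. \<mu> v = 0}"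
proof -
  have U: "open U" "\<And>k. C_on k \<rho> U" "\<And>x. x \<in> U \<Longrightarrow> \<rho> x \<in> Y" "\<And>x. x \<in> Y \<Longrightarrow> x \<in> U \<Longrightarrow> \<rho> x = x"
    using ret by (auto simp: local_retraction_def)
  have linL: "linear L" using L by (rule has_derivative_linear)
  have contr: "continuous_on U \<rho>" using C_on_continuous[OF U(2)[of 0]] .
  \<comment> \<open>Differentiate \<open>\<rho> (\<rho> x) = \<rho> x\<close> at the fixed point
    \<open>p\<close>.\<close>
  have LL: "L (L h) = L h" for h
  proof -
    have "((\<lambda>x. \<rho> (\<rho> x)) has_derivative (\<lambda>h. L (L h))) (at p)"
      by (rule has_derivative_compose[OF L]) (use L p U in auto)
    moreover have "((\<lambda>x. \<rho> (\<rho> x)) has_derivative L) (at p)"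
      by (rule has_derivative_transform_within_open[OF L, of "U \<inter> \<rho> -` U"])
        (use p U continuous_open_preimage[OF contr U(1) U(1)] in auto)
    ultimately show ?thesis using has_derivative_unique by metis
  qed
  note simps = linear_add[OF linL] linear_diff[OF linL] linear_add[OF lin(1)] linear_diff[OF lin(1)]
    linear_add[OF lin(2)] linear_diff[OF lin(2)]
  have linRmu: "linear (\<lambda>x. R (\<mu> x))" "linear (\<lambda>x. R (\<mu> (L x)))"
    using linear_compose[OF lin] linear_compose[OF linear_compose[OF linL lin(1)] lin(2)]
    by (auto simp: o_def)
  \<comment> \<open>The two terms with \<open>R\<close> exchange the \<mu>-value of
    \<open>L (\<rho> x - p)\<close> for that of \<open>\<rho> x - p\<close>. They cancel to first
    order, and on \<open>Y\<close> they give \<open>\<mu> (\<Theta> x) = \<mu> (x - p)\<close>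
    exactly, so the level set becomes a kernel.\<close>
  define \<Theta> where "\<Theta> = (\<lambda>x. L (\<rho> x - p) - R (\<mu> (L (\<rho> x - p))) + R (\<mu> (\<rho> x - p)) +
    ((x - \<rho> x) - L (x - \<rho> x)))"
  have C\<Theta>: "C_on k \<Theta> U" for k
    unfolding \<Theta>_def
    by (intro C_on_add C_on_diff C_on_linear_compose[OF _ linL]
        C_on_linear_compose[OF _ linRmu(1)] C_on_linear_compose[OF _ linRmu(2)] C_on_const C_on_id U)
  have bl: "bounded_linear L" "bounded_linear (\<lambda>x. R (\<mu> x))" "bounded_linear (\<lambda>x. R (\<mu> (L x)))"
    using linL linRmu by (simp_all add: linear_conv_bounded_linear)
  have D\<Theta>: "(\<Theta> has_derivative (\<lambda>h. h)) (at p)"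
    unfolding \<Theta>_def
    by (rule derivative_eq_intros L bounded_linear.has_derivative[OF bl(1)]
        bounded_linear.has_derivative[OF bl(2)] bounded_linear.has_derivative[OF bl(3)] refl)+
      (simp add: simps LL fun_eq_iff)
  obtain N0 M0 g where N0: "open N0" "p \<in> N0" "N0 \<subseteq> U" "open M0" "homeomorphism N0 M0 \<Theta> g"
    "\<And>k. C_on k g M0"
    using smooth_inverse_function[OF U(1) p(1) C\<Theta> D\<Theta>] by blast
  have d0: "diffeo N0 M0 \<Theta> g"
    using N0 C_on_subset[OF C\<Theta>] by (auto simp: diffeo_def)
  \<comment> \<open>Keeps \<open>\<rho> x\<close> in the domain \<open>N0\<close> on which
    \<open>\<Theta>\<close> is injective.\<close>
  define N where "N = N0 \<inter> \<rho> -` N0"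
  have oN: "open N"
    unfolding N_def using continuous_on_subset[OF contr N0(3)] N0(1)
    by (intro continuous_open_preimage) auto
  have N: "N \<subseteq> N0" "p \<in> N" using N0 U p by (auto simp: N_def)
  have d: "diffeo N (\<Theta> ` N) \<Theta> g" by (rule diffeo_subset[OF d0 oN N(1)])
  have \<Theta>p: "\<Theta> p = 0"
    using p U by (simp add: \<Theta>_def linear_0[OF linL] linear_0[OF lin(1)] linear_0[OF lin(2)])
  have Dg: "(g has_derivative (\<lambda>h. h)) (at 0)"
  proof (rule has_derivative_inverse_strong_x[of N0 g 0 \<Theta> "\<lambda>h. h"])
    have "g 0 = p" using \<Theta>p diffeoD(6)[OF d0 N0(2)] by simp
    then show "g 0 \<in> N0" "(\<Theta> has_derivative (\<lambda>h. h)) (at (g 0))" "\<Theta> (g 0) = 0"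
      using N0 D\<Theta> \<Theta>p by auto
    show "continuous_on N0 \<Theta>" using N0(5) by (auto simp: homeomorphism_def)
  qed (use N0 diffeoD(6)[OF d0] in auto)
  have sub: "subspace (range L)" by (simp add: linL linear_subspace_image)
  have L_range: "L v = v" if "v \<in> range L" for v using that LL by auto
  have a: "L (\<rho> x - p) - R (\<mu> (L (\<rho> x - p))) + R (\<mu> (\<rho> x - p)) \<in> range L" if "x \<in> U" for x
    using that \<mu>Y \<mu>L R(1) U(3) by (intro subspace_add[OF sub] subspace_diff[OF sub]) auto
  have \<Theta>Y: "\<Theta> x = L (x - p) - R (\<mu> (L (x - p))) + R (\<mu> (x - p))" if "x \<in> Y" "x \<in> U" for x
    using U(4)[OF that] by (simp add: \<Theta>_def linear_0[OF linL])
  \<comment> \<open>\<open>L\<close> kills the transversal part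
    \<open>(x - \<rho> x) - L (x - \<rho> x)\<close>, so a value in \<open>range L\<close> has no
    such part and equals \<open>\<Theta> (\<rho> x)\<close>; injectivity gives
    \<open>x = \<rho> x\<close>.\<close>
  have in_Y: "x \<in> Y" if x: "x \<in> N" "\<Theta> x \<in> range L" for x
  proof -
    have xU: "x \<in> U" "\<rho> x \<in> U" "\<rho> x \<in> N0" using x N0 N by (auto simp: N_def)
    have "L (\<Theta> x) = L (\<rho> x - p) - R (\<mu> (L (\<rho> x - p))) + R (\<mu> (\<rho> x - p))"
      using L_range[OF a[OF xU(1)]] unfolding \<Theta>_def by (simp only: simps LL) simp
    then have "\<Theta> x = L (\<rho> x - p) - R (\<mu> (L (\<rho> x - p))) + R (\<mu> (\<rho> x - p))"
      using L_range[OF x(2)] by simp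
    also have "\<dots> = \<Theta> (\<rho> x)" using \<Theta>Y[OF U(3)[OF xU(1)] xU(2)] by simp
    finally have "x = \<rho> x" using diffeoD(6)[OF d0] x xU N by (metis subsetD)
    then show ?thesis using U(3)[OF xU(1)] by simp
  qed
  have \<mu>\<Theta>: "\<mu> (\<Theta> x) = \<mu> (x - p)" if "x \<in> Y" "x \<in> U" for x
    using \<Theta>Y[OF that] R(2)[OF \<mu>L] R(2)[OF \<mu>Y[OF that(1)]] by (simp only: linear_add[OF lin(1)] linear_diff[OF lin(1)]) simp
  have im1: "\<Theta> ` (Y \<inter> N) = \<Theta> ` N \<inter> range L"
  proof
    show "\<Theta> ` (Y \<inter> N) \<subseteq> \<Theta> ` N \<inter> range L"
    proof clarify
      fix x assume x: "x \<in> Y" "x \<in> N"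
      then have "x \<in> U" using N N0 by auto
      then show "\<Theta> x \<in> \<Theta> ` N \<inter> range L"
        using x(2) a[of x] \<Theta>Y[of x] U(4)[of x] x(1) by (metis IntI imageI)
    qed
  qed (use in_Y in auto)
  have \<mu>p: "\<mu> (x - p) = 0 \<longleftrightarrow> \<mu> x = \<mu> p" for x by (simp add: linear_diff[OF lin(1)])
  have im2: "\<Theta> ` ({x \<in> Y. \<mu> x = \<mu> p} \<inter> N) = \<Theta> ` N \<inter> {v \<in> range L. \<mu> v = 0}"
  proof
    show "\<Theta> ` ({x \<in> Y. \<mu> x = \<mu> p} \<inter> N) \<subseteq> \<Theta> ` N \<inter> {v \<in> range L. \<mu> v = 0}"
    proof clarify
      fix x assume x: "x \<in> Y" "x \<in> N" "\<mu> x = \<mu> p"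
      then have "x \<in> U" using N N0 by auto
      then have "\<mu> (\<Theta> x) = 0" using \<mu>\<Theta>[of x] x \<mu>p by simp
      moreover have "\<Theta> x \<in> range L" using im1 x by blast
      ultimately show "\<Theta> x \<in> \<Theta> ` N \<inter> {v \<in> range L. \<mu> v = 0}" using x by blast
    qed
    show "\<Theta> ` N \<inter> {v \<in> range L. \<mu> v = 0} \<subseteq> \<Theta> ` ({x \<in> Y. \<mu> x = \<mu> p} \<inter> N)"
    proof clarify
      fix x k assume x: "x \<in> N" "\<Theta> x = L k" "\<mu> (\<Theta> x) = 0"
      have "x \<in> Y" by (rule in_Y) (use x in auto)
      moreover have "x \<in> U" using x N N0 by auto
      ultimately show "\<Theta> x \<in> \<Theta> ` ({x \<in> Y. \<mu> x = \<mu> p} \<inter> N)"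
        using x(1,3) \<mu>\<Theta>[of x] \<mu>p by auto
    qed
  qed
  show ?thesis
    by (rule that[OF d N(2) _ \<Theta>p D\<Theta> Dg im1 im2]) (use N N0 in auto)
qed

text \<open>In the straightened coordinates a linear projection onto \<open>W\<close> is a
  retraction; transported back it keeps its derivative, because \<Phi> and \<Psi> have identity
  derivatives at the base points. This supplies the retraction onto the level set that is later
  followed by \<open>\<sigma>\<close>.\<close>

lemma straighten_local_retraction:
  assumes d: "diffeo N M \<Phi> \<Psi>" and p: "p \<in> N" "\<Phi> p = 0"
    and D: "(\<Phi> has_derivative (\<lambda>h. h)) (at p)" "(\<Psi> has_derivative (\<lambda>h. h)) (at 0)"
    and W: "subspace W" and im: "\<Phi> ` (X \<inter> N) = M \<inter> W"
  obtains U \<rho> P where "local_retraction U \<rho> X" "p \<in> U" "(\<rho> has_derivative P) (at p)" "range P = W"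
proof -
  obtain P where P: "range P \<subseteq> W" "linear P" "\<forall>v\<in>W. P v = v"
    using linear_exists_right_inverse_on[OF linear_ident W] by auto
  note DD = diffeoD[OF d]
  define U where "U = N \<inter> (\<lambda>x. P (\<Phi> x)) -` M"
  have CP: "C_on k (\<lambda>x. P (\<Phi> x)) N" for k
    by (rule C_on_linear_compose[OF DD(1) P(2) DD(3)])
  have oU: "open U" unfolding U_def
    by (rule continuous_open_preimage[OF C_on_continuous[OF CP[of 0]] DD(1,2)])
  have pU: "p \<in> U" using p P DD(5)[OF p(1)] by (simp add: U_def linear_0)
  have "(P has_derivative P) (at 0)"
    using P(2) by (simp add: linear_conv_bounded_linear bounded_linear_imp_has_derivative)
  then have "((\<lambda>x. P (\<Phi> x)) has_derivative P) (at p)"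
    using has_derivative_compose[OF D(1), of P P] p by simp
  then have "((\<lambda>x. \<Psi> (P (\<Phi> x))) has_derivative P) (at p)"
    using has_derivative_compose[of "\<lambda>x. P (\<Phi> x)" P p UNIV \<Psi> "\<lambda>h. h"] p D P by (simp add: linear_0)
  moreover have "range P = W" using P by (metis image_eqI rangeI subsetI subset_antisym)
  moreover have "local_retraction U (\<lambda>x. \<Psi> (P (\<Phi> x))) X"
    unfolding local_retraction_def
  proof (intro conjI allI ballI)
    show "C_on k (\<lambda>x. \<Psi> (P (\<Phi> x))) U" for k
      by (rule C_on_compose[OF oU C_on_subset[OF CP] DD(4)]) (auto simp: U_def)
    show "(\<lambda>x. \<Psi> (P (\<Phi> x))) ` U \<subseteq> X"
      using diffeo_inv_into(1)[OF d im] P by (auto simp: U_def)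
    show "\<Psi> (P (\<Phi> x)) = x" if "x \<in> X \<inter> U" for x
    proof -
      have "x \<in> X \<inter> N" using that by (auto simp: U_def)
      then have "\<Phi> x \<in> W" using im by auto
      then show ?thesis using P(3) that DD(6) by (simp add: U_def)
    qed
  qed (rule oU)
  ultimately show ?thesis using that pU by blast
qed

text \<open>\<open>\<sigma>\<close> is idempotent on \<open>X \<inter> Q\<close>, so its image there
  is its fixed point set; taking the preimage of \<open>Q\<close> under \<open>\<rho>\<close> makes
  \<open>\<sigma>\<close> applicable.\<close>

lemma local_retraction_compose:
  assumes "local_retraction U \<rho> X" "open Q" "\<And>k. C_on k \<sigma> Q"
    and "\<And>x. x \<in> X \<inter> Q \<Longrightarrow> \<sigma> x \<in> X \<inter> Q" "\<And>x. x \<in> X \<inter> Q \<Longrightarrow> \<sigma> (\<sigma> x) = \<sigma> x"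
  shows "local_retraction (U \<inter> \<rho> -` Q) (\<lambda>x. \<sigma> (\<rho> x)) {x \<in> X \<inter> Q. \<sigma> x = x}"
proof -
  have U: "open U" "\<And>k. C_on k \<rho> U" "\<And>x. x \<in> U \<Longrightarrow> \<rho> x \<in> X" "\<And>x. x \<in> X \<Longrightarrow> x \<in> U \<Longrightarrow> \<rho> x = x"
    using assms by (auto simp: local_retraction_def)
  have o: "open (U \<inter> \<rho> -` Q)"
    by (rule continuous_open_preimage[OF C_on_continuous[OF U(2)[of 0]] U(1) assms(2)])
  have "C_on k (\<lambda>x. \<sigma> (\<rho> x)) (U \<inter> \<rho> -` Q)" for k
    by (rule C_on_compose[OF o C_on_subset[OF U(2)] assms(3)]) auto
  then show ?thesis
    using o U assms(4,5) by (auto simp: local_retraction_def)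
qed

section \<open>Quotients with local slices\<close>

text \<open>Restrict \<open>f\<close> to the line \<open>x + t v\<close>, which stays in
  \<open>D\<close> for small \<open>t\<close>. A linear projection \<open>P\<close> onto
  \<open>W\<close> satisfies \<open>P o f = f\<close> on \<open>D\<close>, and differentiating gives
  \<open>P (f' v) = f' v\<close>.\<close>

lemma derivative_into_subspace:
  fixes f :: "'a::euclidean_space \<Rightarrow> 'b::euclidean_space"
  assumes f: "(f has_derivative f') (at x within D)" and D: "openin (top_of_set V) D" "x \<in> D"
    and V: "subspace V" "v \<in> V" and W: "subspace W" "f ` D \<subseteq> W"
  shows "f' v \<in> W"
proof -
  obtain P where P: "range P \<subseteq> W" "linear P" "\<forall>w\<in>W. P w = w"
    using linear_exists_right_inverse_on[OF linear_ident W(1)] by auto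
  obtain S where S: "open S" "D = V \<inter> S" using D(1) by (auto simp: openin_open)
  let ?c = "\<lambda>t::real. x + t *\<^sub>R v"
  let ?A = "?c -` S"
  have A: "open ?A"
    by (intro open_vimage S) (auto intro!: continuous_intros)
  have cD: "?c t \<in> D" if "t \<in> ?A" for t
    using that S D(2) V by (auto intro: subspace_add subspace_scale)
  have A0: "0 \<in> ?A" using D(2) S by auto
  have "(?c has_derivative (\<lambda>t. t *\<^sub>R v)) (at 0 within ?A)"
    by (auto intro!: derivative_eq_intros)
  then have "((\<lambda>t. f (?c t)) has_derivative (\<lambda>t. f' (t *\<^sub>R v))) (at 0 within ?A)"
    using diff_chain_within[of ?c "\<lambda>t. t *\<^sub>R v" 0 ?A f f'] has_derivative_subset[OF f, of "?c ` ?A"] cD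
    by (auto simp: o_def)
  then have 1: "((\<lambda>t. f (?c t)) has_derivative (\<lambda>t. f' (t *\<^sub>R v))) (at 0)"
    using at_within_open[OF A0 A] by simp
  have "bounded_linear P" using P(2) by (simp add: linear_conv_bounded_linear)
  then have "((\<lambda>t. P (f (?c t))) has_derivative (\<lambda>t. P (f' (t *\<^sub>R v)))) (at 0)"
    using 1 by (rule bounded_linear.has_derivative)
  then have "((\<lambda>t. f (?c t)) has_derivative (\<lambda>t. P (f' (t *\<^sub>R v)))) (at 0)"
    by (rule has_derivative_transform_within_open[OF _ A A0]) (use P(3) W(2) cD in auto)
  then have "(\<lambda>t. f' (t *\<^sub>R v)) = (\<lambda>t. P (f' (t *\<^sub>R v)))"
    using has_derivative_unique[OF 1] by blast
  then have "f' (1 *\<^sub>R v) = P (f' (1 *\<^sub>R v))" by (rule fun_cong)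
  then show ?thesis using P(1) by (metis rangeI scaleR_one subsetD)
qed

lemma smooth_on_has_derivative:
  assumes "smooth_on D f" "x \<in> D"
  obtains f' where "(f has_derivative f') (at x within D)"
proof -
  obtain N g where N: "open N" "x \<in> N" "\<And>k. C_on k g N" "\<And>y. y \<in> D \<Longrightarrow> y \<in> N \<Longrightarrow> g y = f y"
    using smooth_onE[OF assms] by metis
  obtain g' where "(g has_derivative g') (at x)"
    using C_on_has_derivative[OF N(3,2)] by metis
  then have g': "(g has_derivative g') (at x within D)" by (rule has_derivative_at_withinI)
  obtain e where "e > 0" "ball x e \<subseteq> N" using N(1,2) by (meson openE)
  then have "(f has_derivative g') (at x within D)"
    by (intro has_derivative_transform_within[OF g', of e]) (use N(4) assms(2) in \<open>auto simp: dist_commute subset_iff\<close>)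
  then show ?thesis by (rule that)
qed

text \<open>\<open>\<sigma>\<close> selects one point from each orbit in a neighbourhood, and \<open>\<Phi>\<close> straightens the set of
  selected points.\<close>

locale orbit_slice =
  fixes X :: "'a::euclidean_space set" and \<pi> :: "'a \<Rightarrow> 'b" and d :: nat
    and Q :: "'a set" and \<sigma> :: "'a \<Rightarrow> 'a"
    and N M :: "'a set" and \<Phi> \<Psi> :: "'a \<Rightarrow> 'a" and V :: "'a set"
  assumes open_Q: "open Q" and smooth_\<sigma>: "\<And>k. C_on k \<sigma> Q"
    and \<sigma>_in: "\<And>x. x \<in> X \<Longrightarrow> x \<in> Q \<Longrightarrow> \<sigma> x \<in> X \<and> \<sigma> x \<in> Q \<and> \<pi> (\<sigma> x) = \<pi> x"
    and \<sigma>_eq: "\<And>x y. x \<in> X \<Longrightarrow> x \<in> Q \<Longrightarrow> y \<in> X \<Longrightarrow> \<pi> x = \<pi> y \<Longrightarrow> y \<in> Q \<and> \<sigma> y = \<sigma> x"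
    and diffeo: "diffeo N M \<Phi> \<Psi>" and V: "subspace V" "dim V = d"
    and straight: "\<Phi> ` ({x \<in> X \<inter> Q. \<sigma> x = x} \<inter> N) = M \<inter> V"
begin

definition "chart_dom = \<pi> ` {x \<in> X \<inter> Q. \<sigma> x \<in> N}"
text \<open>The choice of representative is immaterial on \<open>chart_dom\<close>, since
  \<open>\<sigma>\<close> is constant on classes that meet \<open>Q\<close>.\<close>

definition "coord c = \<Phi> (\<sigma> (SOME x. x \<in> X \<and> \<pi> x = c))"

lemma in_chart_dom_iff: "x \<in> X \<Longrightarrow> \<pi> x \<in> chart_dom \<longleftrightarrow> x \<in> Q \<and> \<sigma> x \<in> N"
  unfolding chart_dom_def by (auto dest: \<sigma>_eq[of _ x, OF _ _ _ sym])

lemma coord_eq: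
  assumes "x \<in> X" "x \<in> Q"
  shows "coord (\<pi> x) = \<Phi> (\<sigma> x)"
proof -
  let ?y = "SOME y. y \<in> X \<and> \<pi> y = \<pi> x"
  have "?y \<in> X \<and> \<pi> ?y = \<pi> x" by (rule someI[of _ x]) (use assms in auto)
  then have "\<sigma> ?y = \<sigma> x" using \<sigma>_eq[OF assms, of ?y] by auto
  then show ?thesis by (simp add: coord_def)
qed

lemma \<sigma>_idem: "x \<in> X \<Longrightarrow> x \<in> Q \<Longrightarrow> \<sigma> (\<sigma> x) = \<sigma> x"
  using \<sigma>_in \<sigma>_eq by metis

lemma coord_in: "c \<in> chart_dom \<Longrightarrow> coord c \<in> M \<inter> V"
proof -
  assume "c \<in> chart_dom"
  then obtain x where x: "x \<in> X" "x \<in> Q" "\<sigma> x \<in> N" "c = \<pi> x" by (auto simp: chart_dom_def)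
  then have "\<sigma> x \<in> {x \<in> X \<inter> Q. \<sigma> x = x} \<inter> N" using \<sigma>_in \<sigma>_idem by auto
  then show ?thesis using coord_eq[OF x(1,2)] x(4) straight by blast
qed

lemma \<Psi>_in:
  assumes "v \<in> M \<inter> V"
  shows "\<Psi> v \<in> X" "\<pi> (\<Psi> v) \<in> chart_dom" "coord (\<pi> (\<Psi> v)) = v"
proof -
  have 1: "\<Psi> v \<in> {x \<in> X \<inter> Q. \<sigma> x = x} \<inter> N"
    by (rule diffeo_inv_into(1)[OF diffeo straight assms])
  then show "\<Psi> v \<in> X" by auto
  show "\<pi> (\<Psi> v) \<in> chart_dom" using 1 in_chart_dom_iff by auto
  show "coord (\<pi> (\<Psi> v)) = v"
    using 1 coord_eq[of "\<Psi> v"] diffeoD(8)[OF diffeo] assms by auto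
qed

lemma coord_image: "coord ` chart_dom = M \<inter> V"
proof
  show "M \<inter> V \<subseteq> coord ` chart_dom" using \<Psi>_in(2,3) by (metis imageI subsetI)
qed (use coord_in in auto)

lemma \<Psi>_coord:
  assumes "c \<in> chart_dom"
  shows "\<pi> (\<Psi> (coord c)) = c"
proof -
  obtain x where x: "x \<in> X" "x \<in> Q" "\<sigma> x \<in> N" "c = \<pi> x" using assms by (auto simp: chart_dom_def)
  then show ?thesis using coord_eq[OF x(1,2)] diffeoD(6)[OF diffeo x(3)] \<sigma>_in by simp
qed

lemma inj_coord: "inj_on coord chart_dom"
  by (rule inj_on_inverseI[of _ "\<lambda>v. \<pi> (\<Psi> v)"]) (rule \<Psi>_coord)

lemma inv_into_coord: "v \<in> coord ` chart_dom \<Longrightarrow> inv_into chart_dom coord v = \<pi> (\<Psi> v)"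
  using \<Psi>_coord inj_coord by auto

lemma smooth_coord: "smooth_on {x \<in> X. \<pi> x \<in> chart_dom} (\<lambda>x. coord (\<pi> x))"
proof (rule smooth_on_cong)
  let ?O = "Q \<inter> \<sigma> -` N"
  have o: "open ?O"
    by (rule continuous_open_preimage[OF C_on_continuous[OF smooth_\<sigma>[of 0]] open_Q diffeoD(1)[OF diffeo]])
  have "C_on k (\<lambda>x. \<Phi> (\<sigma> x)) ?O" for k
    by (rule C_on_compose[OF o C_on_subset[OF smooth_\<sigma>] diffeoD(3)[OF diffeo]]) auto
  then show "smooth_on {x \<in> X. \<pi> x \<in> chart_dom} (\<lambda>x. \<Phi> (\<sigma> x))"
    by (rule smooth_onI[OF o, rotated]) (use in_chart_dom_iff in auto)
qed (use in_chart_dom_iff coord_eq in auto)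

lemma smooth_\<Psi>: "smooth_on (coord ` chart_dom) \<Psi>"
  unfolding coord_image using diffeoD[OF diffeo] by (intro smooth_onI[of M]) auto

lemma open_preimage:
  assumes "open A"
  shows "openin (top_of_set X) {x \<in> X. \<pi> x \<in> chart_dom \<and> coord (\<pi> x) \<in> A}"
proof -
  let ?O = "Q \<inter> \<sigma> -` N"
  have o: "open ?O"
    by (rule continuous_open_preimage[OF C_on_continuous[OF smooth_\<sigma>[of 0]] open_Q diffeoD(1)[OF diffeo]])
  have "C_on 0 (\<lambda>x. \<Phi> (\<sigma> x)) ?O"
    by (rule C_on_compose[OF o C_on_subset[OF smooth_\<sigma>] diffeoD(3)[OF diffeo]]) auto
  then have "open (?O \<inter> (\<lambda>x. \<Phi> (\<sigma> x)) -` A)"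
    using o assms by (intro continuous_open_preimage[of ?O]) simp_all
  moreover have "{x \<in> X. \<pi> x \<in> chart_dom \<and> coord (\<pi> x) \<in> A} = X \<inter> (?O \<inter> (\<lambda>x. \<Phi> (\<sigma> x)) -` A)"
    using in_chart_dom_iff coord_eq by auto
  ultimately show ?thesis by (metis openin_open_Int)
qed

lemma openin_chart_dom: "openin (quotient_topology (top_of_set X) \<pi>) chart_dom"
  using open_preimage[of UNIV] by (auto simp: openin_quotient_topology chart_dom_def)

text \<open>The inverse is \<open>\<pi> o \<Psi>\<close>. Continuity of \<open>coord\<close> is
  tested upstairs, where it becomes continuity of \<open>\<Phi> o \<sigma>\<close>.\<close>

lemma homeomorphic_coord:
  "homeomorphic_map (subtopology (quotient_topology (top_of_set X) \<pi>) chart_dom) (top_of_set (coord ` chart_dom)) coord"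
proof -
  let ?T = "quotient_topology (top_of_set X) \<pi>"
  have ts: "topspace (subtopology ?T chart_dom) = chart_dom" by (auto simp: chart_dom_def)
  have "continuous_map (subtopology ?T chart_dom) euclidean coord"
    unfolding continuous_map
  proof (intro conjI allI impI)
    fix A :: "'a set" assume "openin euclidean A"
    then have "openin ?T {c \<in> chart_dom. coord c \<in> A}"
      using open_preimage[of A]
      by (auto simp: openin_quotient_topology chart_dom_def)
    then show "openin (subtopology ?T chart_dom) {x \<in> topspace (subtopology ?T chart_dom). coord x \<in> A}"
      unfolding ts openin_subtopology by (intro exI[of _ "{c \<in> chart_dom. coord c \<in> A}"]) auto
  qed auto
  then have 1: "continuous_map (subtopology ?T chart_dom) (top_of_set (coord ` chart_dom)) coord"
    using ts by (auto simp: continuous_map_in_subtopology)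
  have "continuous_map (top_of_set (M \<inter> V)) (top_of_set X) \<Psi>"
    using C_on_continuous[OF diffeoD(4)[OF diffeo, of 0]] \<Psi>_in(1)
    by (auto intro: continuous_on_subset)
  then have "continuous_map (top_of_set (M \<inter> V)) ?T (\<pi> \<circ> \<Psi>)"
    using quotient_map_quotient_topology quotient_imp_continuous_map continuous_map_compose by blast
  then have 2: "continuous_map (top_of_set (coord ` chart_dom)) (subtopology ?T chart_dom) (\<lambda>v. \<pi> (\<Psi> v))"
    using \<Psi>_in(2) by (auto simp: continuous_map_in_subtopology o_def coord_image)
  have "homeomorphic_maps (subtopology ?T chart_dom) (top_of_set (coord ` chart_dom)) coord (\<lambda>v. \<pi> (\<Psi> v))"
    unfolding homeomorphic_maps_def using 1 2 \<Psi>_coord \<Psi>_in(3) coord_image ts by auto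
  then show ?thesis using homeomorphic_map_maps by blast
qed

end

definition slice_charts ::
  "'a::euclidean_space set \<Rightarrow> ('a \<Rightarrow> 'b) \<Rightarrow> nat \<Rightarrow> ('b, 'a) chart set" where
  "slice_charts X \<pi> d = {(orbit_slice.chart_dom X \<pi> Q \<sigma> N, orbit_slice.coord X \<pi> \<sigma> \<Phi>, V) | Q \<sigma> N M \<Phi> \<Psi> V.
     orbit_slice X \<pi> d Q \<sigma> N M \<Phi> \<Psi> V}"

lemma slice_chartsE:
  assumes "(U, \<psi>, V) \<in> slice_charts X \<pi> d"
  obtains Q \<sigma> N M \<Phi> \<Psi> where "orbit_slice X \<pi> d Q \<sigma> N M \<Phi> \<Psi> V"
    "U = orbit_slice.chart_dom X \<pi> Q \<sigma> N" "\<psi> = orbit_slice.coord X \<pi> \<sigma> \<Phi>"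
  using assms unfolding slice_charts_def by auto

text \<open>Hides the slice data behind two smooth maps: the lift \<open>\<psi> o \<pi>\<close> of
  the chart to \<open>X\<close>, and a section \<open>\<Psi>\<close> of \<open>\<pi>\<close> over
  the chart. Transition maps and the submersion property use nothing else about \<sigma>.\<close>

lemma slice_charts_facts:
  assumes "(U, \<psi>, V) \<in> slice_charts X \<pi> d"
  obtains \<Psi> where "openin (quotient_topology (top_of_set X) \<pi>) U" "subspace V" "dim V = d"
    "openin (top_of_set V) (\<psi> ` U)"
    "homeomorphic_map (subtopology (quotient_topology (top_of_set X) \<pi>) U) (top_of_set (\<psi> ` U)) \<psi>"
    "smooth_on {x \<in> X. \<pi> x \<in> U} (\<lambda>x. \<psi> (\<pi> x))" "smooth_on (\<psi> ` U) \<Psi>"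
    "\<And>v. v \<in> \<psi> ` U \<Longrightarrow> \<Psi> v \<in> X" "\<And>v. v \<in> \<psi> ` U \<Longrightarrow> \<pi> (\<Psi> v) = inv_into U \<psi> v"
    "inj_on \<psi> U" "openin (top_of_set X) {x \<in> X. \<pi> x \<in> U}"
proof -
  obtain Q \<sigma> N M \<Phi> \<Psi> where s: "orbit_slice X \<pi> d Q \<sigma> N M \<Phi> \<Psi> V"
    "U = orbit_slice.chart_dom X \<pi> Q \<sigma> N" "\<psi> = orbit_slice.coord X \<pi> \<sigma> \<Phi>"
    using assms by (rule slice_chartsE)
  interpret orbit_slice X \<pi> d Q \<sigma> N M \<Phi> \<Psi> V by (rule s(1))
  have "openin (top_of_set V) (coord ` chart_dom)"
    unfolding coord_image using diffeoD(2)[OF diffeo] by (metis Int_commute openin_open_Int)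
  moreover have "openin (top_of_set X) {x \<in> X. \<pi> x \<in> chart_dom}" using open_preimage[of UNIV] by simp
  ultimately show ?thesis
    using \<Psi>_in(1) inv_into_coord[symmetric] coord_image
    by (intro that[unfolded s(2,3), OF openin_chart_dom V _ homeomorphic_coord smooth_coord smooth_\<Psi> _ _ inj_coord])
      auto
qed

text \<open>An invariant continuous function on a saturated neighbourhood descends to the quotient,
  where disjoint neighbourhoods of its two values pull back to the required open sets.
  \<open>W\<close> and \<open>f\<close> may depend on the pair of points.\<close>

lemma Hausdorff_quotient_topology:
  fixes \<pi> :: "'a::topological_space \<Rightarrow> 'b"
  assumes "\<And>x y. x \<in> X \<Longrightarrow> y \<in> X \<Longrightarrow> \<pi> x \<noteq> \<pi> y \<Longrightarrow>
    \<exists>W (f :: 'a \<Rightarrow> 'c::t2_space). open W \<and> x \<in> W \<and> y \<in> W \<and> continuous_on W f \<and> f x \<noteq> f y \<and>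
      (\<forall>u\<in>X \<inter> W. \<forall>v\<in>X. \<pi> u = \<pi> v \<longrightarrow> v \<in> W \<and> f v = f u)"
  shows "Hausdorff_space (quotient_topology (top_of_set X) \<pi>)"
  unfolding Hausdorff_space_def
proof (intro allI impI)
  fix a b
  assume "a \<in> topspace (quotient_topology (top_of_set X) \<pi>) \<and>
    b \<in> topspace (quotient_topology (top_of_set X) \<pi>) \<and> a \<noteq> b"
  then obtain x y where xy: "x \<in> X" "y \<in> X" "a = \<pi> x" "b = \<pi> y" "\<pi> x \<noteq> \<pi> y" by auto
  obtain W and f :: "'a \<Rightarrow> 'c" where W: "open W" "x \<in> W" "y \<in> W" "continuous_on W f" "f x \<noteq> f y"
    and inv: "\<And>u v. u \<in> X \<Longrightarrow> u \<in> W \<Longrightarrow> v \<in> X \<Longrightarrow> \<pi> u = \<pi> v \<Longrightarrow> v \<in> W \<and> f v = f u"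
    using assms[OF xy(1,2,5)] by auto
  obtain A B where AB: "open A" "open B" "f x \<in> A" "f y \<in> B" "A \<inter> B = {}"
    using hausdorff[OF W(5)] by auto
  have op: "openin (quotient_topology (top_of_set X) \<pi>) (\<pi> ` {u \<in> X \<inter> W. f u \<in> C})" if "open C" for C
  proof -
    have "{u \<in> X. \<pi> u \<in> \<pi> ` {u \<in> X \<inter> W. f u \<in> C}} = X \<inter> (W \<inter> f -` C)"
      by (auto dest: inv[OF _ _ _ sym])
    moreover have "open (W \<inter> f -` C)" using continuous_open_preimage[OF W(4,1) that] .
    ultimately show ?thesis by (auto simp: openin_quotient_topology openin_open_Int)
  qed
  have "disjnt (\<pi> ` {u \<in> X \<inter> W. f u \<in> A}) (\<pi> ` {u \<in> X \<inter> W. f u \<in> B})"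
  proof -
    have False if "u \<in> X" "u \<in> W" "f u \<in> A" "v \<in> X" "f v \<in> B" "\<pi> u = \<pi> v" for u v
      using inv[OF that(1,2,4,6)] that(3,5) AB(5) by auto
    then show ?thesis unfolding disjnt_iff by auto
  qed
  then show "\<exists>U V. openin (quotient_topology (top_of_set X) \<pi>) U \<and>
      openin (quotient_topology (top_of_set X) \<pi>) V \<and> a \<in> U \<and> b \<in> V \<and> disjnt U V"
    using op[OF AB(1)] op[OF AB(2)] xy W AB(3,4)
    by (intro exI[of _ "\<pi> ` {u \<in> X \<inter> W. f u \<in> A}"] exI[of _ "\<pi> ` {u \<in> X \<inter> W. f u \<in> B}"]) auto
qed

text \<open>What remains of the group action: points of one fibre are related by a smooth ambient
  map that preserves all fibres.\<close>

definition smooth_transport :: "'a::euclidean_space set \<Rightarrow> ('a \<Rightarrow> 'b) \<Rightarrow> bool" where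
  "smooth_transport X \<pi> \<longleftrightarrow> (\<forall>x\<in>X. \<forall>y\<in>X. \<pi> x = \<pi> y \<longrightarrow>
     (\<exists>T. (\<forall>k. C_on k T UNIV) \<and> T x = y \<and> (\<forall>z\<in>X. T z \<in> X \<and> \<pi> (T z) = \<pi> z)))"

lemma smooth_transportE:
  assumes "smooth_transport X \<pi>" "x \<in> X" "y \<in> X" "\<pi> x = \<pi> y"
  obtains T where "\<And>k. C_on k T UNIV" "T x = y" "\<And>z. z \<in> X \<Longrightarrow> T z \<in> X"
    "\<And>z. z \<in> X \<Longrightarrow> \<pi> (T z) = \<pi> z"
proof -
  obtain T where "(\<forall>k. C_on k T UNIV) \<and> T x = y \<and> (\<forall>z\<in>X. T z \<in> X \<and> \<pi> (T z) = \<pi> z)"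
    using assms unfolding smooth_transport_def by auto
  then show ?thesis by (intro that[of T]) auto
qed

text \<open>\<pi> is an open map, because the saturation of an open set is a union of its preimages
  under transport maps; open continuous images inherit a countable base.\<close>

lemma second_countable_quotient_topology:
  assumes "smooth_transport X \<pi>"
  shows "second_countable (quotient_topology (top_of_set X) \<pi>)"
proof (rule second_countable_open_map_image)
  show "continuous_map (top_of_set X) (quotient_topology (top_of_set X) \<pi>) \<pi>"
    by (rule quotient_imp_continuous_map[OF quotient_map_quotient_topology])
  show "\<pi> ` topspace (top_of_set X) = topspace (quotient_topology (top_of_set X) \<pi>)" by simp
  show "second_countable (top_of_set X)"
  proof (rule second_countable_subtopology)
    obtain B :: "'a set set" where B: "countable B" "topological_basis B"
      using ex_countable_basis by blast
    then show "second_countable (euclidean :: 'a topology)"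
      unfolding second_countable_def
      using topological_basis_open[OF B(2)]
      by (intro exI[of _ B]) (auto elim!: topological_basisE)
  qed
  show "open_map (top_of_set X) (quotient_topology (top_of_set X) \<pi>) \<pi>"
    unfolding open_map_def
  proof (intro allI impI)
    fix U assume U: "openin (top_of_set X) U"
    then obtain S where S: "open S" "U = X \<inter> S" by (auto simp: openin_open)
    have "openin (top_of_set X) {x \<in> X. \<pi> x \<in> \<pi> ` U}"
    proof (subst openin_subopen, intro ballI)
      fix x assume "x \<in> {x \<in> X. \<pi> x \<in> \<pi> ` U}"
      then obtain y where xy: "x \<in> X" "y \<in> X" "y \<in> S" "\<pi> x = \<pi> y" using S by auto
      obtain T where T: "\<And>k. C_on k T UNIV" "T x = y" "\<And>z. z \<in> X \<Longrightarrow> T z \<in> X"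
        "\<And>z. z \<in> X \<Longrightarrow> \<pi> (T z) = \<pi> z"
        using smooth_transportE[OF assms xy(1,2,4)] by metis
      have "open (T -` S)"
        using C_on_continuous[OF T(1)[of 0]] S(1) by (simp add: continuous_on_open_vimage)
      then have "openin (top_of_set X) (X \<inter> T -` S)" by (rule openin_open_Int)
      moreover have "X \<inter> T -` S \<subseteq> {x \<in> X. \<pi> x \<in> \<pi> ` U}"      proof clarify
        fix z assume z: "z \<in> X" "T z \<in> S"
        then have "T z \<in> U" "\<pi> z = \<pi> (T z)" using T(3,4) S(2) by auto
        then show "\<pi> z \<in> \<pi> ` U" by blast
      qed
      ultimately show "\<exists>A. openin (top_of_set X) A \<and> x \<in> A \<and> A \<subseteq> {x \<in> X. \<pi> x \<in> \<pi> ` U}"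
        using xy T(2) by (intro exI[of _ "X \<inter> T -` S"]) auto
    qed
    then show "openin (quotient_topology (top_of_set X) \<pi>) (\<pi> ` U)"
      using S by (auto simp: openin_quotient_topology)
  qed
qed

theorem smooth_atlas_slice_charts:
  assumes H: "Hausdorff_space (quotient_topology (top_of_set X) \<pi>)"
    and tr: "smooth_transport X \<pi>"
    and cover: "\<And>x. x \<in> X \<Longrightarrow> \<exists>(U, \<psi>, V)\<in>slice_charts X \<pi> d. \<pi> x \<in> U"
  shows "smooth_atlas (int d) (quotient_topology (top_of_set X) \<pi>) (slice_charts X \<pi> d)"
  unfolding smooth_atlas_def
proof (intro conjI)
  show "topspace (quotient_topology (top_of_set X) \<pi>) = (\<Union>(U, \<psi>, V)\<in>slice_charts X \<pi> d. U)"
  proof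
    show "topspace (quotient_topology (top_of_set X) \<pi>) \<subseteq> (\<Union>(U, \<psi>, V)\<in>slice_charts X \<pi> d. U)"
      using cover by fastforce
    show "(\<Union>(U, \<psi>, V)\<in>slice_charts X \<pi> d. U) \<subseteq> topspace (quotient_topology (top_of_set X) \<pi>)"
      by (auto elim!: slice_charts_facts dest!: openin_subset)
  qed
  show "\<forall>(U, \<psi>, V)\<in>slice_charts X \<pi> d. openin (quotient_topology (top_of_set X) \<pi>) U \<and>
      subspace V \<and> int (dim V) = int d \<and> openin (top_of_set V) (\<psi> ` U) \<and>
      homeomorphic_map (subtopology (quotient_topology (top_of_set X) \<pi>) U) (top_of_set (\<psi> ` U)) \<psi>"
    by (auto elim!: slice_charts_facts)
  show "\<forall>(U, \<phi>, V)\<in>slice_charts X \<pi> d. \<forall>(U', \<phi>', V')\<in>slice_charts X \<pi> d.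
      smooth_on (\<phi> ` (U \<inter> U')) (\<lambda>x. \<phi>' (inv_into U \<phi> x))"
  proof clarify
    fix U \<phi> V U' \<phi>' V'
    assume c: "(U, \<phi>, V) \<in> slice_charts X \<pi> d" and c': "(U', \<phi>', V') \<in> slice_charts X \<pi> d"
    obtain \<Psi> where 1: "smooth_on (\<phi> ` U) \<Psi>" "\<And>v. v \<in> \<phi> ` U \<Longrightarrow> \<Psi> v \<in> X"
      "\<And>v. v \<in> \<phi> ` U \<Longrightarrow> \<pi> (\<Psi> v) = inv_into U \<phi> v" "inj_on \<phi> U"
      using slice_charts_facts[OF c] by metis
    have 2: "smooth_on {x \<in> X. \<pi> x \<in> U'} (\<lambda>x. \<phi>' (\<pi> x))"
      using slice_charts_facts[OF c'] by metis
    \<comment> \<open>The transition map factors through \<open>X\<close>: the section of the first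
      chart, followed by the lift of the second.\<close>
    have "smooth_on (\<phi> ` (U \<inter> U')) (\<lambda>v. \<phi>' (\<pi> (\<Psi> v)))"
      by (rule smooth_on_compose[OF smooth_on_subset[OF 1(1)] 2]) (use 1 in auto)
    then show "smooth_on (\<phi> ` (U \<inter> U')) (\<lambda>x. \<phi>' (inv_into U \<phi> x))"
      by (rule smooth_on_cong) (use 1 in auto)
  qed
qed (use H second_countable_quotient_topology[OF tr] in auto)

text \<open>Surjectivity of the derivative: a local section of \<open>\<pi>\<close> through the given point yields a right
  inverse.\<close>

theorem submersion_slice_charts:
  assumes tr: "smooth_transport X \<pi>"
  shows "submersion (top_of_set X) (euclidean_charts k X) (quotient_topology (top_of_set X) \<pi>)
    (slice_charts X \<pi> d) \<pi>"
  unfolding submersion_def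
proof (intro conjI)
  show "continuous_map (top_of_set X) (quotient_topology (top_of_set X) \<pi>) \<pi>"
    by (rule quotient_imp_continuous_map[OF quotient_map_quotient_topology])
  have main: "smooth_on D F \<and> (\<forall>x\<in>D. \<exists>F'. (F has_derivative F') (at x within D) \<and> F' ` V = V')"
    if c: "(U, \<phi>, V) \<in> euclidean_charts k X" and c': "(U', \<psi>, V') \<in> slice_charts X \<pi> d"
      and D: "D = \<phi> ` (U \<inter> \<pi> -` U')" and F: "F = (\<lambda>x. \<psi> (\<pi> (inv_into U \<phi> x)))"
    for U \<phi> V U' \<psi> V' D F
  proof -
    have U: "openin (top_of_set X) U" "subspace V" "openin (top_of_set V) (\<phi> ` U)" "inj_on \<phi> U"
      "smooth_on U \<phi>" "smooth_on (\<phi> ` U) (inv_into U \<phi>)"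
      using c by (auto simp: euclidean_charts_def)
    have UX: "U \<subseteq> X" using U(1) openin_imp_subset by blast
    obtain \<Psi> where V': "subspace V'" "openin (top_of_set V') (\<psi> ` U')"
      and sm: "smooth_on {x \<in> X. \<pi> x \<in> U'} (\<lambda>x. \<psi> (\<pi> x))" "smooth_on (\<psi> ` U') \<Psi>"
      and \<Psi>: "\<And>v. v \<in> \<psi> ` U' \<Longrightarrow> \<Psi> v \<in> X" "\<And>v. v \<in> \<psi> ` U' \<Longrightarrow> \<pi> (\<Psi> v) = inv_into U' \<psi> v"
      and inj: "inj_on \<psi> U'" and oU': "openin (top_of_set X) {x \<in> X. \<pi> x \<in> U'}"
      using slice_charts_facts[OF c'] by metis
    have invU: "inv_into U \<phi> x \<in> U" "\<pi> (inv_into U \<phi> x) \<in> U'" if "x \<in> D" for x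
      using that U(4) D by auto
    have D_sub: "D \<subseteq> \<phi> ` U" using D by auto
    have smF: "smooth_on D F" unfolding F
      by (rule smooth_on_compose[OF smooth_on_subset[OF U(6) D_sub] sm(1)]) (use invU UX in auto)
    have "openin (top_of_set (\<phi> ` U)) (\<phi> ` U \<inter> inv_into U \<phi> -` {x \<in> X. \<pi> x \<in> U'})"
      by (rule continuous_openin_preimage[OF smooth_on_continuous_on[OF U(6)] _ oU']) (use UX U(4) in auto)
    moreover have "\<phi> ` U \<inter> inv_into U \<phi> -` {x \<in> X. \<pi> x \<in> U'} = D"
      using D U(4) UX by auto
    ultimately have oD: "openin (top_of_set V) D" using U(3) openin_trans by metis
    have FV': "F ` D \<subseteq> V'"
      using V'(2) invU openin_imp_subset unfolding F by blast
    have "\<exists>F'. (F has_derivative F') (at x within D) \<and> F' ` V = V'" if x: "x \<in> D" for x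
    proof -
      obtain F' where F': "(F has_derivative F') (at x within D)"
        using smooth_on_has_derivative[OF smF x] by metis
      let ?q = "inv_into U \<phi> x"
      let ?v = "\<psi> (\<pi> ?q)"
      have q: "?q \<in> X" "?q \<in> U" "\<phi> ?q = x" "?v \<in> \<psi> ` U'"
        using invU[OF x] UX x D_sub by (auto simp: f_inv_into_f)
      have "\<pi> (\<Psi> ?v) = \<pi> ?q" using \<Psi>(2)[OF q(4)] inj invU[OF x] by simp
      \<comment> \<open>\<open>\<Psi> ?v\<close> lies in the fibre of \<open>?q\<close> but may
        differ from \<open>?q\<close>; \<open>T\<close> moves the section so that it passes through
        \<open>?q\<close>.\<close>
      then obtain T where T: "\<And>k. C_on k T UNIV" "T (\<Psi> ?v) = ?q" "\<And>z. z \<in> X \<Longrightarrow> T z \<in> X"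
        "\<And>z. z \<in> X \<Longrightarrow> \<pi> (T z) = \<pi> z"
        using smooth_transportE[OF tr \<Psi>(1)[OF q(4)] q(1)] by metis
      have smT: "smooth_on (\<psi> ` U') (\<lambda>v. T (\<Psi> v))"
        by (rule smooth_on_compose[OF sm(2) smooth_onI[OF open_UNIV _ T(1)]]) auto
      define C where "C = \<psi> ` U' \<inter> (\<lambda>v. T (\<Psi> v)) -` U"
      have "openin (top_of_set (\<psi> ` U')) C" unfolding C_def
        by (rule continuous_openin_preimage[OF smooth_on_continuous_on[OF smT] _ U(1)]) (use \<Psi>(1) T(3) in auto)
      then have oC: "openin (top_of_set V') C" using V'(2) openin_trans by metis
      have vC: "?v \<in> C" unfolding C_def using q T(2) by auto
      let ?j = "\<lambda>v. \<phi> (T (\<Psi> v))"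
      have smj: "smooth_on C ?j"
        by (rule smooth_on_compose[OF smooth_on_subset[OF smT] U(5)]) (auto simp: C_def)
      obtain J' where J': "(?j has_derivative J') (at ?v within C)"
        using smooth_on_has_derivative[OF smj vC] by metis
      have inv_C: "\<pi> (T (\<Psi> v)) = inv_into U' \<psi> v" "inv_into U' \<psi> v \<in> U'" if "v \<in> C" for v
        using that \<Psi> T(4) by (auto simp: C_def inv_into_into)
      have jD: "?j ` C \<subseteq> D" unfolding D using inv_C by (auto simp: C_def)
      have Fj: "F (?j v) = v" if "v \<in> C" for v
      proof -
        have "inv_into U \<phi> (?j v) = T (\<Psi> v)" using that U(4) by (simp add: C_def)
        then show ?thesis using inv_C[OF that] that by (simp add: F C_def f_inv_into_f)
      qed
      have "((\<lambda>v. F (?j v)) has_derivative (\<lambda>v. F' (J' v))) (at ?v within C)"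
        using diff_chain_within[OF J', of F F'] has_derivative_subset[OF F' jD] q T(2)
        by (simp add: o_def)
      \<comment> \<open>\<open>C\<close> is open only in \<open>V'\<close>, so
        \<open>F' (J' v) = v\<close> is to be expected only for \<open>v\<close> in
        \<open>V'\<close>. The difference takes values in the subspace \<open>{0}\<close>, which
        puts its derivative there as well.\<close>
      then have "((\<lambda>v. F (?j v) - v) has_derivative (\<lambda>v. F' (J' v) - v)) (at ?v within C)"
        by (intro has_derivative_diff has_derivative_ident)
      then have FJ: "F' (J' v) - v \<in> {0}" if "v \<in> V'" for v
        by (rule derivative_into_subspace[OF _ oC vC V'(1) that subspace_single_0]) (use Fj in auto)
      have "J' v \<in> V" if "v \<in> V'" for v
        by (rule derivative_into_subspace[OF J' oC vC V'(1) that U(2)])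
          (use jD oD openin_imp_subset in blast)
      then have "V' \<subseteq> F' ` V" using FJ by (metis eq_iff_diff_eq_0 imageI singletonD subsetI)
      moreover have "F' ` V \<subseteq> V'"
        using derivative_into_subspace[OF F' oD x U(2) _ V'(1) FV'] by auto
      ultimately show ?thesis using F' by blast
    qed
    then show ?thesis using smF by blast
  qed
  show "\<forall>(U, \<phi>, V)\<in>euclidean_charts k X. \<forall>(U', \<psi>, V')\<in>slice_charts X \<pi> d.
      let D = \<phi> ` (U \<inter> \<pi> -` U'); F = (\<lambda>x. \<psi> (\<pi> (inv_into U \<phi> x)))
      in smooth_on D F \<and> (\<forall>x\<in>D. \<exists>F'. (F has_derivative F') (at x within D) \<and> F' ` V = V')"
  proof (intro ballI, unfold split_paired_all prod.case, intro ballI, unfold split_paired_all prod.case)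
    fix U \<phi> V U' \<psi> V'
    assume "(U, \<phi>, V) \<in> euclidean_charts k X" "(U', \<psi>, V') \<in> slice_charts X \<pi> d"
    from main[OF this refl refl]
    show "let D = \<phi> ` (U \<inter> \<pi> -` U'); F = (\<lambda>x. \<psi> (\<pi> (inv_into U \<phi> x)))
      in smooth_on D F \<and> (\<forall>x\<in>D. \<exists>F'. (F has_derivative F') (at x within D) \<and> F' ` V = V')"
      unfolding Let_def .
  qed
qed

section \<open>Complex matrices\<close>

abbreviation "ct \<equiv> conj_transpose"

section \<open>The Hermitian form, rank-one and unitary matrices\<close>

definition hdot :: "complex^'d \<Rightarrow> complex^'d \<Rightarrow> complex" where
  "hdot x y = (\<Sum>j\<in>UNIV. x $ j * cnj (y $ j))"

definition outer :: "complex^'d \<Rightarrow> complex^'d \<Rightarrow> complex^'d^'d" where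
  "outer v w = (\<chi> i j. v $ i * cnj (w $ j))"

lemma rank_one_eq_outer: "rank_one w = outer w w"
  by (simp add: rank_one_def outer_def)

lemma bilinear_matrix_mult: "bilinear ((**) :: complex^'d^'d \<Rightarrow> complex^'d^'d \<Rightarrow> complex^'d^'d)"
  unfolding bilinear_def
  by (auto intro!: linearI simp: matrix_matrix_mult_def vec_eq_iff algebra_simps sum.distrib
      scaleR_sum_right)

lemma bilinear_matrix_vector_mult: "bilinear ((*v) :: complex^'d^'d \<Rightarrow> complex^'d \<Rightarrow> complex^'d)"
  unfolding bilinear_def
  by (auto intro!: linearI simp: matrix_vector_mult_def vec_eq_iff algebra_simps sum.distrib
      scaleR_sum_right)

lemma bilinear_outer: "bilinear outer"
  unfolding bilinear_def
  by (auto intro!: linearI simp: outer_def vec_eq_iff algebra_simps)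

interpretation mm: bounded_bilinear "(**) :: complex^'d^'d \<Rightarrow> complex^'d^'d \<Rightarrow> complex^'d^'d"
  using bilinear_matrix_mult by (simp add: bilinear_conv_bounded_bilinear)

interpretation mv: bounded_bilinear "(*v) :: complex^'d^'d \<Rightarrow> complex^'d \<Rightarrow> complex^'d"
  using bilinear_matrix_vector_mult by (simp add: bilinear_conv_bounded_bilinear)

interpretation ou: bounded_bilinear "outer :: complex^'d \<Rightarrow> complex^'d \<Rightarrow> complex^'d^'d"
  using bilinear_outer by (simp add: bilinear_conv_bounded_bilinear)

lemma linear_ct: "linear (ct :: complex^'d^'d \<Rightarrow> _)"
  by (auto intro!: linearI simp: conj_transpose_def vec_eq_iff)

lemma ct_simps [simp]:
  "ct (ct A) = A" "ct (mat 1) = mat 1" "ct (outer v w) = outer w v" "ct 0 = 0"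
  by (simp_all add: conj_transpose_def vec_eq_iff mat_def outer_def)

lemmas ct_linear [simp] = linear_add[OF linear_ct] linear_diff[OF linear_ct] linear_neg[OF linear_ct]
  linear_scale[OF linear_ct] linear_sum[OF linear_ct]

lemma ct_mult [simp]: "ct (A ** B) = ct B ** ct A"
  by (simp add: conj_transpose_def matrix_matrix_mult_def vec_eq_iff mult.commute)

lemma ct_mat [simp]: "ct (mat c) = mat (cnj c)"
  by (simp add: conj_transpose_def vec_eq_iff mat_def)

lemma mat_commute: "mat c ** A = A ** mat (c::complex)"
  by (simp add: matrix_matrix_mult_def mat_def vec_eq_iff if_distrib if_distribR mult.commute cong: if_cong)

lemma mat_mult_vec: "mat c *v x = (c::complex) *s x"
  by (simp add: matrix_vector_mult_def mat_def vec_eq_iff if_distrib if_distribR cong: if_cong)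



lemma mat_nth: "mat c ** A = (\<chi> i j. (c::complex) * A $ i $ j)"
  by (simp add: matrix_matrix_mult_def mat_def vec_eq_iff if_distrib if_distribR cong: if_cong)

lemma scaleR_mat: "t *\<^sub>R (mat c :: complex^'d^'d) = mat (of_real t * c)"
  by (simp add: mat_def vec_eq_iff) (simp add: scaleR_conv_of_real)

lemma matrix_eqI: "(\<And>x. A *v x = B *v x) \<Longrightarrow> A = (B :: complex^'d^'d)"
  by (simp add: matrix_eq)

lemma mat_mult_mat: "mat c ** mat d = (mat (c * d) :: complex^'d^'d)"
  by (rule matrix_eqI) (simp add: matrix_vector_mul_assoc[symmetric] mat_mult_vec)

lemma hdot_ct: "hdot (A *v x) y = hdot x (ct A *v y)"
proof -
  have "hdot (A *v x) y = (\<Sum>i\<in>UNIV. \<Sum>j\<in>UNIV. A $ i $ j * x $ j * cnj (y $ i))"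
    by (simp add: hdot_def matrix_vector_mult_def sum_distrib_right)
  also have "\<dots> = (\<Sum>j\<in>UNIV. \<Sum>i\<in>UNIV. A $ i $ j * x $ j * cnj (y $ i))" by (rule sum.swap)
  also have "\<dots> = hdot x (ct A *v y)"
    by (simp add: hdot_def matrix_vector_mult_def conj_transpose_def sum_distrib_left mult_ac)
  finally show ?thesis .
qed

lemma hdot_cnj: "cnj (hdot x y) = hdot y x"
  by (simp add: hdot_def mult.commute)

lemma hdot_linear:
  "hdot (x + y) z = hdot x z + hdot y z" "hdot z (x + y) = hdot z x + hdot z y"
  "hdot (c *s x) z = c * hdot x z" "hdot z (c *s x) = cnj c * hdot z x"
  "hdot (t *\<^sub>R x) z = of_real t * hdot x z" "hdot z (t *\<^sub>R x) = of_real t * hdot z x"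
  "hdot 0 z = 0" "hdot z 0 = 0"
       apply (simp_all add: hdot_def algebra_simps sum.distrib sum_distrib_left)
   apply (simp_all add: scaleR_conv_of_real mult_ac)
  done

lemma Re_hdot: "Re (hdot x y) = x \<bullet> y"
  by (simp add: hdot_def inner_vec_def inner_complex_def)

lemma hdot_self: "hdot x x = of_real ((norm x)\<^sup>2)"
proof (rule complex_eqI)
  have "Im (hdot x x) = 0" by (simp add: hdot_def)
  then show "Im (hdot x x) = Im (of_real ((norm x)\<^sup>2))" by simp
qed (simp add: Re_hdot power2_norm_eq_inner)

lemma hdot_eq_0_iff: "hdot x y = 0 \<longleftrightarrow> x \<bullet> y = 0 \<and> x \<bullet> (\<i> *s y) = 0"
  by (simp add: complex_eq_iff Re_hdot[symmetric] hdot_linear)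

lemma hdot_eq_0_sym: "hdot x y = 0 \<Longrightarrow> hdot y x = 0"
  by (metis complex_cnj_zero hdot_cnj)

lemma outer_vec: "outer v w *v x = hdot x w *s v"
  by (simp add: outer_def hdot_def matrix_vector_mult_def vec_eq_iff sum_distrib_left sum_distrib_right mult_ac)

lemma mult_outer: "A ** outer v w = outer (A *v v) w"
  by (rule matrix_eqI) (simp add: matrix_vector_mul_assoc[symmetric] outer_vec vector_scalar_commute)

lemma outer_mult: "outer v w ** A = outer v (ct A *v w)"
  by (rule matrix_eqI) (simp add: matrix_vector_mul_assoc[symmetric] outer_vec hdot_ct)

lemma outer_scale: "outer (c *s v) w = mat c ** outer v w" "outer v (c *s w) = mat (cnj c) ** outer v w"
  by (simp_all add: mat_nth outer_def vec_eq_iff)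

lemma rank_one_scale: "rank_one (c *s v) = (cmod c)\<^sup>2 *\<^sub>R rank_one v"
proof -
  have "(c * v $ i) * cnj (c * v $ j) = (cmod c)\<^sup>2 *\<^sub>R (v $ i * cnj (v $ j))" for i j
    by (simp only: scaleR_conv_of_real complex_norm_square complex_cnj_mult mult_ac)
  then show ?thesis by (simp add: rank_one_def vec_eq_iff)
qed

lemma norm_cscale: "norm (c *s (v::complex^'d)) = cmod c * norm v"
  by (simp add: norm_vec_def norm_mult L2_set_right_distrib)

lemma trace_outer: "trace (outer v w) = hdot v w"
  by (simp add: trace_def outer_def hdot_def)

lemma linear_trace: "linear (trace :: complex^'d^'d \<Rightarrow> complex)"
  by (auto intro!: linearI simp: trace_def sum.distrib scaleR_sum_right)

lemma trace_mat: "trace (mat c :: complex^'d^'d) = of_nat CARD('d) * c"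
  by (simp add: trace_def mat_def)

lemma trace_ct: "trace (ct A) = cnj (trace A)"
  by (simp add: trace_def conj_transpose_def)

lemma inner_matrix: "A \<bullet> B = Re (trace (A ** ct B))"
  by (simp add: inner_vec_def trace_def matrix_matrix_mult_def conj_transpose_def inner_complex_def)

lemma unitary_mult_inverse:
  assumes "ct u ** u = mat 1"
  shows "unitary u"
  using assms matrix_left_right_inverse by (auto simp: unitary_def)

lemma norm_unitary_vec:
  assumes "unitary u"
  shows "norm (u *v x) = norm x"
proof -
  have "hdot (u *v x) (u *v x) = hdot x x"
    using assms by (simp add: hdot_ct matrix_vector_mul_assoc unitary_def)
  then have "complex_of_real ((norm (u *v x))\<^sup>2) = of_real ((norm x)\<^sup>2)" by (simp only: hdot_self)
  then show ?thesis by (simp only: of_real_eq_iff power2_eq_iff_nonneg norm_ge_zero)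
qed

lemma unitary_ct: "unitary u \<Longrightarrow> unitary (ct u)"
  by (auto simp: unitary_def)

lemma unitary_mult: "unitary u \<Longrightarrow> unitary v \<Longrightarrow> unitary (u ** v)"
  unfolding unitary_def ct_mult by (metis matrix_mul_assoc matrix_mul_rid)

lemma C_on_mm: "open S \<Longrightarrow> C_on k f S \<Longrightarrow> C_on k g S \<Longrightarrow> C_on k (\<lambda>x. (f x :: complex^'d^'d) ** (g x :: complex^'d^'d)) S"
  by (rule C_on_bilinear[OF mm.bounded_bilinear_axioms])

lemma C_on_mv: "open S \<Longrightarrow> C_on k f S \<Longrightarrow> C_on k g S \<Longrightarrow> C_on k (\<lambda>x. (f x :: complex^'d^'d) *v g x) S"
  by (rule C_on_bilinear[OF mv.bounded_bilinear_axioms])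

lemma C_on_vec:
  fixes f :: "'a::euclidean_space \<Rightarrow> 'i::finite \<Rightarrow> 'b::euclidean_space"
  assumes "open S" "\<And>i. C_on k (\<lambda>x. f x i) S"
  shows "C_on k (\<lambda>x. \<chi> i. f x i) S"
proof -
  have "C_on k (\<lambda>x. \<Sum>i\<in>UNIV. axis i (f x i)) S"
    by (intro C_on_sum C_on_linear_compose[where g = "axis _"] assms)
      (auto intro!: linearI simp: axis_def vec_eq_iff)
  moreover have "(\<Sum>i\<in>UNIV. axis i (f x i)) = (\<chi> i. f x i)" for x
    by (simp add: vec_eq_iff axis_def)
  ultimately show ?thesis by simp
qed

lemma C_on_nth: "open S \<Longrightarrow> C_on k f S \<Longrightarrow> C_on k (\<lambda>x. (f x :: ('b::euclidean_space)^'i::finite) $ i) S"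
  by (rule C_on_linear_compose) (auto intro: linearI)

text \<open>\<open>K\<^sup>-\<^sup>1\<^sup>/\<^sup>2\<close> near the identity, from the inverse function theorem for
  \<open>(K, Q) \<mapsto> (K, 1 + (Q K Q - K) / 2)\<close>, whose derivative at \<open>(1, 1)\<close> is the identity.\<close>

lemma inverse_square_root:
  obtains B :: "(complex^'d^'d) set" and q where "open B" "mat 1 \<in> B" "\<And>k. C_on k q B" "q (mat 1) = mat 1"
    "\<And>K. K \<in> B \<Longrightarrow> q K ** K ** q K = mat 1" "\<And>K. K \<in> B \<Longrightarrow> ct K = K \<Longrightarrow> ct (q K) = q K"
proof -
  let ?F = "\<lambda>z::(complex^'d^'d) \<times> (complex^'d^'d).
    (fst z, mat 1 + (1/2) *\<^sub>R (snd z ** fst z ** snd z - fst z))"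
  have lin: "linear (fst :: (complex^'d^'d) \<times> (complex^'d^'d) \<Rightarrow> _)"
    "linear (snd :: (complex^'d^'d) \<times> (complex^'d^'d) \<Rightarrow> _)"
    by (auto intro: linearI)
  have CF: "C_on k ?F UNIV" for k
    by (intro C_on_Pair C_on_add C_on_scaleR C_on_diff C_on_mm C_on_const
        C_on_linear_compose[OF _ lin(1) C_on_id] C_on_linear_compose[OF _ lin(2) C_on_id] open_UNIV)
  have DF: "(?F has_derivative (\<lambda>h. h)) (at (mat 1, mat 1))"
  proof -
    let ?one = "(mat 1, mat 1) :: (complex^'d^'d) \<times> (complex^'d^'d)"
    have bl: "(fst has_derivative fst) (at ?one)" "(snd has_derivative snd) (at ?one)"
      by (auto intro!: bounded_linear_imp_has_derivative bounded_linear_fst bounded_linear_snd)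
    have "((\<lambda>z. snd z ** fst z ** snd z) has_derivative (\<lambda>h. snd h + (fst h + snd h))) (at ?one)"
      using mm.FDERIV[OF mm.FDERIV[OF bl(2,1)] bl(2)] by simp
    then have "(?F has_derivative (\<lambda>h. (fst h, 0 + (1/2) *\<^sub>R (snd h + (fst h + snd h) - fst h)))) (at ?one)"
      by (intro has_derivative_Pair has_derivative_add has_derivative_scaleR_right has_derivative_diff
          has_derivative_const bl)
    moreover have "(1/2) *\<^sub>R (h2 + (h1 + h2) - h1) = h2" for h1 h2 :: "complex^'d^'d"
      by (simp add: scaleR_2[symmetric])
    ultimately show ?thesis by simp
  qed
  obtain N M g where N: "open N" "(mat 1, mat 1) \<in> N" "open M" "homeomorphism N M ?F g" "\<And>k. C_on k g M"
    using smooth_inverse_function[OF open_UNIV _ CF DF] by auto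
  have d: "diffeo N M ?F g" using N C_on_subset[OF CF] by (auto simp: diffeo_def)
  \<comment> \<open>Restricting to pairs whose adjoint pair also lies in \<open>N\<close> allows a
    root to be compared with its adjoint.\<close>
  let ?s = "\<lambda>z. (ct (fst z), ct (snd z)) :: (complex^'d^'d) \<times> (complex^'d^'d)"
  have "linear ?s" using linear_ct by (auto intro!: linearI)
  then have cs: "continuous_on UNIV ?s" by (simp add: linear_continuous_on linear_conv_bounded_linear)
  have "open (N \<inter> ?s -` N)"
    using N(1) cs by (intro open_Int) (auto simp: continuous_on_open_vimage)
  then have d1: "diffeo (N \<inter> ?s -` N) (?F ` (N \<inter> ?s -` N)) ?F g" by (rule diffeo_subset[OF d]) auto
  let ?M = "?F ` (N \<inter> ?s -` N)"
  \<comment> \<open>This is the value of \<open>?F\<close> at \<open>(K, Q)\<close> whenever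
    \<open>Q ** K ** Q = mat 1\<close>; hence \<open>g (?c K)\<close> recovers the inverse root of
    \<open>K\<close>.\<close>
  let ?c = "\<lambda>K. (K, mat 1 + (1/2) *\<^sub>R (mat 1 - K)) :: (complex^'d^'d) \<times> (complex^'d^'d)"
  have Cc: "C_on k ?c UNIV" for k
    by (intro C_on_Pair C_on_add C_on_scaleR C_on_diff C_on_const C_on_id open_UNIV)
  define B where "B = ?c -` ?M"
  define q where "q = (\<lambda>K. snd (g (?c K)))"
  have oB: "open B"
    unfolding B_def using C_on_continuous[OF Cc[of 0]] diffeoD(2)[OF d1]
    by (simp add: continuous_on_open_vimage)
  have Cq: "C_on k q B" for k
    unfolding q_def
    by (rule C_on_linear_compose[OF oB lin(2) C_on_compose[OF oB C_on_subset[OF Cc] diffeoD(4)[OF d1]]])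
      (auto simp: B_def)
  have F1: "?F (mat 1, mat 1) = ?c (mat 1)" by simp
  have 1: "mat 1 \<in> B" unfolding B_def vimage_eq F1[symmetric] by (rule imageI) (use N(2) in auto)
  have q1: "q (mat 1) = mat 1"
    unfolding q_def F1[symmetric] diffeoD(6)[OF d N(2)] by simp
  have *: "\<exists>Q. (K, Q) \<in> N \<and> (ct K, ct Q) \<in> N \<and> Q ** K ** Q = mat 1 \<and> q K = Q \<and> ?F (K, Q) = ?c K"
    if K: "K \<in> B" for K
  proof -
    obtain z where z: "z \<in> N" "?s z \<in> N" "?F z = ?c K" using K by (auto simp: B_def)
    obtain K' Q where zz: "z = (K', Q)" by (cases z)
    have K': "K' = K" using z(3) zz by simp
    have "(1/2) *\<^sub>R (Q ** K ** Q - K) = (1/2) *\<^sub>R (mat 1 - K)" using z(3) zz K' by simp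
    then have "Q ** K ** Q = mat 1" by (simp del: scaleR_half_double)
    moreover have "g (?c K) = z" using diffeoD(6)[OF d z(1)] unfolding z(3) .
    then have "q K = Q" by (simp add: q_def zz)
    ultimately show ?thesis using z zz K' by auto
  qed
  have "ct (q K) = q K" if K: "K \<in> B" "ct K = K" for K
  proof -
    obtain Q where Q: "(K, Q) \<in> N" "(ct K, ct Q) \<in> N" "Q ** K ** Q = mat 1" "q K = Q" "?F (K, Q) = ?c K"
      using *[OF K(1)] by metis
    \<comment> \<open>The adjoint solves the same equation, and \<open>?F\<close> is injective on
      \<open>N\<close>.\<close>
    have "ct Q ** K ** ct Q = mat 1" using arg_cong[OF Q(3), of ct] K(2) by (simp add: matrix_mul_assoc)
    then have "?F (K, ct Q) = ?F (K, Q)" using Q(3) by simp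
    then have "(K, ct Q) = (K, Q)"
      using diffeoD(6)[OF d Q(1)] diffeoD(6)[OF d, of "(K, ct Q)"] Q(2) K(2) by metis
    then show ?thesis using Q(4) by simp
  qed
  then show ?thesis using that[OF oB 1 Cq q1] * by metis
qed

text \<open>The line \<open>1 + t a\<close> is made unitary by the polar factor
  \<open>(e* e)^(-1/2)\<close>. Since \<open>(1 - t a)(1 + t a) = 1 - t^2 a^2\<close> has no linear
  term, this factor leaves the velocity \<open>a\<close> unchanged.\<close>

lemma unitary_curve:
  fixes a :: "complex^'d^'d"
  assumes a: "ct a = - a"
  obtains c where "c 0 = mat 1" "(c has_vector_derivative a) (at 0)" "eventually (\<lambda>t::real. unitary (c t)) (nhds 0)"
proof -
  obtain B :: "(complex^'d^'d) set" and q where B: "open B" "mat 1 \<in> B" "\<And>k. C_on k q B" "q (mat 1) = mat 1"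
    "\<And>K. K \<in> B \<Longrightarrow> q K ** K ** q K = mat 1" "\<And>K. K \<in> B \<Longrightarrow> ct K = K \<Longrightarrow> ct (q K) = q K"
    using inverse_square_root by metis
  let ?e = "\<lambda>t::real. mat 1 + t *\<^sub>R a"
  let ?K = "\<lambda>t. ct (?e t) ** ?e t"
  have ct_e: "ct (?e t) = mat 1 - t *\<^sub>R a" for t using a by simp
  obtain q' where q': "(q has_derivative q') (at (mat 1))"
    using C_on_has_derivative[OF B(3,2)] by metis
  have De: "(?e has_derivative (\<lambda>t. t *\<^sub>R a)) (at 0)" "((\<lambda>t. mat 1 - t *\<^sub>R a) has_derivative (\<lambda>t. - (t *\<^sub>R a))) (at 0)"
    by (auto intro!: derivative_eq_intros)
  have DK: "(?K has_derivative (\<lambda>t. 0)) (at 0)"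
    using mm.FDERIV[OF De(2,1)] unfolding ct_e by simp
  then have "((\<lambda>t. q (?K t)) has_derivative (\<lambda>t. q' 0)) (at 0)"
    by (rule has_derivative_compose) (use q' in simp)
  moreover have "q' 0 = 0" using has_derivative_linear[OF q'] by (simp add: linear_0)
  ultimately have Dq: "((\<lambda>t. q (?K t)) has_derivative (\<lambda>t. 0)) (at 0)" by simp
  let ?c = "\<lambda>t. ?e t ** q (?K t)"
  have "(?c has_derivative (\<lambda>t. t *\<^sub>R a)) (at 0)"
    using mm.FDERIV[OF De(1) Dq] B(4) by simp
  then have 1: "(?c has_vector_derivative a) (at 0)" by (simp add: has_vector_derivative_def)
  have "isCont ?K 0" using DK has_derivative_continuous by blast
  then have "eventually (\<lambda>t. ?K t \<in> B) (nhds 0)"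
    using B(1,2) by (auto simp: continuous_at_open eventually_nhds)
  moreover have "unitary (?c t)" if "?K t \<in> B" for t
  proof (rule unitary_mult_inverse)
    have "ct (?K t) = ?K t" by simp
    then have "ct (?c t) ** ?c t = q (?K t) ** ?K t ** q (?K t)"
      using B(6)[OF that] by (simp only: ct_mult matrix_mul_assoc)
    then show "ct (?c t) ** ?c t = mat 1" using B(5)[OF that] by simp
  qed
  ultimately have "eventually (\<lambda>t. unitary (?c t)) (nhds 0)" by (auto elim: eventually_mono)
  then show ?thesis using that[of ?c] 1 B(4) by simp
qed

lemma dim_image_kernel:
  fixes f :: "'a::euclidean_space \<Rightarrow> 'b::euclidean_space"
  assumes f: "linear f" and S: "subspace S"
  shows "dim (f ` S) + dim {x \<in> S. f x = 0} = dim S"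
proof -
  obtain g where g: "range g \<subseteq> S" "linear g" "\<forall>v\<in>f ` S. f (g v) = v"
    using linear_exists_right_inverse_on[OF f S] by auto
  let ?K = "{x \<in> S. f x = 0}" and ?G = "g ` f ` S"
  have K: "subspace ?K"
    unfolding subspace_def using S f by (auto simp: subspace_0 linear_0 linear_add subspace_add linear_scale subspace_scale)
  have fS: "subspace (f ` S)" using f S by (rule linear_subspace_image)
  have G: "subspace ?G" using g(2) fS by (rule linear_subspace_image)
  have "{x + y |x y. x \<in> ?K \<and> y \<in> ?G} = S"
  proof
    show "S \<subseteq> {x + y |x y. x \<in> ?K \<and> y \<in> ?G}"
    proof
      fix s assume s: "s \<in> S"
      have "s - g (f s) \<in> ?K"
        using s g S f by (auto simp: linear_diff intro: subspace_diff)
      then show "s \<in> {x + y |x y. x \<in> ?K \<and> y \<in> ?G}"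
        using s by (intro CollectI exI[of _ "s - g (f s)"] exI[of _ "g (f s)"]) auto
    qed
  qed (use S g in \<open>auto intro!: subspace_add\<close>)
  moreover have "?K \<inter> ?G = {0}"
  proof
    show "{0} \<subseteq> ?K \<inter> ?G" using subspace_0[OF K] subspace_0[OF G] by auto
  qed (use g linear_0[OF g(2)] in auto)
  moreover have "dim ?G = dim (f ` S)"
    using fS g(3) by (intro dim_image_eq[OF g(2)] inj_on_inverseI[of _ f]) (auto simp: span_eq_iff[THEN iffD2])
  ultimately show ?thesis using dim_sums_Int[OF K G] by simp
qed

section \<open>Real dimensions of spaces of Hermitian matrices\<close>

definition hermitians :: "(complex^'d^'d) set" where "hermitians = {A. ct A = A}"
definition skew_hermitians :: "(complex^'d^'d) set" where "skew_hermitians = {A. ct A = - A}"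

lemma subspace_hermitians: "subspace (hermitians :: (complex^'d^'d) set)"
  and subspace_skew_hermitians: "subspace (skew_hermitians :: (complex^'d^'d) set)"
  by (auto simp: subspace_def hermitians_def skew_hermitians_def)

lemma mat_i_skew: "(A :: complex^'d^'d) \<in> hermitians \<Longrightarrow> mat \<i> ** A \<in> skew_hermitians"
  "A \<in> skew_hermitians \<Longrightarrow> mat \<i> ** A \<in> hermitians"
proof -
  have "mat (-\<i>) ** A = - (mat \<i> ** A)" for A :: "complex^'d^'d"
    by (simp add: mat_nth vec_eq_iff)
  then show "A \<in> hermitians \<Longrightarrow> mat \<i> ** A \<in> skew_hermitians"
    "A \<in> skew_hermitians \<Longrightarrow> mat \<i> ** A \<in> hermitians"
    by (auto simp: hermitians_def skew_hermitians_def mat_commute[symmetric] mm.minus_right)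
qed

text \<open>Multiplication by the imaginary unit exchanges the two spaces, so their dimensions
  agree; together they split the matrix space, of real dimension
  \<open>2 * CARD('d) * CARD('d)\<close>.\<close>

lemma dim_hermitians:
  "dim (hermitians :: (complex^'d^'d) set) = CARD('d) * CARD('d)"
  "dim (skew_hermitians :: (complex^'d^'d) set) = CARD('d) * CARD('d)"
proof -
  let ?H = "hermitians :: (complex^'d^'d) set" and ?S = "skew_hermitians :: (complex^'d^'d) set"
  have lin: "linear (\<lambda>A::complex^'d^'d. mat \<i> ** A)" by (rule bounded_linear.linear[OF mm.bounded_linear_right])
  have "inj (\<lambda>A::complex^'d^'d. mat \<i> ** A)"
    by (auto simp: inj_on_def mat_nth vec_eq_iff)
  then have dim: "dim ((\<lambda>A. mat \<i> ** A) ` S) = dim S" for S :: "(complex^'d^'d) set"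
    by (intro dim_image_eq[OF lin]) (auto intro: inj_on_subset)
  have "dim ?H \<le> dim ?S" "dim ?S \<le> dim ?H"
    using dim_subset[of "(\<lambda>A. mat \<i> ** A) ` ?H" ?S] dim_subset[of "(\<lambda>A. mat \<i> ** A) ` ?S" ?H]
      dim mat_i_skew by (metis image_subsetI)+
  then have eq: "dim ?H = dim ?S" by simp
  have "x = 0" if "ct x = x" "ct x = - x" for x :: "complex^'d^'d"
  proof -
    have "x = - x" using that by (rule subst)
    then have "x $ i $ j = (- x) $ i $ j" for i j by (rule arg_cong)
    then show ?thesis by (simp add: vec_eq_iff)
  qed
  then have "?H \<inter> ?S = {0}"
    by (auto simp: hermitians_def skew_hermitians_def)
  moreover have "{x + y |x y. x \<in> ?H \<and> y \<in> ?S} = UNIV"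
  proof -
    have "A \<in> {x + y |x y. x \<in> ?H \<and> y \<in> ?S}" for A :: "complex^'d^'d"
    proof (intro CollectI exI conjI)
      show "A = (1/2) *\<^sub>R (A + ct A) + (1/2) *\<^sub>R (A - ct A)"
        by (simp add: algebra_simps scaleR_2[symmetric])
    qed (auto simp: hermitians_def skew_hermitians_def algebra_simps)
    then show ?thesis by blast
  qed
  ultimately have "2 * dim ?H = 2 * (CARD('d) * CARD('d))"
    using dim_sums_Int[OF subspace_hermitians[where 'd='d] subspace_skew_hermitians] eq by simp
  then show "dim ?H = CARD('d) * CARD('d)" "dim ?S = CARD('d) * CARD('d)" using eq by auto
qed

lemma dim_orthogonal_vector:
  fixes v :: "'a::euclidean_space"
  assumes "subspace S" "v \<in> S" "v \<noteq> 0"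
  shows "dim {x \<in> S. v \<bullet> x = 0} + 1 = dim S"
proof -
  have "{y \<in> S. \<forall>x\<in>span {v}. orthogonal x y} = {x \<in> S. v \<bullet> x = 0}"
    by (auto simp: orthogonal_def span_singleton)
  moreover have "span {v} \<subseteq> S" using assms by (simp add: span_minimal)
  ultimately show ?thesis
    using dim_subspace_orthogonal_to_vectors[OF subspace_span assms(1), of "{v}"] assms(3) by simp
qed

definition traceless_hermitians :: "(complex^'d^'d) set" where
  "traceless_hermitians = {A \<in> hermitians. trace A = 0}"

lemma traceless_hermitians_eq: "traceless_hermitians = {A \<in> hermitians. mat 1 \<bullet> A = 0}"
proof -
  have "trace A = 0 \<longleftrightarrow> mat 1 \<bullet> A = 0" if "A \<in> hermitians" for A :: "complex^'d^'d"
    using that trace_ct[of A] by (simp add: inner_matrix hermitians_def complex_eq_iff)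
  then show ?thesis by (auto simp: traceless_hermitians_def)
qed

lemma mat_1_neq_0: "mat 1 \<noteq> (0 :: complex^'d^'d)"
  by (metis matrix_vector_mul_lid matrix_vector_mult_0 axis_eq_0_iff zero_neq_one)

lemma dim_traceless_hermitians:
  "dim (traceless_hermitians :: (complex^'d^'d) set) + 1 = CARD('d) * CARD('d)"
  using dim_orthogonal_vector[OF subspace_hermitians _ mat_1_neq_0[where 'd='d]] dim_hermitians(1)[where 'd='d]
  by (simp add: traceless_hermitians_eq hermitians_def)

lemma subspace_traceless_hermitians: "subspace traceless_hermitians"
  unfolding traceless_hermitians_eq using subspace_hermitians
  by (auto simp: subspace_def inner_right_distrib)

text \<open>Differentiate \<open>\<rho> (\<gamma> t) = \<gamma> t\<close> at \<open>t = 0\<close>.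
  This exhibits velocities of curves in \<open>Y\<close> as elements of the range of
  \<open>L\<close>.\<close>

lemma local_retraction_derivative_tangent:
  assumes ret: "local_retraction U \<rho> Y" and p: "p \<in> U" and L: "(\<rho> has_derivative L) (at p)"
    and \<gamma>: "\<gamma> 0 = p" "(\<gamma> has_vector_derivative \<xi>) (at 0)" "eventually (\<lambda>t::real. \<gamma> t \<in> Y) (nhds 0)"
  shows "L \<xi> = \<xi>"
proof -
  have U: "open U" "\<And>x. x \<in> Y \<Longrightarrow> x \<in> U \<Longrightarrow> \<rho> x = x" using ret by (auto simp: local_retraction_def)
  have D\<gamma>: "(\<gamma> has_derivative (\<lambda>t. t *\<^sub>R \<xi>)) (at 0)" using \<gamma>(2) by (simp add: has_vector_derivative_def)
  have "isCont \<gamma> 0" using \<gamma>(2) has_vector_derivative_continuous by blast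
  then have "eventually (\<lambda>t. \<gamma> t \<in> U) (nhds 0)"
    using U(1) p \<gamma>(1) by (auto simp: continuous_at_open eventually_nhds)
  with \<gamma>(3) have "eventually (\<lambda>t. \<gamma> t \<in> U \<and> \<gamma> t \<in> Y) (nhds 0)" by eventually_elim auto
  then obtain S where S: "open S" "0 \<in> S" "\<And>t. t \<in> S \<Longrightarrow> \<gamma> t \<in> U \<and> \<gamma> t \<in> Y"
    by (auto simp: eventually_nhds)
  have "((\<lambda>t. \<rho> (\<gamma> t)) has_derivative (\<lambda>t. L (t *\<^sub>R \<xi>))) (at 0)"
    by (rule has_derivative_compose[OF D\<gamma>]) (use L \<gamma>(1) in simp)
  then have "(\<gamma> has_derivative (\<lambda>t. L (t *\<^sub>R \<xi>))) (at 0)"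
    by (rule has_derivative_transform_within_open[OF _ S(1,2)]) (use S(3) U(2) in auto)
  then have "(\<lambda>t. L (t *\<^sub>R \<xi>)) = (\<lambda>t. t *\<^sub>R \<xi>)" using D\<gamma> has_derivative_unique by blast
  then have "L (1 *\<^sub>R \<xi>) = 1 *\<^sub>R \<xi>" by (rule fun_cong)
  then show ?thesis by simp
qed

lemma has_derivative_vec_lambda:
  fixes f :: "'a::real_normed_vector \<Rightarrow> 'i::finite \<Rightarrow> 'b::euclidean_space"
  assumes "\<And>i. ((\<lambda>x. f x i) has_derivative (\<lambda>h. f' h i)) F"
  shows "((\<lambda>x. \<chi> i. f x i) has_derivative (\<lambda>h. \<chi> i. f' h i)) F"
proof -
  have "((\<lambda>x. \<Sum>i\<in>UNIV. axis i (f x i)) has_derivative (\<lambda>h. \<Sum>i\<in>UNIV. axis i (f' h i))) F"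
  proof (rule has_derivative_sum)
    fix i :: 'i
    have "linear (axis i :: 'b \<Rightarrow> 'b^'i)"
      by (auto intro!: linearI simp: axis_def vec_eq_iff)
    then show "((\<lambda>x. axis i (f x i)) has_derivative (\<lambda>h. axis i (f' h i))) F"
      by (intro bounded_linear.has_derivative[OF _ assms]) (simp add: linear_conv_bounded_linear)
  qed
  moreover have "(\<Sum>i\<in>UNIV. axis i (y i)) = (\<chi> i. y i)" for y :: "'i \<Rightarrow> 'b"
    by (simp add: vec_eq_iff axis_def)
  ultimately show ?thesis by simp
qed

lemma orthogonal_span_iff: "(\<forall>x\<in>span S. orthogonal x v) \<longleftrightarrow> (\<forall>x\<in>S. orthogonal x v)"
proof (intro iffI ballI)
  fix x assume "\<forall>x\<in>S. orthogonal x v" "x \<in> span S"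
  then have "orthogonal v x"
    by (intro orthogonal_to_span[of x S]) (auto simp: orthogonal_commute)
  then show "orthogonal x v" by (simp add: orthogonal_commute)
qed (simp add: span_base)

lemma mat_uminus: "mat (- c) = - (mat c :: complex^'d^'d)"
  by (simp add: mat_def vec_eq_iff)

lemma hdot_diff: "hdot (x - y) z = hdot x z - hdot y z"
  by (simp add: hdot_def left_diff_distrib sum_subtractf)

section \<open>Tuples of weighted projections\<close>

definition conj_tuple :: "complex^'d^'d \<Rightarrow> complex^'d^'d^'n \<Rightarrow> complex^'d^'d^'n" where
  "conj_tuple u x = (\<chi> i. u ** x $ i ** ct u)"

lemma unitary_orbit_eq: "unitary_orbit x = {conj_tuple u x | u. unitary u}"
  by (simp add: unitary_orbit_def conj_tuple_def)

lemma conj_tuple_mult: "conj_tuple u (conj_tuple v x) = conj_tuple (u ** v) x"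
  by (simp add: conj_tuple_def vec_eq_iff matrix_mul_assoc)

lemma conj_tuple_1 [simp]: "conj_tuple (mat 1) x = x"
  by (simp add: conj_tuple_def vec_eq_iff)

lemma linear_conj_tuple: "linear (conj_tuple u)"
  by (auto intro!: linearI simp: conj_tuple_def vec_eq_iff mm.add_left mm.add_right mm.scaleR_left mm.scaleR_right)

lemma unitary_orbit_conj_tuple:
  assumes u: "unitary u"
  shows "unitary_orbit (conj_tuple u x) = unitary_orbit x"
proof
  show "unitary_orbit (conj_tuple u x) \<subseteq> unitary_orbit x"
    using u unitary_mult by (auto simp: unitary_orbit_eq conj_tuple_mult)
  show "unitary_orbit x \<subseteq> unitary_orbit (conj_tuple u x)"
  proof
    fix y assume "y \<in> unitary_orbit x"
    then obtain v where v: "unitary v" "y = conj_tuple v x" by (auto simp: unitary_orbit_eq)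
    have "y = conj_tuple (v ** ct u) (conj_tuple u x)"
      using v(2) u by (simp add: conj_tuple_mult matrix_mul_assoc[symmetric] unitary_def)
    then show "y \<in> unitary_orbit (conj_tuple u x)"
      using u v(1) unitary_mult unitary_ct by (auto simp: unitary_orbit_eq)
  qed
qed

lemma unitary_orbit_eqD:
  assumes "unitary_orbit x = unitary_orbit y"
  obtains u where "unitary u" "y = conj_tuple u x"
proof -
  have "y \<in> unitary_orbit y"
    by (auto simp: unitary_orbit_eq unitary_def intro!: exI[of _ "mat 1"])
  then show ?thesis using that assms by (auto simp: unitary_orbit_eq)
qed

lemma weighted_projections_conj:
  assumes "A \<in> weighted_projections \<rho>" "unitary u"
  shows "u ** A ** ct u \<in> weighted_projections \<rho>"
proof -
  obtain w where w: "norm w = 1" "A = \<rho> *\<^sub>R outer w w"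
    using assms(1) by (auto simp: weighted_projections_def rank_one_eq_outer)
  have "u ** A ** ct u = \<rho> *\<^sub>R outer (u *v w) (u *v w)"
    by (simp add: w(2) mm.scaleR_left mm.scaleR_right mult_outer outer_mult)
  then show ?thesis
    using w(1) norm_unitary_vec[OF assms(2)] by (auto simp: weighted_projections_def rank_one_eq_outer)
qed

lemma Mtilde_conj:
  assumes "x \<in> Mtilde r" "unitary u"
  shows "conj_tuple u x \<in> Mtilde r"
proof -
  have "(\<Sum>i\<in>UNIV. conj_tuple u x $ i) = u ** (\<Sum>i\<in>UNIV. x $ i) ** ct u"
    by (simp add: conj_tuple_def mm.sum_left mm.sum_right)
  also have "\<dots> = (\<Sum>i\<in>UNIV. x $ i)"
    using assms by (simp add: Mtilde_def mm.scaleR_left mm.scaleR_right unitary_def)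
  finally show ?thesis
    using assms weighted_projections_conj by (auto simp: Mtilde_def projections_product_def conj_tuple_def)
qed

lemma smooth_transport_Mtilde: "smooth_transport (Mtilde r) unitary_orbit"
  unfolding smooth_transport_def
proof (intro ballI impI)
  fix x y assume xy: "x \<in> Mtilde r" "y \<in> Mtilde r" "unitary_orbit x = unitary_orbit y"
  obtain u where u: "unitary u" "y = conj_tuple u x" using unitary_orbit_eqD[OF xy(3)] .
  show "\<exists>T. (\<forall>k. C_on k T UNIV) \<and> T x = y \<and>
      (\<forall>z\<in>Mtilde r. T z \<in> Mtilde r \<and> unitary_orbit (T z) = unitary_orbit z)"
    using u
    by (intro exI[of _ "conj_tuple u"])
      (simp add: C_on_bounded_linear linear_conj_tuple linear_conv_bounded_linear[symmetric]
        Mtilde_conj unitary_orbit_conj_tuple)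
qed

text \<open>A nonzero projection fixes some unit vector \<open>w\<close>, and subtracting
  \<open>outer w w\<close> leaves a projection of trace one less. The induction runs over an integer
  bound for the trace and stops because the trace of \<open>P\<close> equals
  \<open>P \<bullet> P\<close>, which is nonnegative.\<close>

lemma trace_projection_nat:
  fixes P :: "complex^'d^'d"
  assumes "ct P = P" "P ** P = P"
  shows "\<exists>k::nat. trace P = of_nat k"
proof -
  have "Re (trace P) < real n \<Longrightarrow> ct P = P \<Longrightarrow> P ** P = P \<Longrightarrow> \<exists>k::nat. trace P = of_nat k"
    for n and P :: "complex^'d^'d"
  proof (induction n arbitrary: P)
    case 0
    have "Re (trace P) = P \<bullet> P" using 0 by (simp add: inner_matrix)
    then show ?case using 0 inner_ge_zero[of P] by linarith
  next
    case (Suc n)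
    show ?case
    proof (cases "P = 0")
      case True
      then show ?thesis by (intro exI[of _ 0]) (simp add: trace_def)
    next
      case False
      then obtain x where x: "P *v x \<noteq> 0" by (metis matrix_eqI matrix_vector_mult_0)
      define w where "w = (1 / norm (P *v x)) *\<^sub>R (P *v x)"
      have w: "hdot w w = 1" using x by (simp add: hdot_self w_def)
      have Pw: "P *v w = w"
        using Suc.prems(3) by (simp add: w_def mv.scaleR_right matrix_vector_mul_assoc)
      let ?P = "P - outer w w"
      have "?P ** ?P = ?P"
        using Suc.prems Pw w
        by (simp add: mm.diff_left mm.diff_right mult_outer outer_mult outer_vec mv.diff_left
            ou.diff_left ou.diff_right ou.zero_left)
      moreover have "ct ?P = ?P" using Suc.prems by simp
      moreover have tr: "trace ?P = trace P - 1" by (simp add: trace_sub trace_outer w)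
      ultimately obtain k :: nat where "trace ?P = of_nat k" using Suc.IH[of ?P] Suc.prems(1) by auto
      then have "trace P = of_nat (Suc k)" using tr by (simp add: algebra_simps)
      then show ?thesis by blast
    qed
  qed
  moreover obtain n where "Re (trace P) < real n" using reals_Archimedean2 by blast
  ultimately show ?thesis using assms by blast
qed

section \<open>Infinitesimal conjugation and the tangent space of the product\<close>

definition comm :: "complex^'d^'d \<Rightarrow> complex^'d^'d \<Rightarrow> complex^'d^'d" where
  "comm a x = a ** x - x ** a"

lemma bilinear_comm: "comm (a + b) x = comm a x + comm b x" "comm (t *\<^sub>R a) x = t *\<^sub>R comm a x"
  "comm 0 x = 0"
  by (simp_all add: comm_def mm.add_left mm.add_right mm.scaleR_left mm.scaleR_right algebra_simps)

lemma conj_curve_derivative: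
  assumes "c 0 = mat 1" "(c has_vector_derivative a) (at (0::real))" "ct a = - a"
  shows "((\<lambda>t. c t ** A ** ct (c t)) has_vector_derivative comm a A) (at 0)"
proof -
  have c: "(c has_derivative (\<lambda>t. t *\<^sub>R a)) (at 0)" using assms(2) by (simp add: has_vector_derivative_def)
  have "bounded_linear (ct :: complex^'d^'d \<Rightarrow> _)"
    using linear_ct by (simp add: linear_conv_bounded_linear)
  then have ctc: "((\<lambda>t. ct (c t)) has_derivative (\<lambda>t. ct (t *\<^sub>R a))) (at 0)"
    using c by (rule bounded_linear.has_derivative)
  have "((\<lambda>t. c t ** A) has_derivative (\<lambda>t. (t *\<^sub>R a) ** A)) (at 0)"
    using c by (rule bounded_linear.has_derivative[OF mm.bounded_linear_left])
  from mm.FDERIV[OF this ctc] show ?thesis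
    using assms(1,3) by (simp add: has_vector_derivative_def comm_def mm.scaleR_left mm.scaleR_right
        mm.minus_right algebra_simps)
qed

locale projection_tuple =
  fixes r :: "real^'n" and p :: "complex^'d^'d^'n" and w :: "'n \<Rightarrow> complex^'d"
  assumes r_pos: "\<And>i. 0 < r $ i" and norm_w: "\<And>i. norm (w i) = 1"
    and p_eq: "\<And>i. p $ i = r $ i *\<^sub>R outer (w i) (w i)"
begin

lemma hdot_w [simp]: "hdot (w i) (w i) = 1"
  by (simp add: hdot_self norm_w)

lemma w_neq_0: "w i \<noteq> 0"
  using norm_w[of i] by auto

lemma p_in: "p \<in> projections_product r"
  using norm_w by (auto simp: projections_product_def weighted_projections_def p_eq rank_one_eq_outer)

lemma ct_p [simp]: "ct (p $ i) = p $ i"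
  by (simp add: p_eq)

lemma p_vec: "p $ i *v x = (of_real (r $ i) * hdot x (w i)) *s w i"
  by (simp add: p_eq mv.scaleR_left outer_vec vec_eq_iff scaleR_conv_of_real[where 'a=complex])

definition retr_dom :: "(complex^'d^'d^'n) set" where
  "retr_dom = {x. \<forall>i. x $ i *v w i \<noteq> 0}"

text \<open>On the orbit, \<open>x $ i *v w i\<close> is a multiple of the vector spanning the image
  of \<open>x $ i\<close>, so its normalised rank-one matrix recovers \<open>x $ i\<close>. The
  formula makes sense for every matrix that does not kill \<open>w i\<close>, which yields the
  extension off the orbit.\<close>

definition retr :: "complex^'d^'d^'n \<Rightarrow> complex^'d^'d^'n" where
  "retr x = (\<chi> i. (r $ i * inverse ((x $ i *v w i) \<bullet> (x $ i *v w i))) *\<^sub>R outer (x $ i *v w i) (x $ i *v w i))"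

lemma p_in_retr_dom: "p \<in> retr_dom"
  using w_neq_0 r_pos by (auto simp: retr_dom_def p_vec less_imp_neq[symmetric] vector_mul_eq_0)

lemma local_retraction_retr: "local_retraction retr_dom retr (projections_product r)"
  unfolding local_retraction_def
proof (intro conjI allI ballI)
  have lin: "linear (\<lambda>x::complex^'d^'d^'n. x $ i *v w i)" for i
    by (auto intro!: linearI simp: mv.add_left mv.scaleR_left)
  have "open {x::complex^'d^'d^'n. x $ i *v w i \<noteq> 0}" for i
    using lin[of i] by (intro open_Collect_neq) (auto simp: linear_conv_bounded_linear linear_continuous_on)
  then have "open (\<Inter>i. {x::complex^'d^'d^'n. x $ i *v w i \<noteq> 0})" by (intro open_INT) auto
  moreover have "(\<Inter>i. {x::complex^'d^'d^'n. x $ i *v w i \<noteq> 0}) = retr_dom" by (auto simp: retr_dom_def)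
  ultimately show o: "open retr_dom" by simp
  fix k
  have Cl: "C_on k (\<lambda>x::complex^'d^'d^'n. x $ i *v w i) retr_dom" for i
    using lin[of i] o by (intro C_on_bounded_linear) (auto simp: linear_conv_bounded_linear)
  have "C_on k (\<lambda>x. inverse ((x $ i *v w i) \<bullet> (x $ i *v w i))) retr_dom" for i
    by (rule C_on_compose[OF o C_on_inner[OF o Cl Cl] C_on_inverse]) (auto simp: retr_dom_def)
  then have "C_on k (\<lambda>x. ((r $ i) *\<^sub>R inverse ((x $ i *v w i) \<bullet> (x $ i *v w i))) *\<^sub>R outer (x $ i *v w i) (x $ i *v w i)) retr_dom" for i
    using Cl by (intro C_on_scaleR[OF o] C_on_const[OF o] C_on_bilinear[OF ou.bounded_bilinear_axioms o])
  then show "C_on k retr retr_dom"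
    unfolding retr_def[abs_def] by (intro C_on_vec[OF o]) simp
next
  show "retr ` retr_dom \<subseteq> projections_product r"
  proof (clarsimp simp: projections_product_def)
    fix x i assume x: "x \<in> retr_dom"
    let ?y = "x $ i *v w i"
    let ?v = "(1 / norm ?y) *\<^sub>R ?y"
    have y: "?y \<noteq> 0" using x by (simp add: retr_dom_def)
    have "retr x $ i = r $ i *\<^sub>R outer ?v ?v"
      by (simp add: retr_def ou.scaleR_left ou.scaleR_right power2_norm_eq_inner[symmetric] power2_eq_square divide_inverse)
    moreover have "norm ?v = 1" using y by simp
    ultimately show "retr x $ i \<in> weighted_projections (r $ i)"
      by (auto simp: weighted_projections_def rank_one_eq_outer)
  qed
next
  fix x assume x: "x \<in> projections_product r \<inter> retr_dom"
  have "retr x $ i = x $ i" for i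
  proof -
    obtain v where v: "norm v = 1" "x $ i = r $ i *\<^sub>R outer v v"
      using x by (auto simp: projections_product_def weighted_projections_def rank_one_eq_outer)
    define c where "c = of_real (r $ i) * hdot (w i) v"
    have y: "x $ i *v w i = c *s v"
      by (simp add: v(2) c_def mv.scaleR_left outer_vec vec_eq_iff scaleR_conv_of_real[where 'a=complex])
    moreover have "x $ i *v w i \<noteq> 0" using x by (auto simp: retr_dom_def)
    ultimately have c: "cmod c \<noteq> 0" by auto
    have "(c *s v) \<bullet> (c *s v) = (cmod c)\<^sup>2"
      by (simp add: power2_norm_eq_inner[symmetric] norm_cscale v(1))
    moreover have "outer (c *s v) (c *s v) = (cmod c)\<^sup>2 *\<^sub>R outer v v"
      using rank_one_scale[of c v] by (simp add: rank_one_eq_outer)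
    ultimately have "retr x $ i = r $ i *\<^sub>R outer v v" using c by (simp add: retr_def y)
    then show ?thesis using v(2) by simp
  qed
  then show "retr x = x" by (simp add: vec_eq_iff)
qed

definition tangent :: "(complex^'d^'d^'n) set" where
  "tangent = {\<xi>. \<forall>i. \<exists>a. ct a = - a \<and> \<xi> $ i = comm a (p $ i)}"

text \<open>The generator \<open>a\<close> in \<open>tangent\<close> is not determined by \<xi>,
  whereas the vector \<open>v\<close> orthogonal to \<open>w i\<close> is; this form gives linearity
  and the dimension.\<close>

lemma tangent_eq:
  "tangent = (\<lambda>v. \<chi> i. outer (v $ i) (w i) + outer (w i) (v $ i)) ` {v. \<forall>i. hdot (v $ i) (w i) = 0}" (is "_ = ?F ` ?V")
proof
  show "tangent \<subseteq> ?F ` ?V"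
  proof
    fix \<xi> assume "\<xi> \<in> tangent"
    then have "\<exists>v. hdot v (w i) = 0 \<and> \<xi> $ i = outer v (w i) + outer (w i) v" for i
    proof -
      obtain a where a: "ct a = - a" "\<xi> $ i = comm a (p $ i)"
        using \<open>\<xi> \<in> tangent\<close> by (auto simp: tangent_def)
      let ?l = "hdot (a *v w i) (w i)"
      let ?v = "r $ i *\<^sub>R (a *v w i - ?l *s w i)"
      \<comment> \<open>The component of \<open>a *v w i\<close> along \<open>w i\<close> is an
        imaginary multiple of \<open>w i\<close>, so its two contributions to the commutator cancel
        and it may be subtracted.\<close>
      have l: "cnj ?l = - ?l"
      proof -
        have "?l = hdot (w i) (ct a *v w i)" by (rule hdot_ct)
        then have "?l = - hdot (w i) (a *v w i)" unfolding a(1) by (simp add: mv.minus_left hdot_def sum_negf)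
        then show ?thesis by (simp add: hdot_cnj)
      qed
      have "hdot ?v (w i) = 0"
        by (simp add: hdot_linear hdot_diff)
      moreover have "\<xi> $ i = outer ?v (w i) + outer (w i) ?v"
        using l by (simp add: a comm_def p_eq mm.scaleR_left mm.scaleR_right mult_outer outer_mult mv.minus_left
            ou.minus_right ou.diff_left ou.diff_right ou.scaleR_left ou.scaleR_right outer_scale algebra_simps)
          (simp add: mat_uminus mv.minus_left ou.minus_left)
      ultimately show ?thesis by blast
    qed
    then obtain v where v: "\<And>i. hdot (v i) (w i) = 0" "\<And>i. \<xi> $ i = outer (v i) (w i) + outer (w i) (v i)"
      by metis
    then show "\<xi> \<in> ?F ` ?V"
      by (intro image_eqI[of _ _ "\<chi> i. v i"]) (auto simp: vec_eq_iff)
  qed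
  show "?F ` ?V \<subseteq> tangent"
  proof clarify
    fix v :: "complex^'d^'n" assume v: "\<forall>i. hdot (v $ i) (w i) = 0"
    show "?F v \<in> tangent"
      unfolding tangent_def
    proof (clarify, intro exI conjI)
      fix i
      \<comment> \<open>The infinitesimal rotation of \<open>w i\<close> towards
        \<open>v $ i\<close>; the factor \<open>1 / r $ i\<close> compensates the weight in
        \<open>p $ i\<close>.\<close>
      let ?a = "(1 / r $ i) *\<^sub>R (outer (v $ i) (w i) - outer (w i) (v $ i))"
      show "ct ?a = - ?a" by (simp add: algebra_simps)
      have vw: "hdot (v $ i) (w i) = 0" "hdot (w i) (v $ i) = 0" using v hdot_eq_0_sym by auto
      show "?F v $ i = comm ?a (p $ i)"
        using r_pos[of i] vw
        by (simp add: comm_def p_eq mm.scaleR_left mm.scaleR_right mm.diff_left mm.diff_right mult_outer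
            outer_vec mv.scaleR_left mv.diff_left ou.scaleR_left ou.diff_left ou.zero_left)
    qed
  qed
qed

text \<open>Tangent vectors are velocities of curves obtained by conjugating each entry with its own
  unitary curve, hence fixed by \<open>L\<close>. Conversely, values of \<open>retr\<close> satisfy
  \<open>ct A = A\<close> and \<open>A ** A = r $ i *\<^sub>R A\<close>; differentiating both
  equations at \<open>p\<close> forces the form in \<open>tangent_eq\<close>.\<close>

lemma range_derivative_retr:
  assumes L: "(retr has_derivative L) (at p)"
  shows "range L = tangent"
proof
  have lin: "linear L" using L by (rule has_derivative_linear)
  note R = local_retraction_retr[unfolded local_retraction_def]
  have retr_p: "retr p = p" using R p_in p_in_retr_dom by auto
  show "tangent \<subseteq> range L"
  proof
    fix \<xi> assume "\<xi> \<in> tangent"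
    then obtain a where a: "\<And>i. ct (a i) = - a i" "\<And>i. \<xi> $ i = comm (a i) (p $ i)"
      unfolding tangent_def by (simp add: choice_iff) blast
    have "\<exists>c. c 0 = mat 1 \<and> (c has_vector_derivative a i) (at 0) \<and>
        eventually (\<lambda>t::real. unitary (c t)) (nhds 0)" for i
      using unitary_curve[OF a(1)] by metis
    then obtain c where c: "\<And>i. c i 0 = mat 1" "\<And>i. (c i has_vector_derivative a i) (at 0)"
      "\<And>i. eventually (\<lambda>t::real. unitary (c i t)) (nhds 0)" by metis
    let ?\<gamma> = "\<lambda>t. \<chi> i. c i t ** p $ i ** ct (c i t)"
    have "(?\<gamma> has_vector_derivative (\<chi> i. comm (a i) (p $ i))) (at 0)"
    proof -
      have "(?\<gamma> has_derivative (\<lambda>t. \<chi> i. t *\<^sub>R comm (a i) (p $ i))) (at 0)"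
        using conj_curve_derivative[OF c(1,2) a(1)]
        by (intro has_derivative_vec_lambda) (simp add: has_vector_derivative_def)
      moreover have "(\<chi> i. t *\<^sub>R comm (a i) (p $ i)) = t *\<^sub>R (\<chi> i. comm (a i) (p $ i))" for t
        by (rule vec_eq_iff[THEN iffD2]) simp
      ultimately show ?thesis by (simp add: has_vector_derivative_def)
    qed
    then have D: "(?\<gamma> has_vector_derivative \<xi>) (at 0)" using a(2) by (metis (no_types, lifting) vec_lambda_unique)
    have "eventually (\<lambda>t. \<forall>i. unitary (c i t)) (nhds 0)"
      using c(3) by (simp add: eventually_all_finite)
    then have "eventually (\<lambda>t. ?\<gamma> t \<in> projections_product r) (nhds 0)"
      by eventually_elim
        (use p_in in \<open>auto simp: projections_product_def intro!: weighted_projections_conj\<close>)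
    then have "L \<xi> = \<xi>"
      by (intro local_retraction_derivative_tangent[OF local_retraction_retr p_in_retr_dom L _ D])
        (auto simp: c(1) vec_eq_iff)
    then show "\<xi> \<in> range L" by (metis rangeI)
  qed
  show "range L \<subseteq> tangent"
  proof
    fix \<zeta> assume "\<zeta> \<in> range L"
    then obtain h where h: "\<zeta> = L h" by auto
    have "\<exists>v. hdot v (w i) = 0 \<and> \<zeta> $ i = outer v (w i) + outer (w i) v" for i
    proof -
      have "bounded_linear (\<lambda>x::complex^'d^'d^'n. x $ i)" by (rule bounded_linear_vec_nth)
      then have Di: "((\<lambda>x. retr x $ i) has_derivative (\<lambda>h. L h $ i)) (at p)"
        using L by (rule bounded_linear.has_derivative)
      have proj: "ct A = A \<and> A ** A = r $ i *\<^sub>R A" if A: "A \<in> weighted_projections (r $ i)" for A :: "complex^'d^'d"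
      proof -
        obtain v where v: "norm v = 1" "A = r $ i *\<^sub>R outer v v"
          using A unfolding weighted_projections_def rank_one_eq_outer by blast
        have "hdot v v = 1" using v(1) by (simp add: hdot_self)
        then show ?thesis by (simp add: v(2) mm.scaleR_left mm.scaleR_right mult_outer outer_vec mv.scaleR_left ou.scaleR_left)
      qed
      have eqs: "ct (retr x $ i) = retr x $ i" "retr x $ i ** retr x $ i = r $ i *\<^sub>R retr x $ i"
        if "x \<in> retr_dom" for x
        using R that proj[of "retr x $ i"] by (auto simp: projections_product_def)
      note trans = has_derivative_transform_within_open[OF _ conjunct1[OF R] p_in_retr_dom]
      have "((\<lambda>x. ct (retr x $ i)) has_derivative (\<lambda>h. ct (L h $ i))) (at p)"
        using linear_ct Di by (intro bounded_linear.has_derivative[of ct]) (simp_all add: linear_conv_bounded_linear)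
      then have "((\<lambda>x. retr x $ i) has_derivative (\<lambda>h. ct (L h $ i))) (at p)"
        by (rule trans) (use eqs in simp)
      then have 1: "ct (\<zeta> $ i) = \<zeta> $ i"
        using has_derivative_unique[OF Di] unfolding h by metis
      have "((\<lambda>x. retr x $ i ** retr x $ i) has_derivative (\<lambda>h. p $ i ** (L h $ i) + (L h $ i) ** p $ i)) (at p)"
        using mm.FDERIV[OF Di Di] by (simp add: retr_p)
      then have D1: "((\<lambda>x. r $ i *\<^sub>R retr x $ i) has_derivative (\<lambda>h. p $ i ** (L h $ i) + (L h $ i) ** p $ i)) (at p)"
        by (rule trans) (use eqs in simp)
      have D2: "((\<lambda>x. r $ i *\<^sub>R retr x $ i) has_derivative (\<lambda>h. r $ i *\<^sub>R (L h $ i))) (at p)"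
        using Di by (rule has_derivative_scaleR_right)
      have "r $ i *\<^sub>R \<zeta> $ i = p $ i ** (\<zeta> $ i) + (\<zeta> $ i) ** p $ i"
        unfolding h by (rule fun_cong[OF has_derivative_unique[OF D2 D1]])
      also have "\<dots> = r $ i *\<^sub>R (outer (w i) (\<zeta> $ i *v w i) + outer (\<zeta> $ i *v w i) (w i))"
        using 1 by (simp add: p_eq mm.scaleR_left mm.scaleR_right outer_mult mult_outer algebra_simps)
      finally have 2: "\<zeta> $ i = outer (\<zeta> $ i *v w i) (w i) + outer (w i) (\<zeta> $ i *v w i)"
        using r_pos[of i] by (simp add: add.commute)
      have "\<zeta> $ i *v w i = \<zeta> $ i *v w i + hdot (w i) (\<zeta> $ i *v w i) *s w i"
        using arg_cong[OF 2, of "\<lambda>A. A *v w i"] by (simp add: mv.add_left outer_vec)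
      then have "hdot (w i) (\<zeta> $ i *v w i) = 0"
        using w_neq_0[of i] by (simp add: vector_mul_eq_0)
      then show ?thesis using 2 hdot_eq_0_sym by blast
    qed
    then obtain v where v: "\<And>i. hdot (v i) (w i) = 0" "\<And>i. \<zeta> $ i = outer (v i) (w i) + outer (w i) (v i)"
      by metis
    then show "\<zeta> \<in> tangent"
      unfolding tangent_eq by (intro image_eqI[of _ _ "\<chi> i. v i"]) (auto simp: vec_eq_iff)
  qed
qed

text \<open>The parameter space of \<open>tangent_eq\<close> is the orthogonal complement of the
  mutually orthogonal nonzero vectors \<open>w i\<close> and \<open>\<i> *s w i\<close> placed in
  slot \<open>i\<close>, two for each \<open>i\<close>. The result is 2mn.\<close>

lemma dim_tangent: "dim tangent + 2 * CARD('n) = 2 * CARD('d) * CARD('n)"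
proof -
  let ?V = "{v::complex^'d^'n. \<forall>i. hdot (v $ i) (w i) = 0}"
  let ?F = "\<lambda>v::complex^'d^'n. (\<chi> i. outer (v $ i) (w i) + outer (w i) (v $ i)) :: complex^'d^'d^'n"
  let ?e = "\<lambda>(i, b). axis i (if b then \<i> *s w i else w i) :: complex^'d^'n"
  have "linear ?F"
    by (auto intro!: linearI simp: vec_eq_iff ou.add_left ou.add_right ou.scaleR_left ou.scaleR_right algebra_simps)
  moreover have "inj_on ?F ?V"
  proof (rule inj_onI)
    fix v v' assume v: "v \<in> ?V" "v' \<in> ?V" "?F v = ?F v'"
    have "v $ i = v' $ i" for i
    proof -
      have "outer (v $ i) (w i) + outer (w i) (v $ i) = outer (v' $ i) (w i) + outer (w i) (v' $ i)"
        using v(3) by (simp add: vec_eq_iff[where 'b='n])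
      from arg_cong[OF this, of "\<lambda>A. A *v w i"] show ?thesis
        using hdot_eq_0_sym[of "v $ i" "w i"] hdot_eq_0_sym[of "v' $ i" "w i"] v(1,2)
        by (simp add: mv.add_left outer_vec)
    qed
    then show "v = v'" by (simp add: vec_eq_iff)
  qed
  moreover have V: "?V = {y \<in> UNIV. \<forall>x\<in>span (range ?e). orthogonal x y}" (is "_ = ?W")
  proof -
    have *: "hdot (v $ i) (w i) = 0 \<longleftrightarrow> orthogonal (?e (i, False)) v \<and> orthogonal (?e (i, True)) v" for v :: "complex^'d^'n" and i
      by (simp add: hdot_eq_0_iff orthogonal_def inner_axis inner_commute[of _ v])
    have "v \<in> ?V \<longleftrightarrow> (\<forall>x\<in>range ?e. orthogonal x v)" for v
      using * by (auto split: if_splits)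
    then show ?thesis unfolding orthogonal_span_iff by auto
  qed
  moreover have "subspace ?V" by (auto simp: subspace_def hdot_linear)
  ultimately have "dim tangent = dim ?V"
    unfolding tangent_eq by (intro dim_image_eq) (auto simp: span_eq_iff[THEN iffD2])
  also have "dim ?V + dim (span (range ?e)) = DIM(complex^'d^'n)"
    unfolding V using dim_subspace_orthogonal_to_vectors[OF subspace_span subspace_UNIV, of "range ?e"] by simp
  moreover have "dim (span (range ?e)) = 2 * CARD('n)"
  proof -
    have ww: "w i \<bullet> (\<i> *s w i) = 0" for i
      using Re_hdot[of "w i" "\<i> *s w i"] by (simp add: hdot_linear)
    have iw: "\<i> *s w i \<noteq> 0" for i using w_neq_0 by (simp add: vector_mul_eq_0)
    have ne: "?e x \<noteq> 0" for x using w_neq_0 iw by (auto simp: axis_eq_0_iff split: prod.splits)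
    have ort: "orthogonal (?e x) (?e y)" if "x \<noteq> y" for x y
      using that ww by (auto simp: orthogonal_def inner_axis_axis inner_commute split: prod.splits)
    have inj: "inj ?e"
    proof (rule injI, rule ccontr)
      fix x y assume "?e x = ?e y" "x \<noteq> y"
      with ort[OF this(2)] have "orthogonal (?e x) (?e x)" by simp
      then show False unfolding orthogonal_self using ne[of x] by simp
    qed
    have "pairwise orthogonal (range ?e)"
      unfolding pairwise_def
    proof (intro ballI impI)
      fix x y assume xy: "x \<in> range ?e" "y \<in> range ?e" "x \<noteq> y"
      obtain a b where ab: "x = ?e a" "y = ?e b" using xy(1,2) by (elim rangeE)
      have "a \<noteq> b" using ab xy(3) by (metis (no_types))
      then show "orthogonal x y" unfolding ab by (rule ort)
    qed
    moreover have "0 \<notin> range ?e" using ne by (metis (no_types) rangeE)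
    ultimately have "independent (range ?e)" by (rule pairwise_orthogonal_independent)
    then have "dim (range ?e) = card (range ?e)" by (rule dim_eq_card_independent)
    then show ?thesis using card_image[OF inj] by (simp add: card_cartesian_product[of UNIV UNIV, simplified])
  qed
  ultimately show ?thesis by simp
qed

end

section \<open>Tuples off the walls\<close>

locale moduli_point = projection_tuple r p w
  for r :: "real^'n" and p :: "complex^'d^'d^'n" and w +
  assumes sum_p: "(\<Sum>i\<in>UNIV. p $ i) = ((\<Sum>i\<in>UNIV. r $ i) / real CARD('d)) *\<^sub>R mat 1"
    and off_wall: "\<not> on_wall TYPE('d) r"
begin

definition \<Lambda> :: real where "\<Lambda> = (\<Sum>i\<in>UNIV. r $ i) / real CARD('d)"

lemma sum_p': "(\<Sum>i\<in>UNIV. p $ i) = \<Lambda> *\<^sub>R mat 1"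
  by (simp add: \<Lambda>_def sum_p)

lemma \<Lambda>_pos: "\<Lambda> > 0"
  unfolding \<Lambda>_def using r_pos by (intro divide_pos_pos sum_pos) auto

lemma p_Mtilde: "p \<in> Mtilde r"
  using p_in sum_p by (simp add: Mtilde_def)

lemma trace_p: "trace (p $ i) = of_real (r $ i)"
  by (simp add: p_eq linear_scale[OF linear_trace] trace_outer scaleR_conv_of_real[where 'a=complex])

text \<open>An orthogonal partition of the lines would make \<open>\<Lambda>\<^sup>-\<^sup>1 (\<Sum>i\<in>I. p\<^sub>i)\<close> a projection; its
  trace is an integer, which puts \<open>r\<close> on a wall.\<close>

lemma no_orthogonal_partition:
  assumes IJ: "I \<union> J = UNIV" "I \<inter> J = {}" "I \<noteq> {}" "J \<noteq> {}"
    and ort: "\<And>i j. i \<in> I \<Longrightarrow> j \<in> J \<Longrightarrow> hdot (w i) (w j) = 0"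
  shows False
proof -
  let ?P = "(1 / \<Lambda>) *\<^sub>R (\<Sum>i\<in>I. p $ i)" and ?R = "(1 / \<Lambda>) *\<^sub>R (\<Sum>j\<in>J. p $ j)"
  have split: "sum f I + sum f J = sum f UNIV" for f :: "'n \<Rightarrow> 'z::comm_monoid_add"
    using sum.union_disjoint[of I J f] IJ by simp
  have "?P + ?R = (1 / \<Lambda>) *\<^sub>R (\<Sum>i\<in>UNIV. p $ i)"
    by (simp add: split[symmetric] scaleR_add_right)
  then have PR: "?P + ?R = mat 1" using \<Lambda>_pos by (simp add: sum_p')
  have pp: "p $ i ** p $ j = 0" if "i \<in> I" "j \<in> J" for i j
    using hdot_eq_0_sym[OF ort[OF that]]
    by (simp add: p_eq mm.scaleR_left mm.scaleR_right mult_outer outer_vec ou.zero_left mv.scaleR_left)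
  \<comment> \<open>Two matrices with sum \<open>mat 1\<close> and product \<open>0\<close>: the
    first is idempotent.\<close>
  have "?P ** ?R = 0"
    by (simp add: mm.scaleR_left mm.scaleR_right mm.sum_left mm.sum_right pp)
  then have "?P ** ?P = ?P ** (?P + ?R)" by (simp add: mm.add_right)
  also have "\<dots> = ?P" unfolding PR by simp
  finally have "?P ** ?P = ?P" .
  moreover have "ct ?P = ?P" by simp
  ultimately obtain k :: nat where k: "trace ?P = of_nat k" using trace_projection_nat by metis
  have "trace ?P = of_real ((\<Sum>i\<in>I. r $ i) / \<Lambda>)"
    by (simp add: linear_scale[OF linear_trace] linear_sum[OF linear_trace] trace_p scaleR_conv_of_real[where 'a=complex])
  with k have "(\<Sum>i\<in>I. r $ i) / \<Lambda> = real k" by (metis of_real_eq_iff of_real_of_nat_eq)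
  then have I: "(\<Sum>i\<in>I. r $ i) = real k * \<Lambda>" using \<Lambda>_pos by (simp add: field_simps)
  have "(\<Sum>i\<in>UNIV. r $ i) = real CARD('d) * \<Lambda>" by (simp add: \<Lambda>_def)
  then have J: "(\<Sum>j\<in>J. r $ j) = (real CARD('d) - real k) * \<Lambda>"
    using split[of "\<lambda>i. r $ i"] I by (simp add: algebra_simps)
  have "(\<Sum>i\<in>I. r $ i) > 0" "(\<Sum>j\<in>J. r $ j) > 0" using IJ r_pos by (auto intro!: sum_pos)
  then have "k > 0" "real k < real CARD('d)"
    unfolding I J using \<Lambda>_pos by (auto simp: zero_less_mult_iff)
  moreover have "r \<in> polygon_cone TYPE('d)"
    using r_pos p_Mtilde by (auto simp: polygon_cone_def moduli_space_def)
  moreover have "real k * (\<Sum>j\<in>J. r $ j) = (real CARD('d) - real k) * (\<Sum>i\<in>I. r $ i)"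
    unfolding I J by simp
  \<comment> \<open>Since \<open>k\<close> is the trace belonging to \<open>I\<close>, the block
    sums are k\<Lambda> and (d-k)\<Lambda>; the wall equation multiplies crosswise, so the blocks
    appear in swapped order.\<close>
  ultimately have "r \<in> wall TYPE('d) J I k \<and> 1 \<le> k \<and> k < CARD('d)" by (auto simp: wall_def)
  then show False
    using off_wall IJ unfolding on_wall_def by (metis Int_commute Un_commute)
qed

text \<open>If \<open>w i\<close> lies in \<open>V\<close>, then \<open>p $ j *v w i\<close> is a
  multiple of \<open>w j\<close>, so either \<open>w j\<close> lies in \<open>V\<close> or it is
  orthogonal to \<open>w i\<close>. Off the walls the second case never separates the indices, so
  all \<open>w j\<close> lie in \<open>V\<close>; as the \<open>p $ j\<close> sum to a nonzero
  scalar, \<open>V\<close> is everything.\<close>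

lemma irreducible:
  assumes V_add: "\<And>x y. x \<in> V \<Longrightarrow> y \<in> V \<Longrightarrow> x + y \<in> V" and V_scale: "\<And>c x. x \<in> V \<Longrightarrow> c *s x \<in> V"
    and inv: "\<And>i x. x \<in> V \<Longrightarrow> p $ i *v x \<in> V" and i0: "w i0 \<in> V"
  shows "x \<in> V"
proof -
  let ?I = "{i. w i \<in> V}"
  have "hdot (w i) (w j) = 0" if "i \<in> ?I" "j \<in> - ?I" for i j
  proof (rule ccontr)
    assume h: "hdot (w i) (w j) \<noteq> 0"
    let ?c = "of_real (r $ j) * hdot (w i) (w j)"
    have "?c *s w j \<in> V" using inv[of "w i" j] that by (simp add: p_vec)
    then have "(1 / ?c) *s (?c *s w j) \<in> V" by (rule V_scale)
    then show False using h r_pos[of j] that by (simp add: vector_smult_assoc)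
  qed
  then have "- ?I = {}" using no_orthogonal_partition[of ?I "- ?I"] i0 by auto
  then have wV: "w i \<in> V" for i by auto
  have 0: "0 \<in> V" using V_scale[OF i0, of 0] by simp
  have pV: "p $ i *v x \<in> V" for i
    unfolding p_vec by (rule V_scale[OF wV])
  have "(\<Sum>i\<in>A. p $ i *v x) \<in> V" for A
    by (induction A rule: infinite_finite_induct) (simp_all add: 0 pV V_add)
  then have "(\<Sum>i\<in>UNIV. p $ i) *v x \<in> V" by (simp add: mv.sum_left)
  then have "of_real \<Lambda> *s x \<in> V"
    by (simp add: sum_p' scaleR_mat mat_mult_vec)
  then have "of_real (1 / \<Lambda>) *s (of_real \<Lambda> *s x) \<in> V" by (rule V_scale)
  then show ?thesis using \<Lambda>_pos by (simp add: vector_smult_assoc)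
qed

text \<open>Schur's argument: \<open>a\<close> preserves the image of \<open>p $ i0\<close>, so
  \<open>w i0\<close> is an eigenvector, and its eigenspace is invariant under all
  \<open>p $ i\<close>. Skewness makes the eigenvalue imaginary.\<close>

lemma skew_commutant:
  assumes a: "ct a = - a" and c: "\<And>i. comm a (p $ i) = 0"
  obtains s :: real where "a = mat (\<i> * of_real s)"
proof -
  obtain i0 :: 'n where True by simp
  have ap: "a ** p $ i = p $ i ** a" for i using c[of i] by (simp add: comm_def)
  define l where "l = hdot (a *v w i0) (w i0)"
  have "r $ i0 *\<^sub>R (a *v w i0) = (a ** p $ i0) *v w i0"
    by (simp add: p_eq mm.scaleR_right mv.scaleR_left mult_outer outer_vec)
  also have "\<dots> = r $ i0 *\<^sub>R (l *s w i0)"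
    unfolding ap by (simp add: matrix_vector_mul_assoc[symmetric] p_eq mv.scaleR_left outer_vec l_def)
  finally have "a *v w i0 = l *s w i0" using r_pos[of i0] by simp
  then have "w i0 \<in> {v. a *v v = l *s v}" by simp
  have "x \<in> {v. a *v v = l *s v}" for x
  proof (rule irreducible[where ?i0.0 = i0])
    show "p $ i *v x \<in> {v. a *v v = l *s v}" if "x \<in> {v. a *v v = l *s v}" for i x
    proof -
      have "a *v (p $ i *v x) = p $ i *v (a *v x)" by (simp add: matrix_vector_mul_assoc ap)
      then show ?thesis using that by (simp add: vector_scalar_commute)
    qed
  next
    show "c *s x \<in> {v. a *v v = l *s v}" if "x \<in> {v. a *v v = l *s v}" for c x
      using that by (simp add: vector_scalar_commute vector_smult_assoc mult.commute)
  qed (use \<open>w i0 \<in> _\<close> in \<open>auto simp: mv.add_right vector_add_ldistrib\<close>)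
  then have am: "a = mat l" by (intro matrix_eqI) (simp add: mat_mult_vec)
  have "mat (cnj l) = (mat (- l) :: complex^'d^'d)" using a am by (metis ct_mat mat_uminus)
  then have "trace (mat (cnj l) :: complex^'d^'d) = trace (mat (- l) :: complex^'d^'d)" by simp
  then have "cnj l = - l" unfolding trace_mat by (subst (asm) mult_left_cancel) auto
  then have "l = \<i> * of_real (Im l)" by (simp add: complex_eq_iff)
  then show ?thesis using am that by metis
qed

lemma subspace_tangent: "subspace tangent"
  unfolding tangent_eq
  by (intro linear_subspace_image)
    (auto intro!: linearI simp: subspace_def hdot_linear vec_eq_iff ou.add_left ou.add_right
      ou.scaleR_left ou.scaleR_right algebra_simps)

lemma linear_\<mu>: "linear (\<lambda>\<xi>::complex^'d^'d^'n. \<Sum>i\<in>UNIV. \<xi> $ i)"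
  by (auto intro!: linearI simp: sum.distrib scaleR_sum_right)

text \<open>Suppose a traceless Hermitian \<open>b\<close> is orthogonal to the image. Testing it
  against the tangent vector that is \<open>comm a (p $ i)\<close> in slot \<open>i\<close> and zero
  elsewhere, with \<open>a = comm (p $ i) b\<close>, gives \<open>a \<bullet> a = 0\<close>. So
  \<open>b\<close> commutes with every \<open>p $ i\<close>, is scalar, and vanishes by its
  trace.\<close>

lemma \<mu>_tangent: "(\<lambda>\<xi>. \<Sum>i\<in>UNIV. \<xi> $ i) ` tangent = traceless_hermitians" (is "?\<mu> ` _ = _")
proof -
  have sub: "?\<mu> ` tangent \<subseteq> traceless_hermitians"
  proof clarify
    fix \<xi> assume "\<xi> \<in> tangent"
    then have "\<xi> $ i \<in> traceless_hermitians" for i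
    proof -
      obtain a where a: "ct a = - a" "\<xi> $ i = comm a (p $ i)"
        using \<open>\<xi> \<in> tangent\<close> by (auto simp: tangent_def)
      have "trace (comm a (p $ i)) = 0" by (simp add: comm_def trace_sub trace_mul_sym[of a])
      moreover have "ct (comm a (p $ i)) = comm a (p $ i)" by (simp add: comm_def a(1) mm.minus_left mm.minus_right)
      ultimately show ?thesis unfolding a(2) by (simp add: traceless_hermitians_def hermitians_def)
    qed
    then show "?\<mu> \<xi> \<in> traceless_hermitians"
      by (intro subspace_sum[OF subspace_traceless_hermitians])
  qed
  show ?thesis
  proof (rule ccontr)
    assume "?\<mu> ` tangent \<noteq> traceless_hermitians"
    then have "span (?\<mu> ` tangent) \<subset> span (traceless_hermitians :: (complex^'d^'d) set)"
      using sub linear_subspace_image[OF linear_\<mu> subspace_tangent] subspace_traceless_hermitians[where 'a='d]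
      by (simp add: span_eq_iff[THEN iffD2] psubset_eq)
    then obtain b :: "complex^'d^'d" where b: "b \<noteq> 0" "b \<in> span traceless_hermitians"
      "\<And>y. y \<in> span (?\<mu> ` tangent) \<Longrightarrow> orthogonal b y"
      using orthogonal_to_subspace_exists_gen by metis
    then have b': "ct b = b" "trace b = 0"
      using subspace_traceless_hermitians[where 'a='d]
      by (simp_all add: span_eq_iff[THEN iffD2] traceless_hermitians_def hermitians_def)
    have "comm b (p $ i) = 0" for i
    proof -
      let ?a = "comm (p $ i) b"
      have skew: "ct ?a = - ?a" by (simp add: comm_def b'(1))
      have "?\<mu> (axis i (comm ?a (p $ i))) = comm ?a (p $ i)" by (simp add: axis_def)
      moreover have "axis i (comm ?a (p $ i)) \<in> tangent"
        unfolding tangent_def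
      proof (intro CollectI allI)
        fix j
        show "\<exists>a. ct a = - a \<and> axis i (comm ?a (p $ i)) $ j = comm a (p $ j)"
          using skew by (intro exI[of _ "if j = i then ?a else 0"]) (simp add: axis_def bilinear_comm)
      qed
      ultimately have "comm ?a (p $ i) \<in> ?\<mu> ` tangent" by (rule image_eqI[OF sym])
      then have "orthogonal b (comm ?a (p $ i))" by (intro b(3) span_base)
      then have "comm ?a (p $ i) \<bullet> b = 0" by (simp only: orthogonal_def inner_commute)
      then have "Re (trace (comm ?a (p $ i) ** b)) = 0" by (simp add: inner_matrix b'(1))
      moreover have "trace (comm ?a (p $ i) ** b) = trace (?a ** ?a)"
      proof -
        have "trace (comm ?a (p $ i) ** b) = trace (?a ** p $ i ** b) - trace (p $ i ** ?a ** b)"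
          by (simp add: comm_def[of ?a] mm.diff_left trace_sub)
        also have "trace (p $ i ** ?a ** b) = trace (?a ** b ** p $ i)"
          using trace_mul_sym[of "p $ i" "?a ** b"] by (simp add: matrix_mul_assoc)
        finally show ?thesis
          by (simp add: comm_def[of "p $ i"] mm.diff_right trace_sub matrix_mul_assoc)
      qed
      ultimately have "?a \<bullet> ?a = 0" by (simp add: inner_matrix skew mm.minus_right linear_neg[OF linear_trace])
      then show ?thesis by (simp add: comm_def)
    qed
    \<comment> \<open>The factor \<open>\<i>\<close> turns the Hermitian \<open>b\<close> into a
      skew-Hermitian matrix, as \<open>skew_commutant\<close> expects.\<close>
    moreover have "comm (mat \<i> ** b) (p $ i) = mat \<i> ** comm b (p $ i)" for i
      by (simp add: comm_def mm.diff_right matrix_mul_assoc mat_commute[of \<i> "p $ i"])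
    ultimately have "comm (mat \<i> ** b) (p $ i) = 0" for i by (simp add: mm.zero_right)
    moreover have "ct (mat \<i> ** b) = - (mat \<i> ** b)"
      using mat_i_skew(1)[of b] b'(1) by (simp add: hermitians_def skew_hermitians_def)
    ultimately obtain s :: real where "mat \<i> ** b = mat (\<i> * of_real s)" using skew_commutant by metis
    then have "mat (-\<i>) ** (mat \<i> ** b) = mat (-\<i>) ** (mat (\<i> * of_real s) :: complex^'d^'d)" by simp
    then have bs: "b = mat (of_real s)" by (simp add: matrix_mul_assoc mat_mult_mat)
    then have "s = 0" using b'(2) by (simp add: trace_mat)
    then show False using b(1) bs by simp
  qed
qed

section \<open>Tangent spaces of the level set and of the orbit\<close>

definition level_tangent where "level_tangent = {\<xi> \<in> tangent. (\<Sum>i\<in>UNIV. \<xi> $ i) = 0}"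
text \<open>In contrast to \<open>tangent\<close>, a single \<open>a\<close> serves all
  indices.\<close>

definition orbit_tangent where "orbit_tangent = {\<chi> i. comm a (p $ i) | a. ct a = - a}"

lemma subspace_level_tangent: "subspace level_tangent"
  unfolding level_tangent_def using subspace_tangent linear_\<mu>
  by (auto simp: subspace_def linear_add linear_scale[OF linear_\<mu>] sum.distrib scaleR_sum_right[symmetric])

text \<open>Rank-nullity for the sum map on \<open>tangent\<close>: 2mn - ((m+1)^2 - 1), stated
  additively because subtraction of naturals truncates.\<close>

lemma dim_level_tangent:
  "dim level_tangent + CARD('d) * CARD('d) + 2 * CARD('n) = 2 * CARD('d) * CARD('n) + 1"
  using dim_image_kernel[OF linear_\<mu> subspace_tangent] dim_tangent dim_traceless_hermitians[where 'd='d]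
  unfolding \<mu>_tangent level_tangent_def by linarith

lemma orbit_tangent_level: "orbit_tangent \<subseteq> level_tangent"
proof -
  have "(\<Sum>i\<in>UNIV. comm a (p $ i)) = 0" for a
    by (simp add: comm_def sum_subtractf mm.sum_right[symmetric] mm.sum_left[symmetric] sum_p'
        mm.scaleR_left mm.scaleR_right)
  then show ?thesis by (auto simp: orbit_tangent_def level_tangent_def tangent_def)
qed

text \<open>By \<open>skew_commutant\<close> the map from \<open>a\<close> to its tuple of
  commutators kills exactly the real multiples of \<open>mat \<i>\<close>; it is injective on their
  orthogonal complement among the skew-Hermitian matrices.\<close>

lemma dim_orbit_tangent: "dim orbit_tangent + 1 = CARD('d) * CARD('d)"
proof -
  let ?A = "\<lambda>a. (\<chi> i. comm a (p $ i)) :: complex^'d^'d^'n"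
  let ?i = "mat \<i> :: complex^'d^'d"
  have lin: "linear ?A" by (auto intro!: linearI simp: bilinear_comm vec_eq_iff)
  have i: "?i \<in> skew_hermitians" by (simp add: skew_hermitians_def mat_uminus)
  have i0: "?i \<noteq> 0" by (metis mat_1_neq_0 mat_mult_mat mm.zero_right i_squared mat_uminus minus_equation_iff neg_0_equal_iff_equal)
  have Ai: "?A ?i = 0" by (simp add: comm_def mat_commute vec_eq_iff)
  let ?S = "{a \<in> skew_hermitians. ?i \<bullet> a = 0}"
  have S: "subspace ?S"
    using subspace_skew_hermitians[where 'd='d] by (auto simp: subspace_def inner_right_distrib)
  have img: "orbit_tangent = ?A ` ?S"
  proof
    show "?A ` ?S \<subseteq> orbit_tangent" by (auto simp: orbit_tangent_def skew_hermitians_def)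
    show "orbit_tangent \<subseteq> ?A ` ?S"
    proof
      fix \<xi> assume "\<xi> \<in> orbit_tangent"
      then obtain a where a: "a \<in> skew_hermitians" "\<xi> = ?A a" by (auto simp: orbit_tangent_def skew_hermitians_def)
      let ?b = "a - ((?i \<bullet> a) / (?i \<bullet> ?i)) *\<^sub>R ?i"
      have b: "?b \<in> ?S" using a(1) i i0 subspace_skew_hermitians[where 'd='d]
        by (auto intro: subspace_diff subspace_scale simp: inner_diff_right)
      have "?A ?b = \<xi>" using Ai a(2) by (simp only: linear_diff[OF lin] linear_scale[OF lin]) simp
      then show "\<xi> \<in> ?A ` ?S" by (rule image_eqI[OF sym b])
    qed
  qed
  have "inj_on ?A ?S"
  proof (subst linear_inj_on_iff_eq_0[OF lin S], intro ballI impI)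
    fix a assume a: "a \<in> ?S" "?A a = 0"
    then obtain s :: real where s: "a = mat (\<i> * of_real s)"
      using skew_commutant[of a] by (auto simp: skew_hermitians_def vec_eq_iff[where 'b='n])
    then have "a = s *\<^sub>R ?i" by (simp add: scaleR_mat mult.commute)
    then show "a = 0" using a(1) i0 by simp
  qed
  then have "dim orbit_tangent = dim ?S"
    unfolding img using S by (intro dim_image_eq[OF lin]) (simp add: span_eq_iff[THEN iffD2])
  then show ?thesis
    using dim_orthogonal_vector[OF subspace_skew_hermitians i i0] dim_hermitians(2)[where 'd='d] by simp
qed

end

section \<open>An explicit slice\<close>

text \<open>Constants are scalar matrices, which unitary conjugation fixes; this makes the
  evaluation equivariant.\<close>

inductive ncpoly :: "(complex^'d^'d^'n \<Rightarrow> complex^'d^'d) \<Rightarrow> bool" where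
  coord: "ncpoly (\<lambda>x. x $ i)"
| const: "ncpoly (\<lambda>x. mat c)"
| plus: "ncpoly f \<Longrightarrow> ncpoly g \<Longrightarrow> ncpoly (\<lambda>x. f x + g x)"
| times: "ncpoly f \<Longrightarrow> ncpoly g \<Longrightarrow> ncpoly (\<lambda>x. f x ** g x)"

lemma ncpoly_smooth: "ncpoly f \<Longrightarrow> C_on k f UNIV"
proof (induction rule: ncpoly.induct)
  case (coord i)
  show ?case by (intro C_on_nth C_on_id open_UNIV)
qed (intro C_on_const C_on_add C_on_mm open_UNIV; assumption)+

lemma unitary_conj_mult:
  assumes "unitary u"
  shows "(u ** a ** ct u) ** (u ** b ** ct u) = u ** (a ** b) ** ct u"
proof -
  have "(u ** a ** ct u) ** (u ** b ** ct u) = u ** a ** (ct u ** u) ** b ** ct u"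
    by (simp only: matrix_mul_assoc)
  moreover have "ct u ** u = mat 1" using assms by (simp add: unitary_def)
  ultimately show ?thesis by (simp only: matrix_mul_rid) (simp only: matrix_mul_assoc)
qed

lemma unitary_conj_mat: "unitary u \<Longrightarrow> u ** mat c ** ct u = mat c"
  by (simp add: mat_commute[of c u, symmetric] matrix_mul_assoc[symmetric] unitary_def)

lemma trace_unitary_conj: "unitary u \<Longrightarrow> trace (u ** a ** ct u) = trace a"
  using trace_mul_sym[of "u ** a" "ct u"] by (simp add: matrix_mul_assoc unitary_def)

lemma ncpoly_conj_tuple:
  assumes "ncpoly f" "unitary u"
  shows "f (conj_tuple u x) = u ** f x ** ct u"
  using assms(1)
proof (induction rule: ncpoly.induct)
  case (coord i)
  then show ?case by (simp add: conj_tuple_def)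
next
  case (const c)
  then show ?case using unitary_conj_mat[OF assms(2)] by simp
next
  case (plus f g)
  then show ?case by (simp add: mm.add_left mm.add_right)
next
  case (times f g)
  then show ?case using unitary_conj_mult[OF assms(2)] by simp
qed

text \<open>The vectors \<open>f p *v w i0\<close> form an invariant complex subspace that contains
  \<open>w i0\<close>, so \<open>irreducible\<close> applies. The frame polynomials are the ones
  that produce the standard basis at \<open>p\<close>.\<close>

lemma (in moduli_point) ncpoly_cyclic:
  "\<exists>f. ncpoly f \<and> f p *v w i0 = x"
proof -
  have "x \<in> {f p *v w i0 | f. ncpoly f}"
  proof (rule irreducible[where ?i0.0 = i0])
    fix x y assume "x \<in> {f p *v w i0 | f. ncpoly f}" "y \<in> {f p *v w i0 | f. ncpoly f}"
    then obtain f g where "ncpoly f" "ncpoly g" "x = f p *v w i0" "y = g p *v w i0" by blast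
    then show "x + y \<in> {f p *v w i0 | f. ncpoly f}"
      by (intro CollectI exI[of _ "\<lambda>x. f x + g x"]) (simp add: ncpoly.plus mv.add_left)
  next
    fix c x assume "x \<in> {f p *v w i0 | f. ncpoly f}"
    then obtain f where "ncpoly f" "x = f p *v w i0" by blast
    then show "c *s x \<in> {f p *v w i0 | f. ncpoly f}"
      by (intro CollectI exI[of _ "\<lambda>x. mat c ** f x"])
        (simp add: ncpoly.times ncpoly.const matrix_vector_mul_assoc[symmetric] mat_mult_vec)
  next
    fix i x assume "x \<in> {f p *v w i0 | f. ncpoly f}"
    then obtain f where "ncpoly f" "x = f p *v w i0" by blast
    then show "p $ i *v x \<in> {f p *v w i0 | f. ncpoly f}"
      by (intro CollectI exI[of _ "\<lambda>x. x $ i ** f x"])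
        (simp add: ncpoly.times ncpoly.coord matrix_vector_mul_assoc[symmetric])
  next
    show "w i0 \<in> {f p *v w i0 | f. ncpoly f}"
      by (intro CollectI exI[of _ "\<lambda>x. mat 1"]) (simp add: ncpoly.const)
  qed
  then show ?thesis by auto
qed

text \<open>The vectors \<open>f\<^sub>j(x) v\<close>, where \<open>v\<close> spans the image of \<open>x\<^sub>i\<^sub>0\<close>, form a frame that depends
  equivariantly on \<open>x\<close>, up to the phase of \<open>v\<close>. The matrix of \<open>x\<^sub>i\<close> in the orthonormalised
  frame is an invariant \<open>\<sigma>(x)\<^sub>i\<close>; its entries \<open>G\<close> before orthonormalisation are traces, so that no
  phase has to be chosen.\<close>

locale gauge = moduli_point r p w
  for r :: "real^'n" and p :: "complex^'d^'d^'n" and w +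
  fixes i0 :: 'n and f :: "'d \<Rightarrow> complex^'d^'d^'n \<Rightarrow> complex^'d^'d"
    and B :: "(complex^'d^'d) set" and q :: "complex^'d^'d \<Rightarrow> complex^'d^'d"
  assumes f: "\<And>j. ncpoly (f j)" and f_p: "\<And>j. f j p *v w i0 = axis j 1"
    and B: "open B" "mat 1 \<in> B" and smooth_q: "\<And>k. C_on k q B" and q_1: "q (mat 1) = mat 1"
    and q_mult: "\<And>K. K \<in> B \<Longrightarrow> q K ** K ** q K = mat 1"
    and ct_q: "\<And>K. K \<in> B \<Longrightarrow> ct K = K \<Longrightarrow> ct (q K) = q K"
begin

definition "G A x = (\<chi> j k. (1 / r $ i0) *\<^sub>R trace (ct (f j x) ** A ** f k x ** x $ i0))"
text \<open>The Gram matrix of the frame up to index order; \<open>q (K x)\<close> is the symmetric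
  orthonormalisation, and \<open>B\<close> keeps the frame near an orthonormal one.\<close>

definition "K x = G (mat 1) x"
definition "gdom = {x. K x \<in> B}"
definition \<sigma> :: "complex^'d^'d^'n \<Rightarrow> complex^'d^'d^'n" where
  "\<sigma> x = (\<chi> i. q (K x) ** G (x $ i) x ** q (K x))"

lemma C_on_G:
  assumes "\<And>k. C_on k g UNIV"
  shows "C_on k (\<lambda>x. G (g x) x) UNIV"
  unfolding G_def
  by (intro C_on_vec C_on_scaleR C_on_const C_on_linear_compose[OF _ linear_trace]
      C_on_mm C_on_linear_compose[OF _ linear_ct] ncpoly_smooth[OF f] assms C_on_nth C_on_id open_UNIV)

lemma C_on_K: "C_on k K UNIV"
  unfolding K_def[abs_def] by (intro C_on_G C_on_const open_UNIV)

lemma open_gdom: "open gdom"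
  using C_on_continuous[OF C_on_K[of 0]] B(1) continuous_on_open_vimage[OF open_UNIV, of K]
  by (auto simp: gdom_def vimage_def)

lemma C_on_qK: "C_on k (\<lambda>x. q (K x)) gdom"
  by (rule C_on_compose[OF open_gdom C_on_subset[OF C_on_K] smooth_q]) (auto simp: gdom_def)

lemma C_on_\<sigma>: "C_on k \<sigma> gdom"
proof -
  have "C_on k (\<lambda>x. G (x $ i) x) gdom" for i
    by (rule C_on_subset[OF C_on_G[OF C_on_nth[OF open_UNIV C_on_id[OF open_UNIV]]]]) auto
  then show ?thesis
    unfolding \<sigma>_def[abs_def] by (intro C_on_vec C_on_mm C_on_qK open_gdom)
qed

lemma G_conj: "unitary u \<Longrightarrow> G (u ** A ** ct u) (conj_tuple u x) = G A x"
proof -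
  assume u: "unitary u"
  have "trace (ct (f j (conj_tuple u x)) ** (u ** A ** ct u) ** f k (conj_tuple u x) ** conj_tuple u x $ i0)
      = trace (ct (f j x) ** A ** f k x ** x $ i0)" for j k
  proof -
    have "ct (f j (conj_tuple u x)) = u ** ct (f j x) ** ct u"
      by (simp add: ncpoly_conj_tuple[OF f u] matrix_mul_assoc)
    moreover have "conj_tuple u x $ i0 = u ** x $ i0 ** ct u" by (simp add: conj_tuple_def)
    ultimately show ?thesis
      by (simp only: ncpoly_conj_tuple[OF f u] unitary_conj_mult[OF u] trace_unitary_conj[OF u])
  qed
  then show ?thesis by (simp add: G_def)
qed

lemma K_conj: "unitary u \<Longrightarrow> K (conj_tuple u x) = K x"
  unfolding K_def using G_conj[of u "mat 1" x] unitary_conj_mat[of u 1] by simp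

lemma gdom_conj: "unitary u \<Longrightarrow> conj_tuple u x \<in> gdom \<longleftrightarrow> x \<in> gdom"
  by (simp add: gdom_def K_conj)

lemma \<sigma>_conj: "unitary u \<Longrightarrow> \<sigma> (conj_tuple u x) = \<sigma> x"
  using G_conj[of u _ x] by (simp add: \<sigma>_def K_conj) (simp add: conj_tuple_def)

definition "H x v = (\<chi> a j. (f j x *v v) $ a)"

lemma H_entry: "(ct (H x v) ** A ** H x v) $ j $ k = hdot (A *v (f k x *v v)) (f j x *v v)"
proof -
  have AH: "(A ** H x v) $ a $ k = (A *v (f k x *v v)) $ a" for a
    by (simp add: matrix_matrix_mult_def matrix_vector_mult_def H_def)
  have "(ct (H x v) ** (A ** H x v)) $ j $ k = (\<Sum>a\<in>UNIV. cnj ((f j x *v v) $ a) * (A ** H x v) $ a $ k)"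
    unfolding matrix_matrix_mult_def[of "ct (H x v)"] by (simp add: conj_transpose_def H_def)
  then show ?thesis
    unfolding AH by (simp add: hdot_def matrix_mul_assoc mult.commute)
qed

lemma G_eq:
  assumes "x $ i0 = r $ i0 *\<^sub>R outer v v"
  shows "G A x = ct (H x v) ** A ** H x v"
proof -
  have "(1 / r $ i0) *\<^sub>R trace (ct (f j x) ** A ** f k x ** x $ i0) = hdot (A *v (f k x *v v)) (f j x *v v)" for j k
    using r_pos[of i0]
    by (simp add: assms mm.scaleR_right linear_scale[OF linear_trace] mult_outer trace_outer
        matrix_vector_mul_assoc[symmetric])
      (simp add: hdot_ct)
  then show ?thesis by (simp add: G_def vec_eq_iff H_entry)
qed

lemma H_p: "H p (w i0) = mat 1"
  by (simp add: H_def f_p vec_eq_iff axis_def mat_def)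

lemma K_p: "K p = mat 1"
  unfolding K_def using G_eq[OF p_eq[of i0]] by (simp add: H_p)

lemma p_in_gdom: "p \<in> gdom"
  by (simp add: gdom_def K_p B)

lemma \<sigma>_p: "\<sigma> p = p"
  using G_eq[OF p_eq[of i0]] by (simp add: \<sigma>_def K_p q_1 H_p vec_eq_iff[where 'b='n])

text \<open>With \<open>H\<close> the frame matrix, \<open>K = H* H\<close>, so
  \<open>H q(K)\<close> is unitary by \<open>q_mult\<close>. The vector \<open>v\<close> enters the
  conjugating unitary but not \<open>\<sigma>\<close>.\<close>

lemma \<sigma>_eq_conj:
  assumes x: "x \<in> gdom" "x $ i0 = r $ i0 *\<^sub>R outer v v"
  shows "unitary (H x v ** q (K x))" "\<sigma> x = conj_tuple (ct (H x v ** q (K x))) x"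
proof -
  have KB: "K x \<in> B" using x by (simp add: gdom_def)
  have KH: "K x = ct (H x v) ** H x v" unfolding K_def using G_eq[OF x(2), of "mat 1"] by simp
  then have "ct (K x) = K x" by simp
  then have ctq: "ct (q (K x)) = q (K x)" by (rule ct_q[OF KB])
  have "ct (H x v ** q (K x)) ** (H x v ** q (K x)) = q (K x) ** K x ** q (K x)"
    unfolding ct_mult ctq by (simp only: KH matrix_mul_assoc)
  then show "unitary (H x v ** q (K x))"
    by (intro unitary_mult_inverse) (simp only: q_mult[OF KB])
  show "\<sigma> x = conj_tuple (ct (H x v ** q (K x))) x"
    by (simp add: \<sigma>_def conj_tuple_def ctq G_eq[OF x(2)] matrix_mul_assoc)
qed

lemma projections_product_nth:
  assumes "x \<in> projections_product r"
  obtains v where "norm v = 1" "x $ i0 = r $ i0 *\<^sub>R outer v v"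
  using assms by (auto simp: projections_product_def weighted_projections_def rank_one_eq_outer)

lemma \<sigma>_orbit:
  assumes "x \<in> projections_product r" "x \<in> gdom"
  obtains u where "unitary u" "\<sigma> x = conj_tuple u x"
proof -
  obtain v where v: "x $ i0 = r $ i0 *\<^sub>R outer v v" using projections_product_nth[OF assms(1)] .
  show ?thesis using \<sigma>_eq_conj[OF assms(2) v] unitary_ct that by blast
qed

text \<open>The unitary \<open>H x v ** q (K x)\<close> depends on the phase of \<open>v\<close>.
  Replacing \<open>v\<close> by \<open>x $ i0 *v w i0\<close>, rescaled, gives a function smooth in
  \<open>x\<close>; on the product it only multiplies the unitary by a scalar, which is harmless for
  intertwining though it spoils unitarity.\<close>

definition "h x = H x ((1 / r $ i0) *\<^sub>R (x $ i0 *v w i0)) ** q (K x)"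

lemma C_on_h: "C_on k h gdom"
proof -
  have "C_on k (\<lambda>x. f j x) gdom" for j
    by (rule C_on_subset[OF ncpoly_smooth[OF f]]) auto
  then show ?thesis
    unfolding h_def[abs_def] H_def
    by (intro C_on_mm C_on_qK C_on_vec C_on_nth C_on_mv C_on_scaleR C_on_const C_on_id open_gdom)
qed

lemma h_p: "h p = mat 1"
proof -
  have "(1 / r $ i0) *\<^sub>R (p $ i0 *v w i0) = w i0"
    using r_pos[of i0] by (simp add: p_eq mv.scaleR_left outer_vec)
  then show ?thesis by (simp add: h_def H_p K_p q_1)
qed

lemma h_intertwines:
  assumes "x \<in> projections_product r" "x \<in> gdom"
  shows "x $ i ** h x = h x ** \<sigma> x $ i"
proof -
  obtain v where v: "x $ i0 = r $ i0 *\<^sub>R outer v v" using projections_product_nth[OF assms(1)] .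
  let ?c = "hdot (w i0) v" and ?u = "H x v ** q (K x)"
  have "(1 / r $ i0) *\<^sub>R (x $ i0 *v w i0) = ?c *s v"
    using r_pos[of i0] by (simp add: v mv.scaleR_left outer_vec)
  moreover have "H x (?c *s v) = mat ?c ** H x v"
    by (simp add: H_def mat_nth vec_eq_iff vector_scalar_commute)
  ultimately have h: "h x = mat ?c ** ?u" by (simp add: h_def matrix_mul_assoc)
  have u: "?u ** ct ?u = mat 1" using \<sigma>_eq_conj(1)[OF assms(2) v] by (simp add: unitary_def)
  have "?u ** \<sigma> x $ i = (?u ** ct ?u) ** x $ i ** ?u"
    unfolding \<sigma>_eq_conj(2)[OF assms(2) v] by (simp add: conj_tuple_def matrix_mul_assoc)
  then have "?u ** \<sigma> x $ i = x $ i ** ?u" unfolding u by simp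
  then have "h x ** \<sigma> x $ i = mat ?c ** (x $ i ** ?u)" unfolding h by (simp only: matrix_mul_assoc[symmetric])
  also have "\<dots> = x $ i ** (mat ?c ** ?u)" by (simp only: matrix_mul_assoc mat_commute[of ?c "x $ i"])
  finally show ?thesis unfolding h by simp
qed

lemma derivative_\<sigma>_orbit_tangent:
  assumes D: "(\<sigma> has_derivative D) (at p)" and \<xi>: "\<xi> \<in> orbit_tangent"
  shows "D \<xi> = 0"
proof -
  obtain a where a: "ct a = - a" "\<xi> = (\<chi> i. comm a (p $ i))" using \<xi> by (auto simp: orbit_tangent_def)
  obtain c where c: "c 0 = mat 1" "(c has_vector_derivative a) (at 0)"
    "eventually (\<lambda>t::real. unitary (c t)) (nhds 0)"
    using unitary_curve[OF a(1)] by metis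
  let ?\<gamma> = "\<lambda>t. conj_tuple (c t) p"
  have "(?\<gamma> has_derivative (\<lambda>t. \<chi> i. t *\<^sub>R comm a (p $ i))) (at 0)"
    unfolding conj_tuple_def using conj_curve_derivative[OF c(1,2) a(1)]
    by (intro has_derivative_vec_lambda) (simp add: has_vector_derivative_def)
  moreover have "(\<chi> i. t *\<^sub>R comm a (p $ i)) = t *\<^sub>R \<xi>" for t
    unfolding a(2) by (rule vec_eq_iff[THEN iffD2]) simp
  ultimately have "(?\<gamma> has_derivative (\<lambda>t. t *\<^sub>R \<xi>)) (at 0)" by simp
  then have 1: "((\<lambda>t. \<sigma> (?\<gamma> t)) has_derivative (\<lambda>t. D (t *\<^sub>R \<xi>))) (at 0)"
    by (rule has_derivative_compose) (use D c(1) in simp)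
  obtain S where S: "open S" "0 \<in> S" "\<And>t. t \<in> S \<Longrightarrow> unitary (c t)"
    using c(3) by (auto simp: eventually_nhds)
  have "((\<lambda>t::real. \<sigma> p) has_derivative (\<lambda>t. D (t *\<^sub>R \<xi>))) (at 0)"
    by (rule has_derivative_transform_within_open[OF 1 S(1,2)]) (use S(3) \<sigma>_conj in auto)
  then have "(\<lambda>t. D (t *\<^sub>R \<xi>)) = (\<lambda>t. 0)"
    using has_derivative_unique has_derivative_const by blast
  then have "D (1 *\<^sub>R \<xi>) = 0" by (rule fun_cong)
  then show ?thesis by simp
qed

text \<open>Differentiate \<open>x $ i ** h x = h x ** \<sigma> x $ i\<close> at \<open>p\<close>
  along the product, where \<open>h p = mat 1\<close> and \<open>\<sigma> p = p\<close>. If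
  \<open>D \<xi> = 0\<close>, then \<open>\<xi> $ i\<close> is the commutator of
  \<open>h' \<xi>\<close> with \<open>p $ i\<close>, with the same matrix for every
  \<open>i\<close>.\<close>

lemma derivative_\<sigma>_kernel:
  assumes D: "(\<sigma> has_derivative D) (at p)" and \<xi>: "\<xi> \<in> tangent" "D \<xi> = 0"
  shows "\<xi> \<in> orbit_tangent"
proof -
  note R = local_retraction_retr[unfolded local_retraction_def]
  have retr_p: "retr p = p" using R p_in p_in_retr_dom by auto
  have Cr: "C_on k retr retr_dom" for k using R by auto
  obtain L where L: "(retr has_derivative L) (at p)"
    using C_on_has_derivative[OF Cr p_in_retr_dom] .
  \<comment> \<open>The intertwining identity holds only on the product, so it is differentiated
    after precomposition with \<open>retr\<close>, whose derivative fixes \<xi>.\<close>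
  have L\<xi>: "L \<xi> = \<xi>"
  proof -
    have "\<xi> \<in> range L" using \<xi>(1) range_derivative_retr[OF L] by simp
    then obtain h where h: "\<xi> = L h" by auto
    have LL: "((\<lambda>x. retr (retr x)) has_derivative (\<lambda>h. L (L h))) (at p)"
      by (rule has_derivative_compose[OF L]) (use L retr_p in simp)
    have o: "open (retr_dom \<inter> retr -` retr_dom)"
      using R C_on_continuous[OF Cr[of 0]] by (intro continuous_open_preimage) auto
    have "(retr has_derivative (\<lambda>h. L (L h))) (at p)"
      by (rule has_derivative_transform_within_open[OF LL o]) (use R p_in_retr_dom retr_p in auto)
    from fun_cong[OF has_derivative_unique[OF this L], of h] show ?thesis using h by simp
  qed
  obtain h' where h': "(h has_derivative h') (at p)"
    using C_on_has_derivative[OF C_on_h p_in_gdom] .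
  let ?O = "retr_dom \<inter> retr -` gdom"
  have o: "open ?O"
    using R C_on_continuous[OF Cr[of 0]] open_gdom by (intro continuous_open_preimage) auto
  have pO: "p \<in> ?O" using p_in_retr_dom retr_p p_in_gdom by simp
  have hr: "((\<lambda>x. h (retr x)) has_derivative (\<lambda>v. h' (L v))) (at p)"
    by (rule has_derivative_compose[OF L]) (use h' retr_p in simp)
  have sr: "((\<lambda>x. \<sigma> (retr x)) has_derivative (\<lambda>v. D (L v))) (at p)"
    by (rule has_derivative_compose[OF L]) (use D retr_p in simp)
  have nth: "((\<lambda>x. g x $ i) has_derivative (\<lambda>v. g' v $ i)) (at p)"
    if "(g has_derivative g') (at p)" for g g' :: "complex^'d^'d^'n \<Rightarrow> complex^'d^'d^'n" and i
    using bounded_linear_vec_nth that by (rule bounded_linear.has_derivative)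
  have eq: "\<xi> $ i = h' \<xi> ** p $ i - p $ i ** h' \<xi>" for i
  proof -
    have 1: "((\<lambda>x. retr x $ i ** h (retr x)) has_derivative (\<lambda>v. p $ i ** h' (L v) + L v $ i)) (at p)"
      using mm.FDERIV[OF nth[OF L] hr] by (simp add: retr_p h_p)
    have 2: "((\<lambda>x. h (retr x) ** \<sigma> (retr x) $ i) has_derivative (\<lambda>v. D (L v) $ i + h' (L v) ** p $ i)) (at p)"
      using mm.FDERIV[OF hr nth[OF sr]] by (simp add: retr_p h_p \<sigma>_p)
    have "((\<lambda>x. retr x $ i ** h (retr x)) has_derivative (\<lambda>v. D (L v) $ i + h' (L v) ** p $ i)) (at p)"
      by (rule has_derivative_transform_within_open[OF 2 o pO]) (use R h_intertwines in auto)
    from fun_cong[OF has_derivative_unique[OF 1 this], of \<xi>] show ?thesis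
      using L\<xi> \<xi>(2) by (simp add: algebra_simps)
  qed
  let ?e = "h' \<xi>"
  \<comment> \<open>\<open>?e\<close> need not be skew-Hermitian. As \<xi> is Hermitian,
    \<open>- ct ?e\<close> yields the same commutators, and so does the average.\<close>
  let ?a = "(1/2) *\<^sub>R (?e - ct ?e)"
  have "\<xi> $ i = comm ?a (p $ i)" for i
  proof -
    obtain b where b: "ct b = - b" "\<xi> $ i = comm b (p $ i)" using \<xi>(1) by (auto simp: tangent_def)
    have "ct (\<xi> $ i) = \<xi> $ i" unfolding b(2) by (simp add: comm_def b(1) mm.minus_left mm.minus_right)
    then have "\<xi> $ i = p $ i ** ct ?e - ct ?e ** p $ i" using arg_cong[OF eq[of i], of ct] by simp
    then have "\<xi> $ i + \<xi> $ i = (?e ** p $ i - p $ i ** ?e) + (p $ i ** ct ?e - ct ?e ** p $ i)"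
      using eq[of i] by simp
    also have "\<dots> = comm (?e - ct ?e) (p $ i)" by (simp add: comm_def mm.diff_left mm.diff_right)
    finally have "comm ?a (p $ i) = (1/2) *\<^sub>R (\<xi> $ i + \<xi> $ i)" by (simp only: bilinear_comm)
    then show ?thesis by (simp only: scaleR_half_double)
  qed
  moreover have "ct ?a = - ?a" by (simp add: algebra_simps)
  ultimately show ?thesis unfolding orbit_tangent_def
    by (intro CollectI exI[of _ ?a]) (simp add: vec_eq_iff[where 'b='n])
qed

end

section \<open>The moduli space\<close>

lemma (in projection_tuple) slice_chart_projections_product:
  obtains U \<phi> V where "(U, \<phi>, V) \<in> euclidean_charts (dim tangent) (projections_product r)" "p \<in> U"
proof -
  have Cr: "C_on k retr retr_dom" for k using local_retraction_retr by (simp add: local_retraction_def)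
  obtain L where L: "(retr has_derivative L) (at p)" using C_on_has_derivative[OF Cr p_in_retr_dom] .
  \<comment> \<open>The constraint and its right inverse are taken to be zero, with
    \<open>H = {0}\<close>: only the image of the retraction is straightened.\<close>
  have lin: "linear (\<lambda>x::complex^'d^'d^'n. 0::real)" "linear (\<lambda>x::real. 0::complex^'d^'d^'n)"
    by (auto intro: linearI)
  have sub: "subspace (range L)" using has_derivative_linear[OF L] by (simp add: linear_subspace_image)
  then have 0: "0 \<in> range L" by (rule subspace_0)
  obtain N M \<Phi> \<Psi> where d: "diffeo N M \<Phi> \<Psi>" "p \<in> N" "\<Phi> ` (projections_product r \<inter> N) = M \<inter> range L"
    by (rule local_retraction_straighten[OF local_retraction_retr p_in_retr_dom p_in L lin, of "{0}"])
      (use 0 in auto)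
  show ?thesis
    using that[OF diffeo_euclidean_charts[OF d(1) sub _ d(3)]] d(2) p_in
    by (simp add: range_derivative_retr[OF L])
qed

context moduli_point
begin

lemma Mtilde_eq: "{x \<in> projections_product r. (\<Sum>i\<in>UNIV. x $ i) = (\<Sum>i\<in>UNIV. p $ i)} = Mtilde r"
  by (auto simp: Mtilde_def sum_p)

text \<open>All points of the product have Hermitian entries with the traces prescribed by
  \<open>r\<close>, so increments of the sum map are traceless Hermitian. On these \<mu> has a right
  inverse into \<open>tangent\<close>, by \<open>\<mu>_tangent\<close>.\<close>

lemma Mtilde_straighten:
  obtains N M \<Phi> \<Psi> where "diffeo N M \<Phi> \<Psi>" "p \<in> N" "\<Phi> p = 0"
    "(\<Phi> has_derivative (\<lambda>h. h)) (at p)" "(\<Psi> has_derivative (\<lambda>h. h)) (at 0)"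
    "\<Phi> ` (projections_product r \<inter> N) = M \<inter> tangent" "\<Phi> ` (Mtilde r \<inter> N) = M \<inter> level_tangent"
proof -
  have Cr: "C_on k retr retr_dom" for k using local_retraction_retr by (simp add: local_retraction_def)
  obtain L where L: "(retr has_derivative L) (at p)" using C_on_has_derivative[OF Cr p_in_retr_dom] .
  note rL = range_derivative_retr[OF L]
  let ?\<mu> = "\<lambda>x::complex^'d^'d^'n. \<Sum>i\<in>UNIV. x $ i"
  obtain R where R: "range R \<subseteq> tangent" "linear R" "\<forall>v\<in>?\<mu> ` tangent. ?\<mu> (R v) = v"
    using linear_exists_right_inverse_on[OF linear_\<mu> subspace_tangent] by auto
  have trace_nth: "x $ i \<in> hermitians \<and> trace (x $ i) = of_real (r $ i)"
    if x: "x \<in> projections_product r" for x :: "complex^'d^'d^'n" and i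
  proof -
    obtain v where v: "norm v = 1" "x $ i = r $ i *\<^sub>R outer v v"
      using x unfolding projections_product_def weighted_projections_def rank_one_eq_outer by blast
    then show ?thesis
      by (simp add: hermitians_def linear_scale[OF linear_trace] trace_outer hdot_self
          scaleR_conv_of_real[where 'a=complex])
  qed
  have \<mu>Y: "?\<mu> (x - p) \<in> traceless_hermitians" if x: "x \<in> projections_product r" for x
  proof (rule subspace_sum[OF subspace_traceless_hermitians])
    fix i
    show "(x - p) $ i \<in> traceless_hermitians"
      using trace_nth[OF x, of i] trace_nth[OF p_in, of i]
      by (simp add: traceless_hermitians_def hermitians_def trace_sub)
  qed
  have \<mu>L: "?\<mu> (L h) \<in> traceless_hermitians" for h
    using \<mu>_tangent rL by (metis (no_types, lifting) image_eqI rangeI)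
  have Lker: "{v \<in> range L. ?\<mu> v = 0} = level_tangent" unfolding rL level_tangent_def ..
  have RL: "R h \<in> range L" for h using R(1) rL by auto
  have \<mu>R: "?\<mu> (R h) = h" if "h \<in> traceless_hermitians" for h
    using R(3) that unfolding \<mu>_tangent by (rule bspec)
  obtain N M \<Phi> \<Psi> where A: "diffeo N M \<Phi> \<Psi>" "p \<in> N" "\<Phi> p = 0"
    "(\<Phi> has_derivative (\<lambda>h. h)) (at p)" "(\<Psi> has_derivative (\<lambda>h. h)) (at 0)"
    "\<Phi> ` (projections_product r \<inter> N) = M \<inter> range L"
    "\<Phi> ` ({x \<in> projections_product r. ?\<mu> x = ?\<mu> p} \<inter> N) = M \<inter> {v \<in> range L. ?\<mu> v = 0}"
    by (rule local_retraction_straighten[OF local_retraction_retr p_in_retr_dom p_in L linear_\<mu> R(2) \<mu>Y \<mu>L RL \<mu>R])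
  show ?thesis
    by (rule that[OF A(1-5) A(6)[unfolded rL] A(7)[unfolded Lker Mtilde_eq]])
qed

lemma slice_chart_Mtilde:
  obtains U \<phi> V W where "(U, \<phi>, V) \<in> euclidean_charts (dim tangent) (projections_product r)"
    "p \<in> U" "subspace W" "W \<subseteq> V" "dim W = dim level_tangent" "\<phi> ` (Mtilde r \<inter> U) = \<phi> ` U \<inter> W"
proof -
  obtain N M \<Phi> \<Psi> where d: "diffeo N M \<Phi> \<Psi>" "p \<in> N"
    and im: "\<Phi> ` (projections_product r \<inter> N) = M \<inter> tangent" "\<Phi> ` (Mtilde r \<inter> N) = M \<inter> level_tangent"
    using Mtilde_straighten by metis
  let ?U = "projections_product r \<inter> N"
  have "Mtilde r \<inter> ?U = Mtilde r \<inter> N" by (auto simp: Mtilde_def)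
  then have "\<Phi> ` (Mtilde r \<inter> ?U) = M \<inter> level_tangent" using im(2) by simp
  also have "\<dots> = \<Phi> ` ?U \<inter> level_tangent" unfolding im(1) by (auto simp: level_tangent_def)
  finally have "\<Phi> ` (Mtilde r \<inter> ?U) = \<Phi> ` ?U \<inter> level_tangent" .
  moreover have "level_tangent \<subseteq> tangent" by (auto simp: level_tangent_def)
  ultimately show ?thesis
    using that[OF diffeo_euclidean_charts[OF d(1) subspace_tangent refl im(1)] _ subspace_level_tangent _ refl]
      d(2) p_in by blast
qed

lemma gauge_exists: obtains i0 f B q where "gauge r p w i0 f B q"
proof -
  obtain i0 :: 'n where True by simp
  have "\<forall>j. \<exists>f. ncpoly f \<and> f p *v w i0 = axis j 1" using ncpoly_cyclic by blast
  then obtain f where f: "\<And>j. ncpoly (f j)" "\<And>j. f j p *v w i0 = axis j 1"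
    using choice[of "\<lambda>j f. ncpoly f \<and> f p *v w i0 = axis j 1"] by blast
  obtain B :: "(complex^'d^'d) set" and q where B: "open B" "mat 1 \<in> B" "\<And>k. C_on k q B" "q (mat 1) = mat 1"
    "\<And>K. K \<in> B \<Longrightarrow> q K ** K ** q K = mat 1" "\<And>K. K \<in> B \<Longrightarrow> ct K = K \<Longrightarrow> ct (q K) = q K"
    using inverse_square_root by metis
  have "gauge r p w i0 f B q" by unfold_locales (fact f B)+
  then show ?thesis by (rule that)
qed

end

context gauge
begin

lemma \<sigma>_Mtilde:
  assumes "x \<in> Mtilde r" "x \<in> gdom"
  shows "\<sigma> x \<in> Mtilde r \<and> \<sigma> x \<in> gdom \<and> unitary_orbit (\<sigma> x) = unitary_orbit x"
proof -
  have "x \<in> projections_product r" using assms by (simp add: Mtilde_def)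
  then obtain u where "unitary u" "\<sigma> x = conj_tuple u x" using \<sigma>_orbit assms(2) by metis
  then show ?thesis using assms by (simp add: Mtilde_conj gdom_conj unitary_orbit_conj_tuple)
qed

lemma orbit_invariant:
  assumes "unitary_orbit x = unitary_orbit y"
  shows "x \<in> gdom \<longleftrightarrow> y \<in> gdom" "\<sigma> y = \<sigma> x" "K y = K x"
proof -
  obtain u where "unitary u" "y = conj_tuple u x" using unitary_orbit_eqD[OF assms] .
  then show "x \<in> gdom \<longleftrightarrow> y \<in> gdom" "\<sigma> y = \<sigma> x" "K y = K x"
    by (simp_all add: gdom_conj \<sigma>_conj K_conj)
qed

lemma slice_chart_moduli:
  "\<exists>(U, \<psi>, V)\<in>slice_charts (Mtilde r) unitary_orbit (dim level_tangent - dim orbit_tangent). unitary_orbit p \<in> U"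
proof -
  obtain N0 M0 \<Phi>0 \<Psi>0 where d0: "diffeo N0 M0 \<Phi>0 \<Psi>0" "p \<in> N0" "\<Phi>0 p = 0"
    "(\<Phi>0 has_derivative (\<lambda>h. h)) (at p)" "(\<Psi>0 has_derivative (\<lambda>h. h)) (at 0)"
    "\<Phi>0 ` (Mtilde r \<inter> N0) = M0 \<inter> level_tangent"
    using Mtilde_straighten by metis
  obtain U \<rho> P where \<rho>: "local_retraction U \<rho> (Mtilde r)" "p \<in> U" "(\<rho> has_derivative P) (at p)"
    "range P = level_tangent"
    using straighten_local_retraction[OF d0(1-5) subspace_level_tangent d0(6)] .
  have \<rho>p: "\<rho> p = p" using \<rho>(1,2) p_Mtilde by (simp add: local_retraction_def)
  obtain D where D: "(\<sigma> has_derivative D) (at p)" using C_on_has_derivative[OF C_on_\<sigma> p_in_gdom] .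
  have linD: "linear D" using D by (rule has_derivative_linear)
  let ?S = "{x \<in> Mtilde r \<inter> gdom. \<sigma> x = x}"
  have \<sigma>\<sigma>: "\<sigma> (\<sigma> x) = \<sigma> x" if "x \<in> Mtilde r" "x \<in> gdom" for x
    using orbit_invariant(2)[of x "\<sigma> x"] \<sigma>_Mtilde[OF that] by simp
  have ret: "local_retraction (U \<inter> \<rho> -` gdom) (\<lambda>x. \<sigma> (\<rho> x)) ?S"
    by (rule local_retraction_compose[OF \<rho>(1) open_gdom C_on_\<sigma>]) (use \<sigma>_Mtilde \<sigma>\<sigma> in auto)
  have p: "p \<in> U \<inter> \<rho> -` gdom" "p \<in> ?S" using \<rho>(2) \<rho>p p_in_gdom p_Mtilde \<sigma>_p by auto
  have DP: "((\<lambda>x. \<sigma> (\<rho> x)) has_derivative (\<lambda>h. D (P h))) (at p)"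
    by (rule has_derivative_compose[OF \<rho>(3)]) (use D \<rho>p in simp)
  have range: "range (\<lambda>h. D (P h)) = D ` level_tangent"
    unfolding \<rho>(4)[symmetric] by (simp add: image_image)
  have sub: "subspace (D ` level_tangent)"
    using linD subspace_level_tangent by (rule linear_subspace_image)
  have lin: "linear (\<lambda>x::complex^'d^'d^'n. 0::real)" "linear (\<lambda>x::real. 0::complex^'d^'d^'n)"
    by (auto intro: linearI)
  have 0: "0 \<in> range (\<lambda>h. D (P h))" unfolding range using sub by (rule subspace_0)
  obtain N M \<Phi> \<Psi> where d: "diffeo N M \<Phi> \<Psi>" "p \<in> N" "\<Phi> ` (?S \<inter> N) = M \<inter> range (\<lambda>h. D (P h))"
    by (rule local_retraction_straighten[OF ret p DP lin, of "{0}"]) (use 0 in auto)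
  have "{\<xi> \<in> level_tangent. D \<xi> = 0} = orbit_tangent"
    using derivative_\<sigma>_orbit_tangent[OF D] derivative_\<sigma>_kernel[OF D] orbit_tangent_level
    by (auto simp: level_tangent_def)
  then have dim: "dim (D ` level_tangent) = dim level_tangent - dim orbit_tangent"
    using dim_image_kernel[OF linD subspace_level_tangent] by simp
  have s: "orbit_slice (Mtilde r) unitary_orbit (dim level_tangent - dim orbit_tangent) gdom \<sigma> N M \<Phi> \<Psi>
      (D ` level_tangent)"
  proof
    show "y \<in> gdom \<and> \<sigma> y = \<sigma> x"
      if "x \<in> Mtilde r" "x \<in> gdom" "y \<in> Mtilde r" "unitary_orbit x = unitary_orbit y" for x y
      using orbit_invariant[OF that(4)] that(2) by simp
  qed (use open_gdom C_on_\<sigma> \<sigma>_Mtilde d(1) sub dim d(3)[unfolded range] in auto)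
  interpret orbit_slice "Mtilde r" unitary_orbit "dim level_tangent - dim orbit_tangent" gdom \<sigma> N M \<Phi> \<Psi>
      "D ` level_tangent" by (rule s)
  have "unitary_orbit p \<in> chart_dom" using in_chart_dom_iff[OF p_Mtilde] p_in_gdom \<sigma>_p d(2) by simp
  moreover have "(chart_dom, coord, D ` level_tangent)
      \<in> slice_charts (Mtilde r) unitary_orbit (dim level_tangent - dim orbit_tangent)"
    using s unfolding slice_charts_def by blast
  ultimately show ?thesis by blast
qed

text \<open>For \<open>y\<close> in \<open>gdom\<close>, \<open>\<sigma>\<close> selects a point of
  each orbit and so distinguishes the two orbits. Otherwise \<open>K y\<close> lies outside
  \<open>B\<close> while \<open>K p\<close> lies inside, and \<open>K\<close> is invariant
  everywhere.\<close>

lemma separated: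
  assumes y: "y \<in> Mtilde r" "unitary_orbit p \<noteq> unitary_orbit y"
  shows "\<exists>W (g :: complex^'d^'d^'n \<Rightarrow> complex^'d^'d^'n). open W \<and> p \<in> W \<and> y \<in> W \<and>
      continuous_on W g \<and> g p \<noteq> g y \<and>
      (\<forall>u\<in>Mtilde r \<inter> W. \<forall>v\<in>Mtilde r. unitary_orbit u = unitary_orbit v \<longrightarrow> v \<in> W \<and> g v = g u)"
proof (cases "y \<in> gdom")
  case True
  have "\<sigma> p \<noteq> \<sigma> y"
    using y \<sigma>_Mtilde[OF p_Mtilde p_in_gdom] \<sigma>_Mtilde[OF y(1) True] by auto
  moreover have "v \<in> gdom" "\<sigma> v = \<sigma> u" if "u \<in> Mtilde r \<inter> gdom" "unitary_orbit u = unitary_orbit v" for u v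
    using orbit_invariant(1,2)[OF that(2)] that(1) by auto
  ultimately show ?thesis
    using open_gdom p_in_gdom True C_on_continuous[OF C_on_\<sigma>[of 0]]
    by (intro exI[of _ gdom] exI[of _ \<sigma>] conjI ballI impI)
next
  case False
  then have "K p \<noteq> K y" using p_in_gdom by (auto simp: gdom_def)
  \<comment> \<open>The matrix \<open>K\<close> is repeated in every slot so that both cases have a
    separating function with values in tuples.\<close>
  then have "(\<chi> i::'n. K p) \<noteq> (\<chi> i. K y)" by (simp add: vec_eq_iff[where 'b='n])
  moreover have "C_on 0 (\<lambda>x. \<chi> i::'n. K x) UNIV" by (intro C_on_vec C_on_K open_UNIV)
  then have "continuous_on UNIV (\<lambda>x. \<chi> i::'n. K x)" by (rule C_on_continuous)
  ultimately show ?thesis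
    using orbit_invariant(3)
    by (intro exI[of _ UNIV] exI[of _ "\<lambda>x. \<chi> i::'n. K x"] conjI ballI impI open_UNIV UNIV_I
        arg_cong[where f = "\<lambda>A. \<chi> i::'n. A"])
qed

end

lemma projection_tuple_exists:
  assumes "\<And>i. 0 < r $ i" "p \<in> projections_product r"
  obtains w where "projection_tuple r p w"
proof -
  have "\<forall>i. \<exists>v. norm v = 1 \<and> p $ i = r $ i *\<^sub>R outer v v"
    using assms(2) unfolding projections_product_def weighted_projections_def rank_one_eq_outer by blast
  then obtain w where "\<And>i. norm (w i) = 1" "\<And>i. p $ i = r $ i *\<^sub>R outer (w i) (w i)" by metis
  then have "projection_tuple r p w" using assms(1) by unfold_locales
  then show ?thesis by (rule that)
qed

theorem corollary4p1p13:
  fixes m n :: nat and r :: "real^'n"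
  assumes "m \<ge> 1" and "n \<ge> 1"
    and "CARD('d::finite) = m + 1" and "CARD('n) = n"
    and "\<And>i. 0 < r $ i"
    and "\<not> on_wall TYPE('d) r"
  shows "\<exists>k (A :: ((complex^'d^'d^'n) set, complex^'d^'d^'n) chart set).
    submanifold_of k (Mtilde r :: (complex^'d^'d^'n) set) (projections_product r) \<and>
    smooth_atlas (2 * int m * (int n - int m - 2)) (moduli_topology r) A \<and>
    submersion (top_of_set (Mtilde r)) (euclidean_charts k (Mtilde r)) (moduli_topology r) A unitary_orbit"
proof -
  let ?X = "Mtilde r :: (complex^'d^'d^'n) set"
  let ?d = "CARD('d)" and ?n = "CARD('n)"
  \<comment> \<open>The dimension of the level set. The subtraction is exact as soon as
    \<open>?X\<close> has a point, by \<open>dim_level_tangent\<close>; for empty \<open>?X\<close>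
    any \<open>k\<close> will do.\<close>
  define k where "k = 2 * ?d * ?n + 1 - ?d * ?d - 2 * ?n"
  define e where "e = k - (?d * ?d - 1)"
  have point: "\<exists>w. moduli_point r p w" if "p \<in> ?X" for p
  proof -
    have "p \<in> projections_product r" using that by (simp add: Mtilde_def)
    then obtain w where "projection_tuple r p w" using projection_tuple_exists assms(5) by metis
    then show ?thesis
      using that assms(6) unfolding moduli_point_def moduli_point_axioms_def by (auto simp: Mtilde_def)
  qed
  have dims: "dim (moduli_point.level_tangent p) = k"
    "dim (moduli_point.level_tangent p) - dim (moduli_point.orbit_tangent p) = e"
    "int e = 2 * int m * (int n - int m - 2)" if p: "p \<in> ?X" for p
  proof -
    obtain w where "moduli_point r p w" using point[OF p] by blast
    then interpret moduli_point r p w .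
    have 1: "dim level_tangent + ?d * ?d + 2 * ?n = 2 * ?d * ?n + 1" by (rule dim_level_tangent)
    have 2: "dim orbit_tangent + 1 = ?d * ?d" by (rule dim_orbit_tangent)
    have 3: "dim orbit_tangent \<le> dim level_tangent" by (rule dim_subset[OF orbit_tangent_level])
    show a: "dim level_tangent = k" unfolding k_def using 1 by linarith
    show b: "dim level_tangent - dim orbit_tangent = e" unfolding e_def a[symmetric] using 2 by linarith
    have "int e = int (dim level_tangent) - int (dim orbit_tangent)" using b 3 by linarith
    also have "\<dots> = 2 * int ?d * int ?n + 2 - 2 * (int ?d * int ?d) - 2 * int ?n"
      using arg_cong[OF 1, of int] arg_cong[OF 2, of int] by simp
    also have "\<dots> = 2 * int m * (int n - int m - 2)"
      unfolding assms(3,4) by (simp add: algebra_simps)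
    finally show "int e = 2 * int m * (int n - int m - 2)" .
  qed
  have "submanifold_of k ?X (projections_product r)"
    unfolding submanifold_of_def
  proof (intro conjI exI[of _ "2 * ?d * ?n - 2 * ?n"] ballI)
    show "?X \<subseteq> projections_product r" by (auto simp: Mtilde_def)
    show "euclidean_submanifold (2 * ?d * ?n - 2 * ?n) (projections_product r :: (complex^'d^'d^'n) set)"
      unfolding euclidean_submanifold_def
    proof
      fix p :: "complex^'d^'d^'n" assume "p \<in> projections_product r"
      then obtain w where "projection_tuple r p w" using projection_tuple_exists assms(5) by metis
      then interpret projection_tuple r p w .
      have "dim tangent = 2 * ?d * ?n - 2 * ?n" using dim_tangent by simp
      then show "\<exists>(U, \<phi>, V)\<in>euclidean_charts (2 * ?d * ?n - 2 * ?n) (projections_product r). p \<in> U"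
        using slice_chart_projections_product by (metis (no_types, lifting) case_prodI)
    qed
    fix p assume p: "p \<in> ?X"
    then obtain w where "moduli_point r p w" using point by blast
    then interpret moduli_point r p w .
    have "dim tangent = 2 * ?d * ?n - 2 * ?n" using dim_tangent by simp
    then obtain U \<phi> V W where "(U, \<phi>, V) \<in> euclidean_charts (2 * ?d * ?n - 2 * ?n) (projections_product r)"
      "p \<in> U" "subspace W" "W \<subseteq> V" "dim W = k" "\<phi> ` (?X \<inter> U) = \<phi> ` U \<inter> W"
      using slice_chart_Mtilde dims(1)[OF p] by metis
    then show "\<exists>(U, \<phi>, V)\<in>euclidean_charts (2 * ?d * ?n - 2 * ?n) (projections_product r). \<exists>W. p \<in> U \<and>
        subspace W \<and> W \<subseteq> V \<and> dim W = k \<and> \<phi> ` (?X \<inter> U) = \<phi> ` U \<inter> W"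
      by blast
  qed
  moreover have "\<exists>A :: ((complex^'d^'d^'n) set, complex^'d^'d^'n) chart set.
    smooth_atlas (2 * int m * (int n - int m - 2)) (moduli_topology r) A \<and>
    submersion (top_of_set ?X) (euclidean_charts k ?X) (moduli_topology r) A unitary_orbit"
  proof (cases "?X = {}")
    \<comment> \<open>The integer 2m(n-m-2) may be negative here; the empty atlas fits every
      dimension.\<close>
    case True
    have "topspace (moduli_topology r :: (complex^'d^'d^'n) set topology) = {}"
      using True by (simp add: topspace_moduli_topology moduli_space_def)
    moreover have "second_countable (moduli_topology r :: (complex^'d^'d^'n) set topology)"
      unfolding moduli_topology_def by (rule second_countable_quotient_topology[OF smooth_transport_Mtilde])
    moreover have "continuous_map (top_of_set ?X) (moduli_topology r) unitary_orbit"
      unfolding moduli_topology_def by (rule quotient_imp_continuous_map[OF quotient_map_quotient_topology])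
    ultimately show ?thesis
      by (intro exI[of _ "{}"]) (auto simp: smooth_atlas_def submersion_def Hausdorff_space_def)
  next
    case False
    \<comment> \<open>A point of \<open>?X\<close> provides a tangent space count, which shows in
      particular that this integer is nonnegative.\<close>
    then have e: "int e = 2 * int m * (int n - int m - 2)" using dims(3) by blast
    have gauge: "\<exists>w i0 f B q. gauge r p w i0 f B q" if "p \<in> ?X" for p
      using point[OF that] moduli_point.gauge_exists by metis
    have "Hausdorff_space (quotient_topology (top_of_set ?X) unitary_orbit)"
    proof (rule Hausdorff_quotient_topology[where 'c = "complex^'d^'d^'n"], goal_cases)
      case (1 x y)
      obtain w i0 f B q where "gauge r x w i0 f B q" using gauge[OF 1(1)] by (elim exE)
      then show ?case using 1(2,3) by (rule gauge.separated)
    qed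
    moreover have "\<exists>(U, \<psi>, V)\<in>slice_charts ?X unitary_orbit e. unitary_orbit x \<in> U" if x: "x \<in> ?X" for x
    proof -
      obtain w i0 f B q where "gauge r x w i0 f B q" using gauge[OF x] by (elim exE)
      then show ?thesis unfolding dims(2)[OF x, symmetric] by (rule gauge.slice_chart_moduli)
    qed
    ultimately have "smooth_atlas (int e) (moduli_topology r) (slice_charts ?X unitary_orbit e)"
      unfolding moduli_topology_def by (rule smooth_atlas_slice_charts[OF _ smooth_transport_Mtilde])
    moreover have "submersion (top_of_set ?X) (euclidean_charts k ?X) (moduli_topology r)
        (slice_charts ?X unitary_orbit e) unitary_orbit"
      unfolding moduli_topology_def by (rule submersion_slice_charts[OF smooth_transport_Mtilde])
    ultimately show ?thesis unfolding e by blast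
  qed
  ultimately show ?thesis by blast
qed

end
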